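(* Model checking and satisfiability checking over finite linear orders for $\mathrm{D}|_{\mathcal{H}om}$-formulas (and likewise for $\mathrm{D}|_{\mathcal{H}om,\dot\sqsubset}$-formulas) are both $\mathbf{PSPACE}$-hard.
   Context: Formulas: $\varphi ::= p \mid \neg\varphi \mid \varphi\vee\varphi \mid \langle D\rangle\varphi$, $p$ in a finite set $\mathcal{AP}$. Over a finite linear order $\mathbb{S}=(S,<)$, intervals are $[x,y]$ with $x\le y$; an interval model $(\mathbb{I}(\mathbb{S}),\mathcal{V})$ assigns to each $p$ a set $\mathcal{V}(p)$ of intervals; $p$ holds on $[x,y]$ iff $[x,y]\in\mathcal{V}(p)$, Boolean connectives as usual, and $\langle D\rangle\psi$ holds on $[x,y]$ iff $\psi$ holds on some $[x',y']\circ[x,y]$, where $\circ$ is the proper sub-interval relation ($x\le x'$, $y'\le y$, $[x',y']\ne[x,y]$) for $\mathrm{D}|_{\mathcal{H}om}$ and the strict one ($x<x'$, $y'<y$) for $\mathrm{D}|_{\mathcal{H}om,\dot\sqsubset}$. Models are homogeneous: $[x,y]\in\mathcal{V}(p)$ iff $[x',x']\in\mathcal{V}(p)$ for all $x'\in[x,y]$. Satisfiability checking: given $\varphi$, decide whether $\varphi$ holds on some interval of some homogeneous interval model over a finite linear order. Model checking: given a finite Kripke structure $\mathcal{K}=(\mathcal{AP},W,E,\mu,s_0)$ ($W$ finite, $E\subseteq W\times W$ left-total, $\mu:W\to2^{\mathcal{AP}}$, $s_0\in W$) and $\varphi$, decide whether every initial trace $w=\mu(s_0)\cdots\mu(s_n)$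 (for a path $s_0\cdots s_n$ along $E$) satisfies $\mathbf{M}(w),[0,|w|-1]\models\varphi$, where $\mathbf{M}(w)$ is the homogeneous model over $\{0,\dots,|w|-1\}$ with $[x,y]\in\mathcal{V}(p)$ iff $p\in w[x']$ for all $x'\in[x,y]$. *)

theory Defs
  imports "HOL-Computational_Algebra.Polynomial"
begin

section \<open>Deterministic multi-tape Turing machines\<close>

datatype symbol = Blank | Left_End | Bit bool | Aux nat

datatype direction = Left | Stay | Right

record 'q tm =
  ntapes :: nat
  states :: "'q set"
  alphabet :: "symbol set"
  start :: 'q
  accept :: 'q
  reject :: 'q
  delta :: "'q \<Rightarrow> symbol list \<Rightarrow> 'q \<times> (symbol \<times> direction) list"

text \<open>Only the values of \<^term>\<open>delta M\<close> on \<^term>\<open>states M\<close> and on \<^term>\<open>alphabet M\<close> matter;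
  the closure condition below makes this restriction a finite table.\<close>

definition wf_tm :: "'q tm \<Rightarrow> bool" where
  "wf_tm M \<longleftrightarrow>
     ntapes M \<ge> 1 \<and> finite (states M) \<and> finite (alphabet M) \<and>
     {Blank, Left_End, Bit False, Bit True} \<subseteq> alphabet M \<and>
     {start M, accept M, reject M} \<subseteq> states M \<and> accept M \<noteq> reject M \<and>
     (\<forall>q \<in> states M. \<forall>as. length as = ntapes M \<and> set as \<subseteq> alphabet M \<longrightarrow>
        (case delta M q as of (q', acts) \<Rightarrow>
           q' \<in> states M \<and> length acts = ntapes M \<and> fst ` set acts \<subseteq> alphabet M))"

text \<open>A tape is infinite to the right only and is given by its contents and its head position.
  A left move from cell 0 leaves the head where it is.\<close>

type_synonym tape = "(nat \<Rightarrow> symbol) \<times> nat"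

type_synonym 'q config = "'q \<times> tape list"

fun act :: "symbol \<times> direction \<Rightarrow> tape \<Rightarrow> tape" where
  "act (a, d) (c, h) =
     (c(h := a), case d of Left \<Rightarrow> h - 1 | Stay \<Rightarrow> h | Right \<Rightarrow> Suc h)"

definition halted :: "'q tm \<Rightarrow> 'q config \<Rightarrow> bool" where
  "halted M cf \<longleftrightarrow> fst cf \<in> {accept M, reject M}"

definition step :: "'q tm \<Rightarrow> 'q config \<Rightarrow> 'q config" where
  "step M cf =
     (if halted M cf then cf
      else case delta M (fst cf) (map (\<lambda>(c, h). c h) (snd cf)) of
        (q', acts) \<Rightarrow> (q', map2 act acts (snd cf)))"

definition word_tape :: "bool list \<Rightarrow> nat \<Rightarrow> symbol" where
  "word_tape x i =
     (if i = 0 then Left_End else if i \<le> length x then Bit (x ! (i - 1)) else Blank)"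

text \<open>The input is written on tape 0.\<close>

definition initial :: "'q tm \<Rightarrow> bool list \<Rightarrow> 'q config" where
  "initial M x =
     (start M, (word_tape x, 0) # replicate (ntapes M - 1) (word_tape [], 0))"

definition run :: "'q tm \<Rightarrow> bool list \<Rightarrow> nat \<Rightarrow> 'q config" where
  "run M x t = (step M ^^ t) (initial M x)"


section \<open>PSPACE-hardness\<close>

text \<open>Machine states are drawn from \<^typ>\<open>nat\<close>; as state sets are finite, this is no restriction.
  Space is measured by the cells visited on every tape, including the input tape.\<close>

definition decides :: "'q tm \<Rightarrow> bool list set \<Rightarrow> bool" where
  "decides M L \<longleftrightarrow>
     (\<forall>x. \<exists>t. fst (run M x t) = (if x \<in> L then accept M else reject M))"

definition runs_in_space :: "'q tm \<Rightarrow> (nat \<Rightarrow> nat) \<Rightarrow> bool" where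
  "runs_in_space M s \<longleftrightarrow>
     (\<forall>x t. \<forall>(c, h) \<in> set (snd (run M x t)). h < s (length x))"

definition PSPACE :: "bool list set set" where
  "PSPACE = {L. \<exists>(M :: nat tm) (p :: nat poly).
     wf_tm M \<and> decides M L \<and> runs_in_space M (poly p)}"

text \<open>The output is read off the last tape.\<close>

definition computes_in_time :: "'q tm \<Rightarrow> (bool list \<Rightarrow> bool list) \<Rightarrow> (nat \<Rightarrow> nat) \<Rightarrow> bool" where
  "computes_in_time M f b \<longleftrightarrow>
     (\<forall>x. \<exists>t \<le> b (length x).
        halted M (run M x t) \<and> fst (last (snd (run M x t))) = word_tape (f x))"

definition polytime_computable :: "(bool list \<Rightarrow> bool list) \<Rightarrow> bool" where
  "polytime_computable f \<longleftrightarrow>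
     (\<exists>(M :: nat tm) (p :: nat poly). wf_tm M \<and> computes_in_time M f (poly p))"

definition polytime_reducible :: "bool list set \<Rightarrow> bool list set \<Rightarrow> bool"
    (infix "\<le>\<^sub>p" 50) where
  "A \<le>\<^sub>p B \<longleftrightarrow> (\<exists>f. polytime_computable f \<and> (\<forall>x. x \<in> A \<longleftrightarrow> f x \<in> B))"

definition PSPACE_hard :: "bool list set \<Rightarrow> bool" where
  "PSPACE_hard B \<longleftrightarrow> (\<forall>A \<in> PSPACE. A \<le>\<^sub>p B)"


section \<open>The logic D over finite linear orders\<close>

datatype form = Atom nat | Neg form | Or form form | Dia form

primrec atoms :: "form \<Rightarrow> nat set" where
  "atoms (Atom p) = {p}"
| "atoms (Neg \<phi>) = atoms \<phi>"
| "atoms (Or \<phi> \<psi>) = atoms \<phi> \<union> atoms \<psi>"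
| "atoms (Dia \<phi>) = atoms \<phi>"

record 'a imodel =
  points :: "'a set"
  lt :: "'a rel"
  val :: "nat \<Rightarrow> ('a \<times> 'a) set"

definition finite_linear_order :: "'a set \<Rightarrow> 'a rel \<Rightarrow> bool" where
  "finite_linear_order S r \<longleftrightarrow> finite S \<and> strict_linear_order_on S r"

definition intervals :: "'a set \<Rightarrow> 'a rel \<Rightarrow> ('a \<times> 'a) set" where
  "intervals S r = {(x, y). x \<in> S \<and> y \<in> S \<and> (x, y) \<in> r\<^sup>=}"

definition interval_model :: "nat set \<Rightarrow> 'a imodel \<Rightarrow> bool" where
  "interval_model AP M \<longleftrightarrow>
     finite_linear_order (points M) (lt M) \<and>
     (\<forall>p \<in> AP. val M p \<subseteq> intervals (points M) (lt M))"

definition homogeneous :: "nat set \<Rightarrow> 'a imodel \<Rightarrow> bool" where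
  "homogeneous AP M \<longleftrightarrow>
     (\<forall>p \<in> AP. \<forall>(x, y) \<in> intervals (points M) (lt M).
        (x, y) \<in> val M p \<longleftrightarrow>
        (\<forall>z \<in> points M. (x, z) \<in> (lt M)\<^sup>= \<and> (z, y) \<in> (lt M)\<^sup>= \<longrightarrow> (z, z) \<in> val M p))"

text \<open>A sub-interval relation takes the order, the inner interval and the outer interval.\<close>

type_synonym 'a subrel = "'a rel \<Rightarrow> 'a \<times> 'a \<Rightarrow> 'a \<times> 'a \<Rightarrow> bool"

definition proper_sub :: "'a subrel" where
  "proper_sub r = (\<lambda>(x', y') (x, y).
     (x, x') \<in> r\<^sup>= \<and> (y', y) \<in> r\<^sup>= \<and> (x', y') \<noteq> (x, y))"

definition strict_sub :: "'a subrel" where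
  "strict_sub r = (\<lambda>(x', y') (x, y). (x, x') \<in> r \<and> (y', y) \<in> r)"

primrec holds :: "'a subrel \<Rightarrow> 'a imodel \<Rightarrow> 'a \<times> 'a \<Rightarrow> form \<Rightarrow> bool" where
  "holds sub M I (Atom p) \<longleftrightarrow> I \<in> val M p"
| "holds sub M I (Neg \<phi>) \<longleftrightarrow> \<not> holds sub M I \<phi>"
| "holds sub M I (Or \<phi> \<psi>) \<longleftrightarrow> holds sub M I \<phi> \<or> holds sub M I \<psi>"
| "holds sub M I (Dia \<phi>) \<longleftrightarrow>
     (\<exists>J \<in> intervals (points M) (lt M). sub (lt M) J I \<and> holds sub M J \<phi>)"

text \<open>The set of propositions is the set of those occurring in the formula. Every finite linear
  order is isomorphic to one whose points are natural numbers (under some order, not necessarily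
  the usual one).\<close>

definition satisfiable :: "nat subrel \<Rightarrow> form \<Rightarrow> bool" where
  "satisfiable sub \<phi> \<longleftrightarrow>
     (\<exists>M :: nat imodel. interval_model (atoms \<phi>) M \<and> homogeneous (atoms \<phi>) M \<and>
        (\<exists>I \<in> intervals (points M) (lt M). holds sub M I \<phi>))"


section \<open>Kripke structures and model checking\<close>

record kripke =
  props :: "nat set"
  worlds :: "nat set"
  edges :: "nat rel"
  label :: "nat \<Rightarrow> nat set"
  init :: nat

definition wf_kripke :: "kripke \<Rightarrow> bool" where
  "wf_kripke K \<longleftrightarrow>
     finite (props K) \<and> finite (worlds K) \<and>
     edges K \<subseteq> worlds K \<times> worlds K \<and> (\<forall>s \<in> worlds K. \<exists>s'. (s, s') \<in> edges K) \<and>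
     (\<forall>s \<in> worlds K. label K s \<subseteq> props K) \<and> init K \<in> worlds K"

definition initial_trace :: "kripke \<Rightarrow> nat set list \<Rightarrow> bool" where
  "initial_trace K w \<longleftrightarrow>
     (\<exists>ss. ss \<noteq> [] \<and> hd ss = init K \<and> successively (\<lambda>s s'. (s, s') \<in> edges K) ss \<and>
        w = map (label K) ss)"

definition trace_model :: "nat set list \<Rightarrow> nat imodel" where
  "trace_model w =
     \<lparr>points = {0..<length w}, lt = less_than,
      val = (\<lambda>p. {(x, y). x \<le> y \<and> y < length w \<and> (\<forall>z \<in> {x..y}. p \<in> w ! z)})\<rparr>"

definition model_checks :: "nat subrel \<Rightarrow> kripke \<Rightarrow> form \<Rightarrow> bool" where
  "model_checks sub K \<phi> \<longleftrightarrow>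
     (\<forall>w. initial_trace K w \<longrightarrow> holds sub (trace_model w) (0, length w - 1) \<phi>)"


section \<open>The decision problems as languages\<close>

text \<open>Numbers are written in binary, least significant bit first; lists are made self-delimiting by
  a flag bit before each element; formulas are written in Polish notation. A Kripke structure is
  given by its propositions, its worlds, each with its successors and its label, and its initial
  world.\<close>

fun bits :: "nat \<Rightarrow> bool list" where
  "bits n = (if n = 0 then [] else odd n # bits (n div 2))"

declare bits.simps [simp del]

definition enc_list :: "('a \<Rightarrow> bool list) \<Rightarrow> 'a list \<Rightarrow> bool list" where
  "enc_list e xs = concat (map (\<lambda>x. True # e x) xs) @ [False]"

definition enc_nat :: "nat \<Rightarrow> bool list" where
  "enc_nat n = enc_list (\<lambda>b. [b]) (bits n)"

definition enc_set :: "nat set \<Rightarrow> bool list" where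
  "enc_set A = enc_list enc_nat (sorted_list_of_set A)"

primrec enc_form :: "form \<Rightarrow> bool list" where
  "enc_form (Atom p) = [False, False] @ enc_nat p"
| "enc_form (Neg \<phi>) = [False, True] @ enc_form \<phi>"
| "enc_form (Or \<phi> \<psi>) = [True, False] @ enc_form \<phi> @ enc_form \<psi>"
| "enc_form (Dia \<phi>) = [True, True] @ enc_form \<phi>"

definition enc_world :: "kripke \<Rightarrow> nat \<Rightarrow> bool list" where
  "enc_world K s = enc_nat s @ enc_set (edges K `` {s}) @ enc_set (label K s)"

definition enc_kripke :: "kripke \<Rightarrow> bool list" where
  "enc_kripke K =
     enc_set (props K) @ enc_list (enc_world K) (sorted_list_of_set (worlds K)) @ enc_nat (init K)"

definition SAT :: "nat subrel \<Rightarrow> bool list set" where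
  "SAT sub = {enc_form \<phi> | \<phi>. satisfiable sub \<phi>}"

definition MC :: "nat subrel \<Rightarrow> bool list set" where
  "MC sub = {enc_kripke K @ enc_form \<phi> | K \<phi>.
     wf_kripke K \<and> atoms \<phi> \<subseteq> props K \<and> model_checks sub K \<phi>}"


subsection \<open>The encodings are unambiguous\<close>

lemma bits_inj: "bits m = bits n \<Longrightarrow> m = n"
proof (induction m arbitrary: n rule: bits.induct)
  case (1 m)
  show ?case
  proof (cases "m = 0 \<or> n = 0")
    case True
    with "1.prems" show ?thesis
      by (auto simp: bits.simps[of m] bits.simps[of n] split: if_splits)
  next
    case False
    with "1.prems" have "odd m = odd n" and "bits (m div 2) = bits (n div 2)"
      by (simp_all add: bits.simps[of m] bits.simps[of n])
    moreover from this(2) False have "m div 2 = n div 2" using "1.IH" by blast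
    ultimately show ?thesis
      by (metis bit_eq_rec)
  qed
qed

lemma enc_list_cancel:
  assumes "\<And>x y u v. x \<in> set xs \<Longrightarrow> e x @ u = e' y @ v \<Longrightarrow> g x = g' y \<and> u = v"
    and "enc_list e xs @ u = enc_list e' ys @ v"
  shows "map g xs = map g' ys \<and> u = v"
  using assms
proof (induction xs arbitrary: ys)
  case Nil
  then show ?case by (cases ys) (auto simp: enc_list_def)
next
  case (Cons x xs)
  from Cons.prems(2) obtain y ys' where ys: "ys = y # ys'"
    by (cases ys) (auto simp: enc_list_def)
  with Cons.prems(2) have "e x @ (enc_list e xs @ u) = e' y @ (enc_list e' ys' @ v)"
    by (simp add: enc_list_def)
  then have "g x = g' y" and "enc_list e xs @ u = enc_list e' ys' @ v"
    using Cons.prems(1) by (meson list.set_intros(1))+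
  moreover have "map g xs = map g' ys' \<and> u = v"
    using Cons.prems(1) by (intro Cons.IH calculation(2)) auto
  ultimately show ?case by (simp add: ys)
qed

lemma enc_nat_cancel: "enc_nat m @ u = enc_nat n @ v \<Longrightarrow> m = n \<and> u = v"
  using enc_list_cancel[of "bits m" "\<lambda>b. [b]" "\<lambda>b. [b]" id id u "bits n" v] bits_inj
  by (auto simp: enc_nat_def)

lemma enc_set_cancel:
  assumes "enc_set A @ u = enc_set B @ v"
  shows "sorted_list_of_set A = sorted_list_of_set B \<and> u = v"
proof -
  have "id m = id n \<and> u = v" if "enc_nat m @ u = enc_nat n @ v" for m n u v
    using enc_nat_cancel[OF that] by simp
  from enc_list_cancel[where g = id and g' = id, OF this assms[unfolded enc_set_def]]
  show ?thesis by simp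
qed

lemma enc_form_cancel: "enc_form \<phi> @ u = enc_form \<psi> @ v \<Longrightarrow> \<phi> = \<psi> \<and> u = v"
proof (induction \<phi> arbitrary: \<psi> u v)
  case (Atom p)
  then show ?case by (cases \<psi>) (simp_all, metis enc_nat_cancel)
next
  case (Neg \<phi>)
  from Neg.prems Neg.IH show ?case by (cases \<psi>) simp_all
next
  case (Or \<phi>1 \<phi>2)
  from Or.prems obtain \<psi>1 \<psi>2 where \<psi>: "\<psi> = Or \<psi>1 \<psi>2"
    by (cases \<psi>) simp_all
  with Or.prems have "enc_form \<phi>1 @ (enc_form \<phi>2 @ u) = enc_form \<psi>1 @ (enc_form \<psi>2 @ v)"
    by simp
  from Or.IH(1)[OF this] have "\<phi>1 = \<psi>1" and "enc_form \<phi>2 @ u = enc_form \<psi>2 @ v"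
    by blast+
  with Or.IH(2)[of u \<psi>2 v] show ?case by (simp add: \<psi>)
next
  case (Dia \<phi>)
  from Dia.prems Dia.IH show ?case by (cases \<psi>) simp_all
qed

lemma enc_form_inj: "enc_form \<phi> = enc_form \<psi> \<Longrightarrow> \<phi> = \<psi>"
  using enc_form_cancel[of \<phi> "[]" \<psi> "[]"] by simp

lemma enc_instance_inj:
  assumes eq: "enc_kripke K @ enc_form \<phi> = enc_kripke K' @ enc_form \<phi>'"
    and wf: "wf_kripke K" "wf_kripke K'"
  shows "\<phi> = \<phi>' \<and> props K = props K' \<and> worlds K = worlds K' \<and> edges K = edges K' \<and>
    (\<forall>s \<in> worlds K. label K s = label K' s) \<and> init K = init K'"
proof -
  let ?g = "\<lambda>K s. (s, sorted_list_of_set (edges K `` {s}), sorted_list_of_set (label K s))"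
  have fin: "finite (props J)" "finite (worlds J)" "finite (edges J `` {s})"
    "s \<in> worlds J \<Longrightarrow> finite (label J s)" if "wf_kripke J" for J s
  proof -
    have "edges J `` {s} \<subseteq> worlds J" using that by (auto simp: wf_kripke_def)
    then show "finite (props J)" "finite (worlds J)" "finite (edges J `` {s})"
      "s \<in> worlds J \<Longrightarrow> finite (label J s)"
      using that by (auto simp: wf_kripke_def dest: finite_subset)
  qed
  have w: "?g K s = ?g K' s' \<and> u = v" if "enc_world K s @ u = enc_world K' s' @ v" for s s' u v
    using that by (auto simp: enc_world_def dest!: enc_nat_cancel enc_set_cancel)
  from eq have "enc_set (props K) @ enc_list (enc_world K) (sorted_list_of_set (worlds K)) @
      enc_nat (init K) @ enc_form \<phi> = enc_set (props K') @
      enc_list (enc_world K') (sorted_list_of_set (worlds K')) @ enc_nat (init K') @ enc_form \<phi>'"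
    by (simp add: enc_kripke_def)
  note 1 = enc_set_cancel[OF this]
  note 2 = enc_list_cancel[where g = "?g K" and g' = "?g K'", OF w 1[THEN conjunct2]]
  note 3 = enc_nat_cancel[OF 2[THEN conjunct2]]
  have M: "map (?g K) (sorted_list_of_set (worlds K)) = map (?g K') (sorted_list_of_set (worlds K'))"
    and init: "init K = init K'" and form: "\<phi> = \<phi>'"
    using 2 3 enc_form_inj by blast+
  have P: "props K = props K'"
    using arg_cong[OF 1[THEN conjunct1], of set] fin(1) wf by simp
  from arg_cong[OF M, of set] have G: "?g K ` worlds K = ?g K' ` worlds K'"
    using fin(2) wf by simp
  have W: "worlds K = worlds K'"
    using arg_cong[OF G, of "\<lambda>X. fst ` X"] by (simp add: image_image)
  have S: "edges K `` {s} = edges K' `` {s} \<and> label K s = label K' s" if "s \<in> worlds K" for s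
  proof -
    from that G have "?g K s \<in> ?g K' ` worlds K'" by blast
    then have "sorted_list_of_set (edges K `` {s}) = sorted_list_of_set (edges K' `` {s})"
      "sorted_list_of_set (label K s) = sorted_list_of_set (label K' s)" by auto
    from this[THEN arg_cong, of set] show ?thesis using fin(3,4) wf that W by simp
  qed
  then have "edges K = edges K'"
    using wf W unfolding wf_kripke_def by blast
  with P init form W S show ?thesis by blast
qed

end

theory Submission
  imports Defs "HOL-Library.Countable"
begin

text \<open>All four reductions use one formula. A configuration of a machine running in polynomial space
  is written as a block of \<open>N + 1\<close> points. The point of cell \<open>j\<close> carries the number of its block
  modulo 3 (its kind) and an atom coding \<open>j\<close> and a letter; the letter contains the state, the symbols
  under all heads, and for each tape the symbol in cell \<open>j\<close> and the position of the cell relative to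
  the head, so that a step is a local condition on two adjacent blocks.

  Under both sub-interval relations, a diamond in front of atoms sees an interval only as the set of
  letters at its visible points. An interval that misses one of the three kinds lies within two
  adjacent blocks, and there the step condition can be stated; an interval that meets all three
  kinds contains a complete block. Since the logic is invariant under reversal, a model yields only
  an undirected walk between configurations. This suffices: the machine is deterministic and halted
  configurations are fixed points, so whether a given halting state is reached is invariant under
  steps in either direction.

  Hence the formula is satisfiable iff the machine reaches the given halting state. For model
  checking, the negated formula for the rejecting state is evaluated on a complete graph, the traces
  of which are all words over single letters. Atoms and worlds are numbered by powers of two, whose
  binary codes are unary in the exponent; therefore a counter program with nested loops writes the
  instance.\<close>

section \<open>Counter programs and their compilation to Turing machines\<close>

text \<open>The constraints speak of visible sets, so they leave open the order of the points inside
  a block and, apart from \<open>clash\<close>, the number of letters at a point. Hence no word is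
  reconstructed from a model. A row is any choice of one letter per column found in a visible set;
  in a set that misses a kind, two rows of the same kind agree because disagreement is itself a
  forbidden pattern, and the cyclic order of the two kinds present, not their position, tells which
  row is earlier. What must be forced is that the walk never breaks off. In the shortest interval
  where a third kind appears, each outer kind sits on a single point, whereas a row needs two
  points, by \<open>N \<ge> 1\<close> and the absence of a \<open>clash\<close>. So the complete
  block is the middle one, and it belongs to two overlapping windows that each miss a kind. The
  strict relation dictates the nesting of diamonds: the points from \<open>p\<close> to
  \<open>q\<close> are seen from \<open>[p - 1, q + 1]\<close>, and this interval has to lie inside
  the evaluated one. Therefore the initial and the final row are sought inside an intermediate
  sub-interval.\<close>

text \<open>Registers are head positions: register 0 is the head on the input tape, and the others are
  heads on blank tapes, so that reading \<^const>\<open>Left_End\<close> is the test for zero. \<open>Prep\<close> moves the head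
  of the output tape off cell 0; it is run once, before the program.\<close>

datatype cmd = Prep | Skip | Out bool | Inc nat | Dec nat | Seq cmd cmd
  | Cond nat symbol cmd cmd | Loop nat symbol cmd

instance symbol :: countable by countable_datatype
instance cmd :: countable by countable_datatype

definition reg_tape :: "bool list \<Rightarrow> nat \<Rightarrow> nat \<Rightarrow> symbol" where
  "reg_tape x r = word_tape (if r = 0 then x else [])"

lemma reg_tape_Left_End [simp]: "reg_tape x r i = Left_End \<longleftrightarrow> i = 0"
  by (simp add: reg_tape_def word_tape_def)

text \<open>The number counts machine steps exactly: one per elementary command, and one per
  dispatch of a composite command. \<open>Prep\<close> is executed outside this semantics, as the
  first step of the machine.\<close>

inductive exec :: "bool list \<Rightarrow> cmd \<Rightarrow> (nat \<Rightarrow> nat) \<times> bool list \<Rightarrow> nat \<Rightarrow>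
    (nat \<Rightarrow> nat) \<times> bool list \<Rightarrow> bool" for x where
  Skip: "exec x Skip s 1 s"
| Out: "exec x (Out b) (e, w) 1 (e, w @ [b])"
| Inc: "exec x (Inc r) (e, w) 1 (e(r := Suc (e r)), w)"
| Dec: "exec x (Dec r) (e, w) 1 (e(r := e r - 1), w)"
| Seq: "exec x a s m s' \<Longrightarrow> exec x b s' n s'' \<Longrightarrow> exec x (Seq a b) s (Suc (m + n)) s''"
| CondT: "reg_tape x r (fst s r) = a \<Longrightarrow> exec x b s n s' \<Longrightarrow> exec x (Cond r a b c) s (Suc n) s'"
| CondF: "reg_tape x r (fst s r) \<noteq> a \<Longrightarrow> exec x c s n s' \<Longrightarrow> exec x (Cond r a b c) s (Suc n) s'"
| LoopE: "reg_tape x r (fst s r) = a \<Longrightarrow> exec x (Loop r a c) s 1 s"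
| LoopS: "reg_tape x r (fst s r) \<noteq> a \<Longrightarrow> exec x c s m s' \<Longrightarrow> exec x (Loop r a c) s' n s'' \<Longrightarrow>
    exec x (Loop r a c) s (Suc (m + n)) s''"

primrec regs :: "cmd \<Rightarrow> nat set" where
  "regs Prep = {}"
| "regs Skip = {}"
| "regs (Out b) = {}"
| "regs (Inc r) = {r}"
| "regs (Dec r) = {r}"
| "regs (Seq a b) = regs a \<union> regs b"
| "regs (Cond r s a b) = insert r (regs a \<union> regs b)"
| "regs (Loop r s a) = insert r (regs a)"

lemma finite_regs: "finite (regs c)"
  by (induction c) auto

text \<open>The control stacks that occur while \<open>c\<close> runs on top of \<open>K\<close>, up
  to the moment when \<open>K\<close> itself is left. The set is finite because the body of a loop
  runs on top of the loop command, so each round returns to a stack already counted.\<close>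

primrec conts :: "cmd \<Rightarrow> cmd list \<Rightarrow> cmd list set" where
  "conts Prep K = {Prep # K}"
| "conts Skip K = {Skip # K}"
| "conts (Out b) K = {Out b # K}"
| "conts (Inc r) K = {Inc r # K}"
| "conts (Dec r) K = {Dec r # K}"
| "conts (Seq a b) K = insert (Seq a b # K) (conts a (b # K) \<union> conts b K)"
| "conts (Cond r s a b) K = insert (Cond r s a b # K) (conts a K \<union> conts b K)"
| "conts (Loop r s a) K = insert (Loop r s a # K) (conts a (Loop r s a # K))"

definition stay :: "symbol list \<Rightarrow> (symbol \<times> direction) list" where
  "stay as = map (\<lambda>a. (a, Stay)) as"

fun next_cmd :: "nat \<Rightarrow> cmd list \<Rightarrow> symbol list \<Rightarrow> cmd list \<times> (symbol \<times> direction) list" where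
  "next_cmd R [] as = ([], stay as)"
| "next_cmd R (Prep # K) as = (K, (stay as)[R := (as ! R, Right)])"
| "next_cmd R (Skip # K) as = (K, stay as)"
| "next_cmd R (Out b # K) as = (K, (stay as)[R := (Bit b, Right)])"
| "next_cmd R (Inc r # K) as = (K, (stay as)[r := (as ! r, Right)])"
| "next_cmd R (Dec r # K) as = (K, (stay as)[r := (as ! r, Left)])"
| "next_cmd R (Seq a b # K) as = (a # b # K, stay as)"
| "next_cmd R (Cond r s a b # K) as = ((if as ! r = s then a else b) # K, stay as)"
| "next_cmd R (Loop r s a # K) as =
    (if as ! r = s then K else a # Loop r s a # K, stay as)"

text \<open>A state is the stack of the commands still to be executed, wrapped in
  \<open>Some\<close> and numbered. The empty stack accepts; \<open>None\<close> supplies a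
  rejecting state different from it.\<close>

definition machine :: "nat \<Rightarrow> cmd \<Rightarrow> nat tm" where
  "machine R c = \<lparr>ntapes = Suc R,
     states = to_nat ` ({None, Some [], Some [Prep, c]} \<union> Some ` conts c []),
     alphabet = {Blank, Left_End, Bit False, Bit True},
     start = to_nat (Some [Prep, c]),
     accept = to_nat (Some [] :: cmd list option),
     reject = to_nat (None :: cmd list option),
     delta = (\<lambda>q as. case from_nat q of None \<Rightarrow> (q, stay as)
       | Some K \<Rightarrow> (case next_cmd R K as of (K', acts) \<Rightarrow> (to_nat (Some K'), acts)))\<rparr>"

lemma finite_conts: "finite (conts c K)"
  by (induction c arbitrary: K) auto

lemma Cons_in_conts: "c # K \<in> conts c K"
  by (cases c) auto

lemma next_cmd_conts: "K' \<in> conts c K \<Longrightarrow> fst (next_cmd R K' as) \<in> insert K (conts c K)"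
proof (induction c arbitrary: K)
  case (Seq a b)
  from Seq.prems Seq.IH(1)[of "b # K"] Seq.IH(2)[of K] show ?case
    by (auto simp: Cons_in_conts)
next
  case (Cond r s a b)
  from Cond.prems Cond.IH[of K] show ?case
    by (auto simp: Cons_in_conts)
next
  case (Loop r s a)
  from Loop.prems Loop.IH[of "Loop r s a # K"] Cons_in_conts[of a "Loop r s a # K"] show ?case
    by (cases "K' = Loop r s a # K") auto
qed auto

lemma set_stay_update:
  assumes "fst a \<in> A \<or> i \<ge> length as" "set as \<subseteq> A"
  shows "fst ` set ((stay as)[i := a]) \<subseteq> A"
proof (cases "i < length as")
  case True
  have "set ((stay as)[i := a]) \<subseteq> insert a (set (stay as))"
    by (rule set_update_subset_insert)
  then show ?thesis using assms True by (auto simp: stay_def)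
next
  case False
  then show ?thesis using assms by (auto simp: stay_def list_update_beyond)
qed

lemma next_cmd_acts:
  assumes "set as \<subseteq> A" "Bit False \<in> A" "Bit True \<in> A"
  shows "length (snd (next_cmd R K as)) = length as \<and>
    fst ` set (snd (next_cmd R K as)) \<subseteq> A"
proof -
  have nth: "as ! i \<in> A \<or> i \<ge> length as" for i
    using assms(1) nth_mem by (metis not_less subsetD)
  have bit: "Bit b \<in> A" for b
    using assms by (cases b) auto
  have stay: "fst ` set (stay as) \<subseteq> A"
    using assms(1) by (auto simp: stay_def)
  have len: "length (stay as) = length as"
    by (simp add: stay_def)
  note upd = set_stay_update[OF _ assms(1)]
  show ?thesis
  proof (cases K)
    case (Cons c K')
    show ?thesis
      by (cases c) (use nth bit stay len in \<open>simp_all add: Cons upd\<close>)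
  qed (use stay len in simp)
qed

lemma wf_machine: "wf_tm (machine R c)"
proof -
  let ?Q = "{None, Some [], Some [Prep, c]} \<union> Some ` conts c []"
  have closed: "case delta (machine R c) q as of (q', acts) \<Rightarrow>
      q' \<in> states (machine R c) \<and> length acts = ntapes (machine R c) \<and>
      fst ` set acts \<subseteq> alphabet (machine R c)"
    if "q \<in> states (machine R c)" "length as = ntapes (machine R c)"
      "set as \<subseteq> alphabet (machine R c)" for q as
  proof -
    from that(1) obtain K where K: "K \<in> ?Q" "q = to_nat K"
      by (auto simp: machine_def)
    show ?thesis
    proof (cases K)
      case None
      then show ?thesis using that K by (auto simp: machine_def stay_def)
    next
      case (Some L)
      have "Some (fst (next_cmd R L as)) \<in> ?Q"
        using K(1) next_cmd_conts[of L c "[]" R as] Cons_in_conts[of c "[]"] by (auto simp: Some)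
      then have "to_nat (Some (fst (next_cmd R L as))) \<in> to_nat ` ?Q"
        by (rule imageI)
      then show ?thesis
        using that next_cmd_acts[of as "alphabet (machine R c)" R L]
        by (simp add: machine_def K Some split_def del: image_insert image_Un Un_insert_left)
    qed
  qed
  have "to_nat (Some [] :: cmd list option) \<noteq> to_nat (None :: cmd list option)"
    by simp
  with closed show ?thesis
    unfolding wf_tm_def by (auto simp: machine_def finite_conts)
qed

text \<open>The last head stands at \<open>Suc (length w)\<close> for the output \<open>w\<close>,
  since cell 0 holds \<open>Left_End\<close>.\<close>

definition tapes :: "bool list \<Rightarrow> nat \<Rightarrow> (nat \<Rightarrow> nat) \<times> bool list \<Rightarrow> tape list" where
  "tapes x R s = map (\<lambda>r. (reg_tape x r, fst s r)) [0..<R] @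
     [(word_tape (snd s), Suc (length (snd s)))]"

definition conf :: "bool list \<Rightarrow> nat \<Rightarrow> cmd list \<Rightarrow> (nat \<Rightarrow> nat) \<times> bool list \<Rightarrow> nat config" where
  "conf x R K s = (to_nat (Some K), tapes x R s)"

abbreviation reads :: "tape list \<Rightarrow> symbol list" where
  "reads ts \<equiv> map (\<lambda>(c, h). c h) ts"

lemma map2_act_stay: "map2 act (stay (reads ts)) ts = ts"
  by (induction ts) (auto simp: stay_def)

lemma map2_act_update:
  "i < length ts \<Longrightarrow>
    map2 act ((stay (reads ts))[i := a]) ts = ts[i := act a (ts ! i)]"
  using map2_act_stay[of ts]
  by (auto intro!: nth_equalityI simp: nth_list_update stay_def split: prod.splits)

lemma step_conf:
  assumes "K \<noteq> []" "next_cmd R K (reads (tapes x R s)) = (K', acts)"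
  shows "step (machine R c) (conf x R K s) = (to_nat (Some K'), map2 act acts (tapes x R s))"
  using assms by (simp add: step_def conf_def halted_def machine_def)

lemma length_tapes [simp]: "length (tapes x R s) = Suc R"
  by (simp add: tapes_def)

lemma tapes_nth: "r < R \<Longrightarrow> tapes x R s ! r = (reg_tape x r, fst s r)"
  "tapes x R s ! R = (word_tape (snd s), Suc (length (snd s)))"
  by (simp_all add: tapes_def nth_append)

lemma tapes_update:
  "r < R \<Longrightarrow> tapes x R (e(r := h), w) = (tapes x R (e, w))[r := (reg_tape x r, h)]"
  by (rule nth_equalityI) (auto simp: tapes_def nth_append nth_list_update less_Suc_eq)

lemma tapes_Out:
  "tapes x R (e, w @ [b]) = (tapes x R (e, w))[R := act (Bit b, Right) (tapes x R (e, w) ! R)]"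
  by (rule nth_equalityI)
    (auto simp: tapes_def nth_append nth_list_update less_Suc_eq word_tape_def fun_eq_iff)

text \<open>The transition function of \<open>machine R p\<close> looks only at \<open>R\<close> and
  the stack, so \<open>p\<close> is arbitrary here and the induction can vary the continuation
  \<open>K\<close>.\<close>

lemma exec_steps:
  assumes "exec x c s t s'" "regs c \<subseteq> {..<R}"
  shows "(step (machine R p) ^^ t) (conf x R (c # K) s) = conf x R K s'"
  using assms
proof (induction arbitrary: K rule: exec.induct)
  case (Skip s)
  have "step (machine R p) (conf x R (Skip # K) s) = conf x R K s"
    by (subst step_conf) (auto simp: map2_act_stay conf_def)
  then show ?case by simp
next
  case (Out b e w)
  have "step (machine R p) (conf x R (Out b # K) (e, w)) = conf x R K (e, w @ [b])"
    by (subst step_conf) (auto simp: map2_act_update conf_def tapes_Out)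
  then show ?case by simp
next
  case (Inc r e w)
  have "step (machine R p) (conf x R (Inc r # K) (e, w)) = conf x R K (e(r := Suc (e r)), w)"
    using Inc by (subst step_conf) (auto simp: map2_act_update conf_def tapes_update tapes_nth)
  then show ?case by simp
next
  case (Dec r e w)
  have "step (machine R p) (conf x R (Dec r # K) (e, w)) = conf x R K (e(r := e r - 1), w)"
    using Dec by (subst step_conf) (auto simp: map2_act_update conf_def tapes_update tapes_nth)
  then show ?case by simp
next
  case (Seq a s m s' b n s'')
  have "step (machine R p) (conf x R (Seq a b # K) s) = conf x R (a # b # K) s"
    by (subst step_conf) (auto simp: map2_act_stay conf_def)
  with Seq show ?case
    by (simp add: funpow_swap1 funpow_add add.commute[of m])
next
  case (CondT r s a b n s' c)
  then have "step (machine R p) (conf x R (Cond r a b c # K) s) = conf x R (b # K) s"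
    by (subst step_conf) (auto simp: map2_act_stay conf_def tapes_nth)
  with CondT show ?case by (simp add: funpow_swap1)
next
  case (CondF r s a c n s' b)
  then have "step (machine R p) (conf x R (Cond r a b c # K) s) = conf x R (c # K) s"
    by (subst step_conf) (auto simp: map2_act_stay conf_def tapes_nth)
  with CondF show ?case by (simp add: funpow_swap1)
next
  case (LoopE r s a c)
  then have "step (machine R p) (conf x R (Loop r a c # K) s) = conf x R K s"
    by (subst step_conf) (auto simp: map2_act_stay conf_def tapes_nth)
  then show ?case by simp
next
  case (LoopS r s a c m s' n s'')
  then have "step (machine R p) (conf x R (Loop r a c # K) s) = conf x R (c # Loop r a c # K) s"
    by (subst step_conf) (auto simp: map2_act_stay conf_def tapes_nth)
  with LoopS show ?case
    by (simp add: funpow_swap1 funpow_add add.commute[of m])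
qed

lemma polytime_computableI:
  fixes p :: "nat poly"
  assumes "\<And>x. \<exists>t e. exec x c (\<lambda>_. 0, []) t (e, f x) \<and> t \<le> poly p (length x)"
  shows "polytime_computable f"
proof -
  \<comment> \<open>\<open>R \<ge> 1\<close> keeps tape 0, the input, apart from tape
    \<open>R\<close>, the output.\<close>
  obtain R where R: "regs c \<subseteq> {..<R}" "R \<ge> 1"
  proof -
    have "regs c \<subseteq> {..<Suc (Max (insert 0 (regs c)))}"
      using finite_regs[of c] by (auto simp: less_Suc_eq_le)
    then show thesis using that by (metis One_nat_def Suc_leI zero_less_Suc)
  qed
  let ?M = "machine R c"
  \<comment> \<open>The summand 1 pays for \<open>Prep\<close>.\<close>
  have "\<exists>t\<le>poly (p + 1) (length x).
      halted ?M (run ?M x t) \<and> fst (last (snd (run ?M x t))) = word_tape (f x)" for x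
  proof -
    obtain t e where t: "exec x c (\<lambda>_. 0, []) t (e, f x)" "t \<le> poly p (length x)"
      using assms by blast
    let ?ts = "(word_tape x, 0) # replicate R (word_tape [], 0 :: nat)"
    have ts: "?ts = map (\<lambda>r. (reg_tape x r, 0)) [0..<R] @ [(word_tape [], 0)]"
      using R(2) by (intro nth_equalityI) (auto simp: nth_append reg_tape_def nth_Cons')
    have upd: "?ts[R := act (word_tape [] 0, Right) (word_tape [], 0)] = tapes x R (\<lambda>_. 0, [])"
      unfolding ts by (simp add: tapes_def list_update_append fun_eq_iff)
    have ini: "initial ?M x = (to_nat (Some [Prep, c]), ?ts)"
      by (simp add: initial_def machine_def)
    have nth: "?ts ! R = (word_tape [], 0)"
      using R(2) by (auto simp: nth_Cons')
    have "map2 act ((stay (reads ?ts))[R := (word_tape [] 0, Right)]) ?ts =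
        ?ts[R := act (word_tape [] 0, Right) (?ts ! R)]"
      by (rule map2_act_update) simp
    moreover have "reads ?ts ! R = word_tape [] 0"
      using R(2) by (auto simp: nth_Cons')
    ultimately have "step ?M (initial ?M x) = conf x R [c] (\<lambda>_. 0, [])"
      unfolding ini conf_def upd[symmetric] nth
      by (simp add: step_def halted_def machine_def)
    then have "run ?M x (Suc t) = conf x R [] (e, f x)"
      using exec_steps[OF t(1) R(1)] by (simp add: run_def funpow_swap1)
    moreover have "halted ?M (conf x R [] (e, f x))"
      "fst (last (snd (conf x R [] (e, f x)))) = word_tape (f x)"
      by (simp_all add: halted_def machine_def conf_def tapes_def)
    moreover have "Suc t \<le> poly (p + 1) (length x)"
      using t(2) by simp
    ultimately show ?thesis by metis
  qed
  then show ?thesis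
    unfolding polytime_computable_def computes_in_time_def using wf_machine by blast
qed


section \<open>Programs that generate output\<close>

definition runs :: "bool list \<Rightarrow> cmd \<Rightarrow> (nat \<Rightarrow> nat) \<times> bool list \<Rightarrow>
    (nat \<Rightarrow> nat) \<times> bool list \<Rightarrow> nat \<Rightarrow> bool" where
  "runs x c s s' b \<longleftrightarrow> (\<exists>t\<le>b. exec x c s t s')"

lemma runs_mono: "runs x c s s' b \<Longrightarrow> b \<le> b' \<Longrightarrow> runs x c s s' b'"
  unfolding runs_def using le_trans by blast

lemma runs_weaken: "runs x c s s' b \<Longrightarrow> s' = t' \<Longrightarrow> b \<le> b' \<Longrightarrow> runs x c s t' b'"
  using runs_mono by simp

lemma runs_basic:
  "runs x Skip s s 1"
  "runs x (Out b) (e, w) (e, w @ [b]) 1"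
  "runs x (Inc r) (e, w) (e(r := Suc (e r)), w) 1"
  "runs x (Dec r) (e, w) (e(r := e r - 1), w) 1"
  unfolding runs_def by (blast intro: exec.intros)+

lemma runs_Seq:
  assumes "runs x a s s' m" "runs x b s' s'' n"
  shows "runs x (Seq a b) s s'' (m + n + 1)"
proof -
  obtain t u where "exec x a s t s'" "t \<le> m" "exec x b s' u s''" "u \<le> n"
    using assms by (auto simp: runs_def)
  then show ?thesis unfolding runs_def
    by (intro exI[of _ "Suc (t + u)"]) (auto intro: exec.Seq)
qed

lemma runs_CondT:
  "reg_tape x r (fst s r) = a \<Longrightarrow> runs x b s s' n \<Longrightarrow> runs x (Cond r a b c) s s' (n + 1)"
  unfolding runs_def by (metis Suc_eq_plus1 Suc_le_mono exec.CondT)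

lemma runs_CondF:
  "reg_tape x r (fst s r) \<noteq> a \<Longrightarrow> runs x c s s' n \<Longrightarrow> runs x (Cond r a b c) s s' (n + 1)"
  unfolding runs_def by (metis Suc_eq_plus1 Suc_le_mono exec.CondF)

lemma runs_LoopE: "reg_tape x r (fst s r) = a \<Longrightarrow> runs x (Loop r a c) s s 1"
  unfolding runs_def by (blast intro: exec.LoopE)

lemma runs_LoopS:
  assumes "reg_tape x r (fst s r) \<noteq> a" "runs x c s s' m" "runs x (Loop r a c) s' s'' n"
  shows "runs x (Loop r a c) s s'' (m + n + 1)"
proof -
  obtain t u where "exec x c s t s'" "t \<le> m" "exec x (Loop r a c) s' u s''" "u \<le> n"
    using assms by (auto simp: runs_def)
  then show ?thesis unfolding runs_def using assms(1)
    by (intro exI[of _ "Suc (t + u)"]) (auto intro: exec.LoopS)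
qed

text \<open>Reading a register by counting it down destroys it. Several targets make it possible to
  copy a value and to restore the source from one of the copies; with no target the register is
  cleared.\<close>

definition move :: "nat \<Rightarrow> nat list \<Rightarrow> cmd" where
  "move a rs = Loop a Left_End (foldr (\<lambda>r. Seq (Inc r)) rs (Dec a))"

lemma runs_move:
  assumes "a \<notin> set rs" "distinct rs"
  shows "runs x (move a rs) (e, w)
    (\<lambda>r. if r = a then 0 else if r \<in> set rs then e r + e a else e r, w)
    (e a * (2 * length rs + 2) + 1)"
proof -
  have body: "runs x (foldr (\<lambda>r. Seq (Inc r)) rs (Dec a)) (e, w)
    (\<lambda>r. if r = a then e a - 1 else if r \<in> set rs then e r + 1 else e r, w) (2 * length rs + 1)"
    for e
    using assms
  proof (induction rs arbitrary: e)
    case Nil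
    have "e(a := e a - 1) = (\<lambda>r. if r = a then e a - 1 else if r \<in> set [] then e r + 1 else e r)"
      by auto
    from runs_basic(4)[of x a e w, unfolded this] show ?case by simp
  next
    case (Cons b rs)
    let ?e = "e(b := Suc (e b))"
    have "(\<lambda>r. if r = a then ?e a - 1 else if r \<in> set rs then ?e r + 1 else ?e r) =
        (\<lambda>r. if r = a then e a - 1 else if r \<in> set (b # rs) then e r + 1 else e r)"
      using Cons.prems by (auto simp: fun_eq_iff)
    note IH = Cons.IH[of ?e, unfolded this]
    have "runs x (foldr (\<lambda>r. Seq (Inc r)) rs (Dec a)) (?e, w)
      (\<lambda>r. if r = a then e a - 1 else if r \<in> set (b # rs) then e r + 1 else e r, w)
      (2 * length rs + 1)"
      by (rule IH) (use Cons.prems in simp_all)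
    from runs_Seq[OF runs_basic(3) this] show ?case by simp
  qed
  show ?thesis
  proof (induction "e a" arbitrary: e)
    case 0
    then have "(\<lambda>r. if r = a then 0 else if r \<in> set rs then e r + e a else e r) = e"
      by auto
    with 0 show ?case by (simp add: move_def runs_LoopE[unfolded One_nat_def])
  next
    case (Suc k)
    let ?e = "\<lambda>r. if r = a then e a - 1 else if r \<in> set rs then e r + 1 else e r"
    have k: "k = ?e a"
      using Suc.hyps(2) by simp
    have eq: "(\<lambda>r. if r = a then 0 else if r \<in> set rs then ?e r + ?e a else ?e r) =
        (\<lambda>r. if r = a then 0 else if r \<in> set rs then e r + e a else e r)"
      using Suc.hyps(2) by (auto simp: fun_eq_iff)
    have "reg_tape x a (fst (e, w) a) \<noteq> Left_End"
      using Suc.hyps(2) by simp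
    from runs_LoopS[OF this body Suc.hyps(1)[of ?e, OF k, unfolded move_def eq]]
    show ?case unfolding move_def
      by (rule runs_mono) (use Suc.hyps(2)[symmetric] in simp)
  qed
qed


text \<open>A loop \<open>For v u\<close> counts \<open>v\<close> up while counting \<open>u\<close> down, and restores \<open>u\<close> from \<open>v\<close> at its end;
  inside the body, \<open>u\<close> holds the number of the remaining iterations.\<close>

datatype gen = Lit "bool list" | Cat gen gen | For nat nat gen | Case symbol gen gen

primrec emit :: "bool list \<Rightarrow> gen \<Rightarrow> (nat \<Rightarrow> nat) \<Rightarrow> bool list" where
  "emit x (Lit bs) e = bs"
| "emit x (Cat g h) e = emit x g e @ emit x h e"
| "emit x (For v u g) e =
    concat (map (\<lambda>i. emit x g (e(v := i, u := e u - Suc i))) [0..<e u])"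
| "emit x (Case a g h) e = (if word_tape x (e 0) = a then emit x g e else emit x h e)"

primrec outs :: "bool list \<Rightarrow> cmd" where
  "outs [] = Skip"
| "outs (b # bs) = Seq (Out b) (outs bs)"

primrec compile :: "gen \<Rightarrow> cmd" where
  "compile (Lit bs) = outs bs"
| "compile (Cat g h) = Seq (compile g) (compile h)"
| "compile (For v u g) =
    Seq (Loop u Left_End (Seq (Dec u) (Seq (compile g) (Inc v)))) (move v [u])"
| "compile (Case a g h) = Cond 0 a (compile g) (compile h)"

text \<open>The variable of the polynomial stands for a bound on all registers. A round of
  \<open>For\<close> costs 5 steps besides its body, and 4 more when the bound is restored by
  \<open>move\<close>; the constant 3 covers the two loop exits and the sequencing.\<close>

primrec cost :: "gen \<Rightarrow> nat poly" where
  "cost (Lit bs) = [:2 * length bs + 1:]"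
| "cost (Cat g h) = cost g + cost h + 1"
| "cost (For v u g) = [:0, 1:] * (cost g + [:9:]) + [:3:]"
| "cost (Case a g h) = cost g + cost h + 1"

text \<open>\<open>Z\<close> is the set of registers known to be 0. A counter must come from it,
  because it starts at 0 and is reset to 0. Inside the body neither \<open>v\<close> nor
  \<open>u\<close> may serve as a counter, but \<open>v\<close> may bound an inner loop, which is
  how exponents are printed.\<close>

primrec scoped :: "nat set \<Rightarrow> gen \<Rightarrow> bool" where
  "scoped Z (Lit bs) \<longleftrightarrow> True"
| "scoped Z (Cat g h) \<longleftrightarrow> scoped Z g \<and> scoped Z h"
| "scoped Z (For v u g) \<longleftrightarrow> v \<in> Z \<and> u \<noteq> v \<and> scoped (Z - {v, u}) g"
| "scoped Z (Case a g h) \<longleftrightarrow> scoped Z g \<and> scoped Z h"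

lemma runs_outs: "runs x (outs bs) (e, w) (e, w @ bs) (2 * length bs + 1)"
proof (induction bs arbitrary: w)
  case Nil
  then show ?case using runs_basic(1) by simp
next
  case (Cons b bs)
  from runs_Seq[OF runs_basic(2)[of x b e w] Cons.IH[of "w @ [b]"]] show ?case by simp
qed

lemma runs_For_loop:
  assumes body: "\<And>i w. i < U \<Longrightarrow>
      runs x c (e(v := i, u := U - Suc i), w) (e(v := i, u := U - Suc i), w @ h i) T"
    and "v \<noteq> u" "k \<le> U"
  shows "runs x (Loop u Left_End (Seq (Dec u) (Seq c (Inc v)))) (e(v := U - k, u := k), w)
    (e(v := U, u := 0), w @ concat (map h [U - k..<U])) (k * (T + 5) + 1)"
  using assms(3)
proof (induction k arbitrary: w)
  case 0
  show ?case
    unfolding diff_zero upt_rec[of U U] by (simp del: fun_upd_apply, rule runs_LoopE[unfolded One_nat_def]) simp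
next
  case (Suc k)
  let ?s = "\<lambda>k w. (e(v := U - k, u := k), w)"
  have d: "runs x (Dec u) (?s (Suc k) w) (e(v := U - Suc k, u := k), w) 1"
    using runs_basic(4)[of x u "e(v := U - Suc k, u := Suc k)" w] by simp
  have b: "runs x c (e(v := U - Suc k, u := k), w) (e(v := U - Suc k, u := k), w @ h (U - Suc k)) T"
    using body[of "U - Suc k" w] Suc.prems by simp
  have i: "runs x (Inc v) (e(v := U - Suc k, u := k), w @ h (U - Suc k))
      (?s k (w @ h (U - Suc k))) 1"
    using runs_basic(3)[of x v "e(v := U - Suc k, u := k)" "w @ h (U - Suc k)"] assms(2) Suc.prems
    by (simp add: fun_upd_twist Suc_diff_Suc)
  have t: "reg_tape x u (fst (?s (Suc k) w) u) \<noteq> Left_End"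
    by simp
  have k: "k \<le> U"
    using Suc.prems by simp
  have "[U - Suc k..<U] = (U - Suc k) # [U - k..<U]"
    using Suc.prems by (simp add: upt_rec[of "U - Suc k"] Suc_diff_Suc)
  then show ?case
    by (intro runs_weaken[OF runs_LoopS[OF t runs_Seq[OF d runs_Seq[OF b i]] Suc.IH[OF k]]])
      simp_all
qed

text \<open>All registers return to their initial values, so loops nest freely. One bound
  \<open>B\<close> serves throughout, as a counter stays below the value of its bounding
  register.\<close>

lemma runs_compile:
  assumes "scoped Z g" "\<And>r. r \<in> Z \<Longrightarrow> e r = 0" "\<And>r. e r \<le> B"
  shows "runs x (compile g) (e, w) (e, w @ emit x g e) (poly (cost g) B)"
  using assms
proof (induction g arbitrary: Z e w)
  case (Lit bs)
  then show ?case using runs_outs by simp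
next
  case (Cat g h)
  from runs_Seq[OF Cat.IH(1)[of Z e w] Cat.IH(2)[of Z e "w @ emit x g e"]] Cat.prems
  show ?case by simp
next
  case (For v u g)
  let ?h = "\<lambda>i. emit x g (e(v := i, u := e u - Suc i))"
  have vu: "v \<noteq> u" "e v = 0" and sc: "scoped (Z - {v, u}) g"
    using For.prems by auto
  have body: "runs x (compile g) (e(v := i, u := e u - Suc i), w)
      (e(v := i, u := e u - Suc i), w @ ?h i) (poly (cost g) B)" if "i < e u" for i w
  proof (rule For.IH[OF sc])
    show "(e(v := i, u := e u - Suc i)) r = 0" if "r \<in> Z - {v, u}" for r
      using that For.prems by auto
    show "(e(v := i, u := e u - Suc i)) r \<le> B" for r
      using For.prems(3)[of r] For.prems(3)[of u] that by (auto intro: le_trans[OF less_imp_le])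
  qed
  have "e(v := 0, u := e u) = e"
    using vu by auto
  with runs_For_loop[OF body vu(1) order_refl, of w]
  have l: "runs x (Loop u Left_End (Seq (Dec u) (Seq (compile g) (Inc v)))) (e, w)
    (e(v := e u, u := 0), w @ emit x (For v u g) e) (e u * (poly (cost g) B + 5) + 1)"
    by simp
  have "(\<lambda>r. if r = v then 0 else if r \<in> set [u] then (e(v := e u, u := 0)) r + (e(v := e u, u := 0)) v
      else (e(v := e u, u := 0)) r) = e"
    using vu by (auto simp: fun_eq_iff)
  with runs_move[of v "[u]" x "e(v := e u, u := 0)" "w @ emit x (For v u g) e"] vu
  have m: "runs x (move v [u]) (e(v := e u, u := 0), w @ emit x (For v u g) e)
    (e, w @ emit x (For v u g) e) (e u * 4 + 1)"
    by simp
  have "e u * (poly (cost g) B + 9) \<le> B * (poly (cost g) B + 9)"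
    using For.prems(3) by (rule mult_le_mono1)
  with runs_Seq[OF l m] show ?case
    by (auto elim!: runs_mono simp: algebra_simps)
next
  case (Case a g h)
  have "reg_tape x 0 (e 0) = word_tape x (e 0)"
    by (simp add: reg_tape_def)
  note read = this
  have 1: "runs x (compile g) (e, w) (e, w @ emit x g e) (poly (cost g) B)"
    and 2: "runs x (compile h) (e, w) (e, w @ emit x h e) (poly (cost h) B)"
    using Case.prems by (auto intro: Case.IH)
  show ?case
  proof (cases "word_tape x (e 0) = a")
    case True
    show ?thesis unfolding compile.simps
      by (rule runs_weaken[OF runs_CondT[OF _ 1]]) (use True read in simp_all)
  next
    case False
    show ?thesis unfolding compile.simps
      by (rule runs_weaken[OF runs_CondF[OF _ 2]]) (use False read in simp_all)
  qed
qed


section \<open>Computing a power of the input length\<close>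

definition mul :: cmd where
  "mul = Seq (Loop 2 Left_End (Seq (Dec 2) (Seq (move 1 [3, 4]) (move 4 [1])))) (move 3 [2])"

primrec pow :: "nat \<Rightarrow> cmd" where
  "pow 0 = Skip"
| "pow (Suc d) = Seq mul (pow d)"

text \<open>Register 1 keeps the factor. In each round it is moved into the accumulator 3 and the
  copy 4, and is then restored from the copy.\<close>

lemma runs_mul:
  "runs x mul ((\<lambda>_ :: nat. 0)(1 := m, 2 := k), w) ((\<lambda>_ :: nat. 0)(1 := m, 2 := k * m), w)
    (k * (14 * m + 6) + 3)"
proof -
  have l: "runs x (Loop 2 Left_End (Seq (Dec 2) (Seq (move 1 [3, 4]) (move 4 [1]))))
    ((\<lambda>_ :: nat. 0)(1 := m, 2 := k, 3 := s), w) ((\<lambda>_ :: nat. 0)(1 := m, 3 := s + k * m), w)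
    (k * (10 * m + 6) + 1)" for s
  proof (induction k arbitrary: s)
    case 0
    have eq: "(\<lambda>_ :: nat. 0)(1 := m, 2 := 0, 3 := s) = (\<lambda>_ :: nat. 0)(1 := m, 3 := s + 0 * m)"
      by (auto simp: fun_eq_iff)
    show ?case unfolding eq by (rule runs_mono[OF runs_LoopE]) simp_all
  next
    case (Suc k)
    let ?e = "(\<lambda>_ :: nat. 0 :: nat)(1 := m, 2 := k, 3 := s)"
    have d: "runs x (Dec 2) ((\<lambda>_ :: nat. 0)(1 := m, 2 := Suc k, 3 := s), w) (?e, w) 1"
      using runs_basic(4)[of x 2 "(\<lambda>_ :: nat. 0)(1 := m, 2 := Suc k, 3 := s)" w]
      by (simp add: fun_upd_twist)
    have "(\<lambda>r. if r = 1 then 0 else if r \<in> set [3, 4] then ?e r + ?e 1 else ?e r) =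
        (\<lambda>_ :: nat. 0)(2 := k, 3 := s + m, 4 := m)"
      by (auto simp: fun_eq_iff)
    with runs_move[of 1 "[3, 4]" x ?e w]
    have 1: "runs x (move 1 [3, 4]) (?e, w) ((\<lambda>_ :: nat. 0)(2 := k, 3 := s + m, 4 := m), w) (m * 6 + 1)"
      by simp
    let ?e' = "(\<lambda>_ :: nat. 0 :: nat)(2 := k, 3 := s + m, 4 := m)"
    have "(\<lambda>r. if r = 4 then 0 else if r \<in> set [1] then ?e' r + ?e' 4 else ?e' r) =
        (\<lambda>_ :: nat. 0)(1 := m, 2 := k, 3 := s + m)"
      by (auto simp: fun_eq_iff)
    with runs_move[of 4 "[1]" x ?e' w]
    have 2: "runs x (move 4 [1]) (?e', w) ((\<lambda>_ :: nat. 0)(1 := m, 2 := k, 3 := s + m), w) (m * 4 + 1)"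
      by simp
    have t: "reg_tape x 2 (fst ((\<lambda>_ :: nat. 0)(1 := m, 2 := Suc k, 3 := s), w) 2) \<noteq> Left_End"
      by simp
    show ?case
      by (rule runs_weaken[OF runs_LoopS[OF t runs_Seq[OF d runs_Seq[OF 1 2]] Suc.IH]])
        (simp_all add: algebra_simps)
  qed
  have eq: "(\<lambda>_ :: nat. 0)(1 := m, 2 := k, 3 := 0) = (\<lambda>_ :: nat. 0)(1 := m, 2 := k)"
    by (auto simp: fun_eq_iff)
  let ?e = "(\<lambda>_ :: nat. 0 :: nat)(1 := m, 3 := k * m)"
  have "(\<lambda>r. if r = 3 then 0 else if r \<in> set [2] then ?e r + ?e 3 else ?e r) =
      (\<lambda>_ :: nat. 0)(1 := m, 2 := k * m)"
    by (auto simp: fun_eq_iff)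
  with runs_move[of 3 "[2]" x ?e w]
  have "runs x (move 3 [2]) (?e, w) ((\<lambda>_ :: nat. 0)(1 := m, 2 := k * m), w) (k * m * 4 + 1)"
    by simp
  with l[of 0, unfolded eq] show ?thesis unfolding mul_def
    by (auto intro!: runs_mono[OF runs_Seq] simp: algebra_simps)
qed

text \<open>A multiplication costs at most 24 times its result, and no intermediate result exceeds
  the final value. The assumptions \<open>m \<ge> 1\<close> and \<open>k \<ge> 1\<close> let
  \<open>k * (14 * m + 6) + 4\<close> be absorbed by \<open>24 * (k * m)\<close>.\<close>

lemma runs_pow:
  assumes "m \<ge> 1" "k \<ge> 1"
  shows "runs x (pow d) ((\<lambda>_ :: nat. 0)(1 := m, 2 := k), w) ((\<lambda>_ :: nat. 0)(1 := m, 2 := k * m ^ d), w)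
    (d * 24 * (k * m ^ d) + 1)"
  using assms(2)
proof (induction d arbitrary: k)
  case 0
  then show ?case using runs_basic(1) by simp
next
  case (Suc d)
  have 1: "1 \<le> k * m"
    using Suc.prems assms(1) by simp
  have "k \<le> k * m"
    using assms(1) by simp
  moreover have "k * (14 * m + 6) = 14 * (k * m) + 6 * k"
    by (simp add: algebra_simps)
  ultimately have "k * (14 * m + 6) + 3 + 1 \<le> 24 * (k * m)"
    using 1 by linarith
  also have "\<dots> \<le> 24 * (k * m * m ^ d)"
    using assms(1) by simp
  finally have "k * (14 * m + 6) + 3 + (d * 24 * (k * m * m ^ d) + 1) + 1
      \<le> Suc d * 24 * (k * m ^ Suc d) + 1"
    by (simp add: algebra_simps)
  from runs_mono[OF runs_Seq[OF runs_mul[of x m k w] Suc.IH[OF 1]] this] show ?case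
    by (simp add: mult.assoc del: fun_upd_apply)
qed

text \<open>The cell with \<open>Left_End\<close> is counted too, so the result is
  \<open>length x + 1\<close>. One further increment in \<open>prelude\<close> gives the base
  \<open>n + 2\<close>, which is at least 2 even for the empty input.\<close>

definition count :: cmd where
  "count = Loop 0 Blank (Seq (Inc 0) (Inc 1))"

lemma runs_count:
  "runs x count (\<lambda>_ :: nat. 0, w) ((\<lambda>_ :: nat. 0)(0 := length x + 1, 1 := length x + 1), w)
    ((length x + 1) * 4 + 1)"
proof -
  have "k \<le> length x + 1 \<Longrightarrow> runs x count
    ((\<lambda>_ :: nat. 0)(0 := length x + 1 - k, 1 := length x + 1 - k), w)
    ((\<lambda>_ :: nat. 0)(0 := length x + 1, 1 := length x + 1), w) (k * 4 + 1)" for k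
  proof (induction k)
    case 0
    show ?case
      unfolding count_def diff_zero
      by (rule runs_mono[OF runs_LoopE]) (simp_all add: reg_tape_def word_tape_def)
  next
    case (Suc k)
    let ?i = "length x + 1 - Suc k"
    let ?e = "(\<lambda>_ :: nat. 0 :: nat)(0 := ?i, 1 := ?i)"
    have t: "reg_tape x 0 (fst (?e, w) 0) \<noteq> Blank"
      using Suc.prems by (auto simp: reg_tape_def word_tape_def)
    have body: "runs x (Seq (Inc 0) (Inc 1)) (?e, w)
      ((\<lambda>_ :: nat. 0)(0 := length x + 1 - k, 1 := length x + 1 - k), w) (1 + 1 + 1)"
    proof (rule runs_Seq)
      show "runs x (Inc 0) (?e, w) (?e(0 := Suc (?e 0)), w) 1"
        by (rule runs_basic)
      have "?e(0 := Suc (?e 0), 1 := Suc ((?e(0 := Suc (?e 0))) 1)) =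
          (\<lambda>_ :: nat. 0)(0 := length x + 1 - k, 1 := length x + 1 - k)"
        using Suc.prems by (auto simp: fun_eq_iff Suc_diff_le)
      then show "runs x (Inc 1) (?e(0 := Suc (?e 0)), w)
          ((\<lambda>_ :: nat. 0)(0 := length x + 1 - k, 1 := length x + 1 - k), w) 1"
        using runs_basic(3)[of x 1 "?e(0 := Suc (?e 0))" w] by (simp only:)
    qed
    have k: "k \<le> length x + 1"
      using Suc.prems by simp
    show ?case unfolding count_def
      by (rule runs_weaken[OF runs_LoopS[OF t body Suc.IH[OF k, unfolded count_def]]]) simp_all
  qed
  from this[of "length x + 1"] show ?thesis
    by (simp add: fun_upd_idem)
qed

text \<open>Two copies of the bound \<open>N + 1\<close> are needed because a loop consumes its bound.\<close>

definition env :: "nat \<Rightarrow> nat \<Rightarrow> nat \<Rightarrow> nat" where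
  "env d n = (\<lambda>_ :: nat. 0)(1 := n + 2, 5 := (n + 2) ^ d, 6 := Suc ((n + 2) ^ d), 7 := Suc ((n + 2) ^ d))"

text \<open>The command \<open>move 0 []\<close> brings the input head back to cell 0, so that
  register 0 can later serve as the counter of a loop that scans the input.\<close>

definition prelude :: "nat \<Rightarrow> cmd" where
  "prelude d = Seq count (Seq (move 0 []) (Seq (Inc 1) (Seq (Inc 2) (Seq (pow d)
     (Seq (move 2 [5, 6, 7]) (Seq (Inc 6) (Inc 7)))))))"

lemma runs_prelude:
  fixes x :: "bool list"
  defines "n \<equiv> length x"
  shows "runs x (prelude d) (\<lambda>_ :: nat. 0, w) (env d n, w) (6 * n + d * 24 * (n + 2) ^ d + 8 * (n + 2) ^ d + 22)"
proof -
  let ?e = "(\<lambda>_ :: nat. 0 :: nat)(0 := n + 1, 1 := n + 1)"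
  have "(\<lambda>r. if r = 0 then 0 else if r \<in> set [] then ?e r + ?e 0 else ?e r) = (\<lambda>_ :: nat. 0)(1 := n + 1)"
    by (auto simp: fun_eq_iff)
  with runs_move[of 0 "[]" x ?e w]
  have m: "runs x (move 0 []) (?e, w) ((\<lambda>_ :: nat. 0)(1 := n + 1), w) ((n + 1) * 2 + 1)"
    by (simp add: mult_2_right)
  have i: "runs x (Inc 1) ((\<lambda>_ :: nat. 0)(1 := n + 1), w) ((\<lambda>_ :: nat. 0)(1 := n + 2), w) 1"
    using runs_basic(3)[of x 1 "(\<lambda>_ :: nat. 0)(1 := n + 1)" w] by simp
  have j: "runs x (Inc 2) ((\<lambda>_ :: nat. 0)(1 := n + 2), w) ((\<lambda>_ :: nat. 0)(1 := n + 2, 2 := 1), w) 1"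
    using runs_basic(3)[of x 2 "(\<lambda>_ :: nat. 0)(1 := n + 2)" w] by simp
  let ?N = "(n + 2) ^ d"
  have p: "runs x (pow d) ((\<lambda>_ :: nat. 0)(1 := n + 2, 2 := 1), w) ((\<lambda>_ :: nat. 0)(1 := n + 2, 2 := ?N), w)
      (d * 24 * ?N + 1)"
    using runs_pow[of "n + 2" 1 x d w] by simp
  let ?f = "(\<lambda>_ :: nat. 0 :: nat)(1 := n + 2, 2 := ?N)"
  have "(\<lambda>r. if r = 2 then 0 else if r \<in> set [5, 6, 7] then ?f r + ?f 2 else ?f r) =
      (\<lambda>_ :: nat. 0)(1 := n + 2, 5 := ?N, 6 := ?N, 7 := ?N)"
    by (auto simp: fun_eq_iff)
  with runs_move[of 2 "[5, 6, 7]" x ?f w]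
  have q: "runs x (move 2 [5, 6, 7]) (?f, w)
      ((\<lambda>_ :: nat. 0)(1 := n + 2, 5 := ?N, 6 := ?N, 7 := ?N), w) (?N * 8 + 1)"
    by simp
  let ?g = "(\<lambda>_ :: nat. 0 :: nat)(1 := n + 2, 5 := ?N, 6 := ?N, 7 := ?N)"
  have eq: "?g(6 := Suc (?g 6), 7 := Suc ((?g(6 := Suc (?g 6))) 7)) = env d n"
    by (auto simp: fun_eq_iff env_def)
  have r: "runs x (Seq (Inc 6) (Inc 7)) (?g, w) (env d n, w) (1 + 1 + 1)"
    using runs_Seq[OF runs_basic(3)[of x 6 ?g w] runs_basic(3)[of x 7 "?g(6 := Suc (?g 6))" w]]
    unfolding eq .
  from runs_Seq[OF runs_count[of x w, folded n_def]
      runs_Seq[OF m runs_Seq[OF i runs_Seq[OF j runs_Seq[OF p runs_Seq[OF q r]]]]]]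
  show ?thesis unfolding prelude_def
    by (auto elim!: runs_mono)
qed

text \<open>The registers 1, 5, 6, 7 are those that \<open>env\<close> sets; all others are 0 and
  may be counters. The polynomial for \<open>n + 3 + (n + 2) ^ d\<close> bounds every register of
  \<open>env\<close>.\<close>

lemma polytime_computable_output:
  assumes "scoped (- {1, 5, 6, 7}) g"
  shows "polytime_computable (\<lambda>x. emit x g (env d (length x)))"
proof -
  let ?N = "[:2, 1:] ^ d :: nat poly"
  let ?p = "[:0, 6:] + of_nat (d * 24) * ?N + [:8:] * ?N + [:22:]"
  let ?B = "[:3, 1:] + ?N :: nat poly"
  show ?thesis
  proof (rule polytime_computableI)
    fix x :: "bool list"
    let ?n = "length x"
    have "runs x (Seq (prelude d) (compile g)) (\<lambda>_ :: nat. 0, []) (env d ?n, [] @ emit x g (env d ?n))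
      (6 * ?n + d * 24 * (?n + 2) ^ d + 8 * (?n + 2) ^ d + 22 +
       poly (cost g) (?n + 3 + (?n + 2) ^ d) + 1)"
      by (rule runs_Seq[OF runs_prelude runs_compile[OF assms]]) (auto simp: env_def)
    then show "\<exists>t e. exec x (Seq (prelude d) (compile g)) (\<lambda>_ :: nat. 0, []) t (e, emit x g (env d ?n)) \<and>
        t \<le> poly (?p + pcompose (cost g) ?B + 1) ?n"
      by (auto simp: runs_def poly_pcompose algebra_simps)
  qed
qed


section \<open>Blocks of letters and local constraints\<close>

definition kinds :: "(nat \<Rightarrow> nat set) \<Rightarrow> nat set \<Rightarrow> nat set" where
  "kinds w V = {k. k < 3 \<and> (\<exists>z\<in>V. k \<in> w z)}"

text \<open>The kinds are the atoms 0, 1, 2, and the exponents are shifted by 2 so that letter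
  atoms, being at least 4, are distinct from them. In a pair, kind and letter come from the same
  point.\<close>

definition letters :: "(nat \<Rightarrow> nat set) \<Rightarrow> nat set \<Rightarrow> (nat \<times> nat) set" where
  "letters w V = {(k, i). k < 3 \<and> (\<exists>z\<in>V. k \<in> w z \<and> 2 ^ (i + 2) \<in> w z)}"

lemma letters_kinds: "(k, i) \<in> letters w V \<Longrightarrow> k \<in> kinds w V"
  by (auto simp: letters_def kinds_def)

lemma letters_mono: "V \<subseteq> V' \<Longrightarrow> letters w V \<subseteq> letters w V'"
  by (auto simp: letters_def)

lemma less_3: "k < 3 \<longleftrightarrow> k = 0 \<or> k = 1 \<or> k = (2 :: nat)"
  by auto

text \<open>An entry \<open>(dk, dj, g)\<close> of a pattern at column \<open>j\<close> and kind \<open>k\<close> asks for the letter \<open>g\<close> in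
  column \<open>j + dj\<close> of a block of kind \<open>k + dk\<close> (modulo 3). The forbidden patterns \<open>P0\<close> apply to column
  0, \<open>P\<close> to the columns below \<open>N\<close>, and \<open>PN\<close> to column \<open>N\<close>.\<close>

type_synonym pattern = "(nat \<times> nat \<times> nat) list"

locale tiling =
  fixes G N :: nat and P0 P PN :: "pattern list"
begin

definition occurs :: "nat \<Rightarrow> nat \<Rightarrow> (nat \<times> nat) set \<Rightarrow> pattern \<Rightarrow> bool" where
  "occurs j k S pat \<longleftrightarrow> (\<forall>(dk, dj, g) \<in> set pat. ((k + dk) mod 3, (j + dj) * G + g) \<in> S)"

text \<open>\<open>k\<close> is the kind of the earlier block. In the intended word, absence of the
  kind \<open>k + 2\<close> modulo 3 guarantees that the letters of kinds \<open>k\<close> and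
  \<open>k + 1\<close> come from one pair of consecutive blocks.\<close>

definition viol :: "nat \<Rightarrow> pattern list \<Rightarrow> nat set \<Rightarrow> (nat \<times> nat) set \<Rightarrow> bool" where
  "viol j Q K S \<longleftrightarrow> (\<exists>k<3. (k + 2) mod 3 \<notin> K \<and> (\<exists>pat\<in>set Q. occurs j k S pat))"

definition full :: "nat set \<Rightarrow> nat \<Rightarrow> (nat \<times> nat) set \<Rightarrow> bool" where
  "full L k S \<longleftrightarrow> (\<forall>j\<le>N. \<exists>g\<in>L. (k, j * G + g) \<in> S)"

definition bad :: "nat set \<Rightarrow> (nat \<times> nat) set \<Rightarrow> bool" where
  "bad K S \<longleftrightarrow> viol 0 P0 K S \<or> (\<exists>j<N. viol j P K S) \<or> viol N PN K S \<or>
     ({..<3} \<subseteq> K \<and> (\<forall>k<3. \<not> full {..<G} k S))"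

text \<open>At a single point this excludes two defects: two kinds, and a letter of column 0 (code
  \<open>g\<close>) together with one of column 1 (code \<open>G + g'\<close>). The second makes a
  complete row occupy two points. The quantifier over \<open>V\<close> is inside because atoms on an
  interval speak of all its points.\<close>

definition clash :: "(nat \<Rightarrow> nat set) \<Rightarrow> nat set \<Rightarrow> bool" where
  "clash w V \<longleftrightarrow> (\<exists>k<3. \<exists>k'<3. k \<noteq> k' \<and> (\<forall>z\<in>V. k \<in> w z \<and> k' \<in> w z)) \<or>
     (\<exists>g<G. \<exists>g'<G. \<forall>z\<in>V. 2 ^ (g + 2) \<in> w z \<and> 2 ^ (G + g' + 2) \<in> w z)"

definition present :: "nat \<Rightarrow> pattern list \<Rightarrow> (nat \<Rightarrow> nat) \<Rightarrow> (nat \<Rightarrow> nat) \<Rightarrow> bool" where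
  "present j Q c c' \<longleftrightarrow>
     (\<exists>pat\<in>set Q. \<forall>(dk, dj, g) \<in> set pat. (if dk = 0 then c else c') (j + dj) = g)"

definition allowed :: "(nat \<Rightarrow> nat) \<Rightarrow> (nat \<Rightarrow> nat) \<Rightarrow> bool" where
  "allowed c c' \<longleftrightarrow> \<not> present 0 P0 c c' \<and> (\<forall>j<N. \<not> present j P c c') \<and> \<not> present N PN c c'"

definition row :: "nat \<Rightarrow> (nat \<Rightarrow> nat) \<Rightarrow> (nat \<times> nat) set \<Rightarrow> bool" where
  "row k c S \<longleftrightarrow> (\<forall>j\<le>N. c j < G \<and> (k, j * G + c j) \<in> S)"

lemma row_mono: "row k c S \<Longrightarrow> S \<subseteq> S' \<Longrightarrow> row k c S'"
  by (auto simp: row_def)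

lemma full_row:
  assumes "full L k S" "L \<subseteq> {..<G}"
  obtains c where "row k c S" "\<And>j. j \<le> N \<Longrightarrow> c j \<in> L"
proof -
  have "\<forall>j. \<exists>g. j \<le> N \<longrightarrow> g \<in> L \<and> (k, j * G + g) \<in> S"
    using assms by (auto simp: full_def)
  then obtain c where "\<forall>j. j \<le> N \<longrightarrow> c j \<in> L \<and> (k, j * G + c j) \<in> S"
    by metis
  then show thesis
    using that[of c] assms(2) by (auto simp: row_def)
qed

end

text \<open>\<open>fate\<close> abstracts the property of eventually reaching a given halting state:
  it depends only on columns up to \<open>N\<close> and does not change across an allowed pair of
  rows. \<open>unique\<close> asks for its patterns in \<open>P\<close> and in \<open>PN\<close>
  because \<open>P\<close> is applied below column \<open>N\<close> only.\<close>

locale tiling_fate = tiling +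
  fixes fate :: "(nat \<Rightarrow> nat) \<Rightarrow> bool"
  assumes N: "N \<ge> 1"
    and P0: "pat \<in> set P0 \<Longrightarrow> (dk, dj, g) \<in> set pat \<Longrightarrow> dk \<le> 1 \<and> dj = 0"
    and P: "pat \<in> set P \<Longrightarrow> (dk, dj, g) \<in> set pat \<Longrightarrow> dk \<le> 1 \<and> dj \<le> 1"
    and PN: "pat \<in> set PN \<Longrightarrow> (dk, dj, g) \<in> set pat \<Longrightarrow> dk \<le> 1 \<and> dj = 0"
    and unique: "g < G \<Longrightarrow> g' < G \<Longrightarrow> g \<noteq> g' \<Longrightarrow> dk \<le> 1 \<Longrightarrow>
      [(dk, 0, g), (dk, 0, g')] \<in> set P \<inter> set PN"
    and fate_cong: "(\<And>j. j \<le> N \<Longrightarrow> c j = c' j) \<Longrightarrow> fate c = fate c'"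
    and fate_step: "(\<And>j. j \<le> N \<Longrightarrow> c j < G \<and> c' j < G) \<Longrightarrow> allowed c c' \<Longrightarrow> fate c = fate c'"
begin

lemma viol_of_present:
  assumes "present j Q c c'" "k < 3" "(k + 2) mod 3 \<notin> K" "row k c S" "row ((k + 1) mod 3) c' S"
    and "\<And>pat dk dj g. pat \<in> set Q \<Longrightarrow> (dk, dj, g) \<in> set pat \<Longrightarrow> dk \<le> 1 \<and> j + dj \<le> N"
  shows "viol j Q K S"
proof -
  obtain pat where pat: "pat \<in> set Q"
    "\<And>dk dj g. (dk, dj, g) \<in> set pat \<Longrightarrow> (if dk = 0 then c else c') (j + dj) = g"
    using assms(1) by (fastforce simp: present_def)
  have "((k + dk) mod 3, (j + dj) * G + g) \<in> S" if "(dk, dj, g) \<in> set pat" for dk dj g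
  proof -
    have "dk = 0 \<or> dk = 1" "j + dj \<le> N"
      using assms(6)[OF pat(1) that] by auto
    with pat(2)[OF that] assms(2,4,5) show ?thesis
      by (auto simp: row_def)
  qed
  then have "occurs j k S pat"
    by (auto simp: occurs_def)
  with pat(1) assms(2,3) show ?thesis
    by (auto simp: viol_def)
qed

lemma rows_allowed:
  assumes "\<not> bad K S" "k < 3" "(k + 2) mod 3 \<notin> K" "row k c S" "row ((k + 1) mod 3) c' S"
  shows "allowed c c'"
proof -
  have "viol 0 P0 K S" if "present 0 P0 c c'"
    by (rule viol_of_present[OF that assms(2-5)]) (use P0 in auto)
  moreover have "viol j P K S" if "present j P c c'" "j < N" for j
    by (rule viol_of_present[OF that(1) assms(2-5)]) (use P that(2) in force)
  moreover have "viol N PN K S" if "present N PN c c'"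
    by (rule viol_of_present[OF that assms(2-5)]) (use PN in auto)
  ultimately show ?thesis
    using assms(1) by (auto simp: allowed_def bad_def)
qed

text \<open>The guard of a violation fixes the missing kind relative to the earlier block. A row of
  kind \<open>k\<close> is therefore addressed at offset 0 if \<open>k + 2\<close> is missing, and
  at offset 1, from the kind before it, if \<open>k + 1\<close> is missing. This is why
  \<open>unique\<close> provides both offsets.\<close>

lemma row_unique:
  assumes "\<not> bad K S" "r < 3" "r \<notin> K" "k < 3" "r \<noteq> k" "row k c S" "row k c' S" "j \<le> N"
  shows "c j = c' j"
proof (rule ccontr)
  assume ne: "c j \<noteq> c' j"
  have "r = (k + 2) mod 3 \<or> r = (k + 1) mod 3"
    using assms(2,4,5) by (auto simp: less_3)
  then obtain dk k0 where k0: "k0 < 3" "r = (k0 + 2) mod 3" "(k0 + dk) mod 3 = k" "dk \<le> 1"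
  proof
    assume "r = (k + 2) mod 3"
    then show thesis using that[of k 0] assms(4) by auto
  next
    assume "r = (k + 1) mod 3"
    moreover have "((k + 2) mod 3 + 2) mod 3 = (k + 1) mod 3" "((k + 2) mod 3 + 1) mod 3 = k"
      using assms(4) by (auto simp: less_3)
    ultimately show thesis using that[of "(k + 2) mod 3" 1] by auto
  qed
  have "occurs j k0 S [(dk, 0, c j), (dk, 0, c' j)]"
    using assms(6-8) k0(3) by (auto simp: occurs_def row_def)
  moreover have "[(dk, 0, c j), (dk, 0, c' j)] \<in> set P \<inter> set PN"
    using unique ne assms(6-8) k0(4) by (auto simp: row_def)
  ultimately have "viol j P K S" "viol j PN K S"
    using k0 assms(3) by (auto simp: viol_def)
  with assms(1,8) show False
    by (auto simp: bad_def le_less)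
qed

text \<open>Two rows of the same kind coincide. Otherwise their kinds are the two that differ from
  \<open>r\<close>, and the one that follows the other in cyclic order is the later row; no
  information about positions enters.\<close>

lemma fate_eq:
  assumes "\<not> bad K S" "fst ` S \<subseteq> K" "r < 3" "r \<notin> K" "k < 3" "k' < 3" "row k c S" "row k' c' S"
  shows "fate c = fate c'"
proof -
  have "k \<noteq> r" "k' \<noteq> r"
    using assms(2,4,7,8) by (force simp: row_def)+
  then consider "k' = k" | "k' = (k + 1) mod 3" "r = (k + 2) mod 3"
    | "k = (k' + 1) mod 3" "r = (k' + 2) mod 3"
    using assms(3,5,6) by (auto simp: less_3)
  then show ?thesis
  proof cases
    case 1
    then show ?thesis
      using fate_cong row_unique[OF assms(1,3,4,5) \<open>k \<noteq> r\<close>[symmetric] assms(7)] assms(8) by blast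
  next
    case 2
    then show ?thesis
      using fate_step[of c c'] rows_allowed[OF assms(1,5), of c c'] assms(4,7,8)
      by (auto simp: row_def)
  next
    case 3
    then show ?thesis
      using fate_step[of c' c] rows_allowed[OF assms(1,6), of c' c] assms(4,7,8)
      by (auto simp: row_def)
  qed
qed

section \<open>Propagation of the fate through a word without bad intervals\<close>

context
  fixes w :: "nat \<Rightarrow> nat set" and a b :: nat
  assumes not_bad: "\<And>p q. a \<le> p \<Longrightarrow> p < q \<Longrightarrow> q \<le> b \<Longrightarrow> \<not> bad (kinds w {p..q}) (letters w {p..q})"
    and no_clash: "\<And>z. a \<le> z \<Longrightarrow> z \<le> b \<Longrightarrow> \<not> clash w {z}"
begin

lemma one_kind: "a \<le> z \<Longrightarrow> z \<le> b \<Longrightarrow> k \<in> w z \<Longrightarrow> k' \<in> w z \<Longrightarrow> k < 3 \<Longrightarrow> k' < 3 \<Longrightarrow> k = k'"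
  using no_clash[of z] unfolding clash_def by blast

lemma row_points:
  assumes "row k c (letters w V)" "j \<le> N"
  obtains z where "z \<in> V" "k \<in> w z" "2 ^ (j * G + c j + 2) \<in> w z"
  using assms unfolding row_def letters_def by auto

text \<open>Columns 0 and 1 both exist since \<open>N \<ge> 1\<close>, and without a
  \<open>clash\<close> no point carries letters of both.\<close>

lemma row_two_points:
  assumes "row k c (letters w V)" "V \<subseteq> {a..b}"
  obtains y z where "y \<in> V" "z \<in> V" "k \<in> w y" "k \<in> w z" "y \<noteq> z"
proof -
  obtain y where y: "y \<in> V" "k \<in> w y" "2 ^ (0 * G + c 0 + 2) \<in> w y"
    using row_points[OF assms(1), of 0] by auto
  obtain z where z: "z \<in> V" "k \<in> w z" "2 ^ (1 * G + c 1 + 2) \<in> w z"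
    using row_points[OF assms(1), of 1] N by auto
  have "c 0 < G" "c 1 < G"
    using assms(1) N by (auto simp: row_def)
  then have "y \<noteq> z"
    using y z no_clash[of z] assms(2) unfolding clash_def by fastforce
  with y z that show thesis by blast
qed

text \<open>Supplies the condition \<open>p < q\<close> of \<open>not_bad\<close>. That condition is
  there because under the proper relation no interval sees exactly one point.\<close>

lemma row_less:
  assumes "row k c (letters w {p..q})" "a \<le> p" "q \<le> b"
  shows "p < q"
proof -
  have "{p..q} \<subseteq> {a..b}"
    using assms by auto
  from row_two_points[OF assms(1) this] obtain y z where "y \<in> {p..q}" "z \<in> {p..q}" "y \<noteq> z" .
  then show ?thesis by auto
qed

lemma fate_eq_interval:
  assumes "row k c (letters w {p..q})" "row k' c' (letters w {p..q})" "a \<le> p" "q \<le> b"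
    "k < 3" "k' < 3" "r < 3" "r \<notin> kinds w {p..q}"
  shows "fate c = fate c'"
proof (rule fate_eq[OF not_bad _ assms(7,8,5,6,1,2)])
  show "fst ` letters w {p..q} \<subseteq> kinds w {p..q}"
    using letters_kinds by auto
qed (use assms row_less in auto)

text \<open>The invariant of the walk to the right: some interval ending at \<open>z\<close> misses a kind and contains
  a complete row. If \<open>z + 1\<close> brings in the third kind, the shortest interval ending there with all
  three kinds has the form \<open>p q \<dots> q r\<close>, and its complete row must be that of the \<open>q\<close>-block.\<close>

lemma propagate:
  assumes "a \<le> p" "row k0 c0 (letters w {p..q})" "k0 < 3" "r0 < 3" "r0 \<notin> kinds w {p..q}"
    and "q \<le> z" "z \<le> b"
  shows "\<exists>l k c r. a \<le> l \<and> l \<le> z \<and> k < 3 \<and> row k c (letters w {l..z}) \<and>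
    r < 3 \<and> r \<notin> kinds w {l..z} \<and> fate c = fate c0"
  using assms(6,7)
proof (induction z rule: dec_induct)
  case base
  have "p < q"
    using assms(1,2) base by (intro row_less) auto
  with assms show ?case by (meson less_imp_le)
next
  case (step z)
  then obtain l k1 c1 r where l: "a \<le> l" "l \<le> z" "k1 < 3" "row k1 c1 (letters w {l..z})"
    "r < 3" "r \<notin> kinds w {l..z}" "fate c1 = fate c0"
    by (metis Suc_leD)
  show ?case
  proof (cases "{..<3} \<subseteq> kinds w {l..Suc z}")
    case False
    then obtain r' where "r' < 3" "r' \<notin> kinds w {l..Suc z}"
      by auto
    moreover have "row k1 c1 (letters w {l..Suc z})"
      by (rule row_mono[OF l(4) letters_mono]) auto
    ultimately show ?thesis
      using l by (meson le_Suc_eq)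
  next
    case True
    define m where "m = (GREATEST m. m \<le> Suc z \<and> {..<3} \<subseteq> kinds w {m..Suc z})"
    have ex: "l \<le> Suc z \<and> {..<3} \<subseteq> kinds w {l..Suc z}"
      using l True by simp
    have m: "m \<le> Suc z" "{..<3} \<subseteq> kinds w {m..Suc z}"
      using GreatestI_nat[where P = "\<lambda>m. m \<le> Suc z \<and> {..<3} \<subseteq> kinds w {m..Suc z}", OF ex]
      unfolding m_def by blast+
    have lm: "l \<le> m"
      unfolding m_def by (rule Greatest_le_nat[where P = "\<lambda>m. m \<le> Suc z \<and> {..<3} \<subseteq> kinds w {m..Suc z}", OF ex]) blast
    have max: "\<not> {..<3} \<subseteq> kinds w {n..Suc z}" if "m < n" "n \<le> Suc z" for n
      using Greatest_le_nat[where P = "\<lambda>m. m \<le> Suc z \<and> {..<3} \<subseteq> kinds w {m..Suc z}" and b = "Suc z" and k = n]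
        that unfolding m_def[symmetric] by auto
    have "m \<noteq> Suc z"
    proof
      assume "m = Suc z"
      then have "0 \<in> w (Suc z)" "1 \<in> w (Suc z)"
        using m(2) by (auto simp: kinds_def subset_eq less_3)
      then show False
        using one_kind[of "Suc z" 0 1] l step by simp
    qed
    with m(1) have mz: "m \<le> z" by simp
    obtain p' where p': "p' < 3" "p' \<notin> kinds w {Suc m..Suc z}"
      using max[of "Suc m"] mz by auto
    have pm: "p' \<in> w m"
    proof -
      obtain y where "y \<in> {m..Suc z}" "p' \<in> w y"
        using m(2) p'(1) unfolding kinds_def by blast
      moreover have "y \<notin> {Suc m..Suc z}"
        using p' \<open>p' \<in> w y\<close> by (auto simp: kinds_def)
      ultimately show ?thesis
        using \<open>p' \<in> w y\<close> by (cases "y = m") auto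
    qed
    have rz: "r \<in> w (Suc z)"
    proof -
      obtain y where "y \<in> {l..Suc z}" "r \<in> w y"
        using True l(5) unfolding kinds_def by blast
      moreover have "y \<notin> {l..z}"
        using l(5,6) \<open>r \<in> w y\<close> by (auto simp: kinds_def)
      ultimately show ?thesis
        using \<open>r \<in> w y\<close> by (cases "y = Suc z") auto
    qed
    have "\<not> bad (kinds w {m..Suc z}) (letters w {m..Suc z})"
      using l lm mz step by (intro not_bad) auto
    then obtain k where k: "k < 3" "full {..<G} k (letters w {m..Suc z})"
      using m(2) by (auto simp: bad_def)
    then obtain c where c: "row k c (letters w {m..Suc z})"
      using full_row by blast
    have sub: "{m..Suc z} \<subseteq> {a..b}"
      using l lm step by auto
    \<comment> \<open>The kind \<open>p'\<close> is confined to the point \<open>m\<close>, and a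
      complete row needs two points. The same reason rules out \<open>r\<close>, which is confined
      to \<open>Suc z\<close>.\<close>
    have "k \<noteq> p'"
    proof
      assume "k = p'"
      from row_two_points[OF c sub] obtain x y where xy: "x \<in> {m..Suc z}" "y \<in> {m..Suc z}"
        "k \<in> w x" "k \<in> w y" "x \<noteq> y" .
      have "u = m" if "u \<in> {m..Suc z}" "k \<in> w u" for u
        using that p' \<open>k = p'\<close> by (force simp: kinds_def)
      with xy show False by blast
    qed
    have "k \<noteq> r"
    proof
      assume "k = r"
      from row_two_points[OF c sub] obtain x y where xy: "x \<in> {m..Suc z}" "y \<in> {m..Suc z}"
        "k \<in> w x" "k \<in> w y" "x \<noteq> y" .
      have "u = Suc z" if "u \<in> {m..Suc z}" "k \<in> w u" for u
        using that l(5,6) lm \<open>k = r\<close> by (force simp: kinds_def)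
      with xy show False by blast
    qed
    \<comment> \<open>The points \<open>m\<close> and \<open>Suc z\<close> have the kinds
      \<open>p'\<close> and \<open>r\<close> and no other, so the whole row lies strictly between
      them. It can then be compared with the old row inside \<open>{l..z}\<close>, which misses
      \<open>r\<close>, and it restores the invariant in \<open>{Suc m..Suc z}\<close>, which misses
      \<open>p'\<close>.\<close>
    have inner: "row k c (letters w {Suc m..z})"
      unfolding row_def
    proof (intro allI impI conjI)
      fix j assume j: "j \<le> N"
      show "c j < G"
        using c j by (simp add: row_def)
      obtain y where y: "y \<in> {m..Suc z}" "k \<in> w y" "2 ^ (j * G + c j + 2) \<in> w y"
        using row_points[OF c j] .
      have "y \<noteq> m"
        using y(2) pm one_kind[of m k p'] k(1) p'(1) \<open>k \<noteq> p'\<close> sub mz by auto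
      moreover have "y \<noteq> Suc z"
        using y(2) rz one_kind[of "Suc z" k r] k(1) l(5) \<open>k \<noteq> r\<close> sub mz by auto
      ultimately have "y \<in> {Suc m..z}"
        using y(1) by auto
      with y k(1) show "(k, j * G + c j) \<in> letters w {Suc m..z}"
        by (auto simp: letters_def)
    qed
    have "row k c (letters w {l..z})"
      by (rule row_mono[OF inner letters_mono]) (use lm in auto)
    then have "fate c = fate c1"
      using fate_eq_interval[OF _ l(4) l(1) _ k(1) l(3) l(5,6)] step by simp
    moreover have "row k c (letters w {Suc m..Suc z})"
      by (rule row_mono[OF inner letters_mono]) auto
    moreover have "a \<le> Suc m" "Suc m \<le> Suc z"
      using l lm mz by auto
    ultimately show ?thesis
      using k(1) p' l(7) by metis
  qed
qed

text \<open>Once the first row has been carried to \<open>q'\<close>, there are two intervals with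
  the same right end, so one contains the other. The larger contains both rows and still misses a
  kind.\<close>

lemma fate_eq_ordered:
  assumes "a \<le> p" "row k c (letters w {p..q})" "k < 3" "r < 3" "r \<notin> kinds w {p..q}"
    and "a \<le> p'" "row k' c' (letters w {p'..q'})" "k' < 3" "r' < 3" "r' \<notin> kinds w {p'..q'}"
    and "q \<le> q'" "q' \<le> b"
  shows "fate c = fate c'"
proof -
  obtain l k1 c1 r1 where l: "a \<le> l" "l \<le> q'" "k1 < 3" "row k1 c1 (letters w {l..q'})"
    "r1 < 3" "r1 \<notin> kinds w {l..q'}" "fate c1 = fate c"
    using propagate[OF assms(1-5,11,12)] by blast
  show ?thesis
  proof (cases "l \<le> p'")
    case True
    have "row k' c' (letters w {l..q'})"
      by (rule row_mono[OF assms(7) letters_mono]) (use True in auto)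
    from fate_eq_interval[OF l(4) this l(1) assms(12) l(3) assms(8) l(5,6)] l(7) show ?thesis
      by simp
  next
    case False
    have "row k1 c1 (letters w {p'..q'})"
      by (rule row_mono[OF l(4) letters_mono]) (use False in auto)
    from fate_eq_interval[OF this assms(7,6,12) l(3) assms(8,9,10)] l(7) show ?thesis
      by simp
  qed
qed

lemma fate_eq_global:
  assumes "a \<le> p" "q \<le> b" "row k c (letters w {p..q})" "k < 3" "r < 3" "r \<notin> kinds w {p..q}"
    and "a \<le> p'" "q' \<le> b" "row k' c' (letters w {p'..q'})" "k' < 3" "r' < 3" "r' \<notin> kinds w {p'..q'}"
  shows "fate c = fate c'"
proof (cases "q \<le> q'")
  case True
  then show ?thesis
    using fate_eq_ordered[of p k c q r p' k' c' q' r'] assms by blast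
next
  case False
  then show ?thesis
    using fate_eq_ordered[of p' k' c' q' r' p k c q r] assms by auto
qed

end

end


section \<open>The word of a sequence of rows\<close>

locale tiling_rows = tiling +
  fixes c :: "nat \<Rightarrow> nat \<Rightarrow> nat" and T :: nat
  assumes N: "N \<ge> 1"
    and digits: "pat \<in> set P0 \<union> set P \<union> set PN \<Longrightarrow> (dk, dj, g) \<in> set pat \<Longrightarrow> dk \<le> 1 \<and> g < G"
    and c_less: "j \<le> N \<Longrightarrow> c t j < G"
    and allowed_init: "allowed (\<lambda>_. G) (c 0)"
    and allowed_Suc: "allowed (c t) (c (Suc t))"
begin

definition blk :: "nat \<Rightarrow> nat" where
  "blk z = (z - 3) div Suc N"

definition off :: "nat \<Rightarrow> nat" where
  "off z = (z - 3) mod Suc N"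

text \<open>Three empty points on either side leave room for nested strict sub-intervals.\<close>

definition size :: nat where
  "size = 6 + Suc T * Suc N"

definition point :: "nat \<Rightarrow> nat set" where
  "point z = (if 3 \<le> z \<and> z + 3 < size
     then {blk z mod 3, 2 ^ (off z * G + c (blk z) (off z) + 2)} else {})"

lemma off_le: "off z \<le> N"
  using mod_less_divisor[of "Suc N" "z - 3"] unfolding off_def by linarith

lemma not_power: "k < 3 \<Longrightarrow> k \<noteq> 2 ^ (i + 2)" for k :: nat
proof -
  have "1 \<le> (2 :: nat) ^ i" by simp
  then have "4 \<le> (2 :: nat) ^ (i + 2)" by (simp add: power_add)
  then show "k < 3 \<Longrightarrow> k \<noteq> 2 ^ (i + 2)" by linarith
qed

lemma kind_point: "k < 3 \<Longrightarrow> k \<in> point z \<longleftrightarrow> 3 \<le> z \<and> z + 3 < size \<and> k = blk z mod 3"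
  using not_power[of k] by (auto simp: point_def)

lemma letter_point:
  "2 ^ (i + 2) \<in> point z \<longleftrightarrow> 3 \<le> z \<and> z + 3 < size \<and> i = off z * G + c (blk z) (off z)"
proof -
  have "2 ^ (i + 2) \<noteq> blk z mod 3"
    using not_power[of "blk z mod 3" i] by simp
  then show ?thesis
    by (auto simp: point_def simp del: power_Suc power_add)
qed

lemma digits_unique:
  assumes "(a :: nat) * G + g = a' * G + g'" "g < G" "g' < G"
  shows "a = a' \<and> g = g'"
proof -
  have "(a * G + g) div G = a" "(a' * G + g') div G = a'"
    using assms(2,3) by simp_all
  with assms(1) show ?thesis by auto
qed

lemma blk_start: "blk (3 + b * Suc N + j) = b" "off (3 + b * Suc N + j) = j" if "j \<le> N"
proof -
  have "(b * Suc N + j) div Suc N = b" "(b * Suc N + j) mod Suc N = j"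
    using that div_mult_self3[of "Suc N" b j] by (simp_all del: mult_Suc_right)
  then show "blk (3 + b * Suc N + j) = b" "off (3 + b * Suc N + j) = j"
    by (simp_all add: blk_def off_def add.assoc del: mult_Suc_right)
qed

lemma z_eq: "3 \<le> z \<Longrightarrow> z = 3 + blk z * Suc N + off z"
  using div_mult_mod_eq[of "z - 3" "Suc N"] unfolding blk_def off_def by linarith

lemma block_between:
  assumes "3 \<le> z" "3 \<le> z'" "blk z < b" "b < blk z'" "j \<le> N"
  shows "z < 3 + b * Suc N + j" "3 + b * Suc N + j < z'"
proof -
  have "Suc (blk z) * Suc N \<le> b * Suc N" "Suc b * Suc N \<le> blk z' * Suc N"
    using assms(3,4) by (intro mult_le_mono1; simp)+
  then show "z < 3 + b * Suc N + j" "3 + b * Suc N + j < z'"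
    using z_eq[OF assms(1)] z_eq[OF assms(2)] off_le[of z] off_le[of z'] assms(5) by simp_all
qed

text \<open>The blocks numbered \<open>blk z\<close>, \<open>blk z + 1\<close> and
  \<open>blk z + 2\<close> all have a point between \<open>z\<close> and \<open>z'\<close>, and
  three consecutive numbers exhaust the residues modulo 3.\<close>

lemma kinds_three:
  assumes "z \<in> {p..q}" "z' \<in> {p..q}" "3 \<le> z" "z' + 3 < size" "blk z + 2 \<le> blk z'"
  shows "{..<3} \<subseteq> kinds point {p..q}"
proof -
  have "3 \<le> z'"
    using assms(5) by (cases "3 \<le> z'") (simp_all add: blk_def)
  let ?y = "3 + Suc (blk z) * Suc N + 0"
  have y: "z < ?y" "?y < z'"
    using block_between[OF assms(3) \<open>3 \<le> z'\<close>, of "Suc (blk z)" 0] assms(5) by simp_all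
  have blk_y: "blk ?y = Suc (blk z)"
    by (rule blk_start) simp
  let ?x = "3 + (blk z + 2) * Suc N + 0"
  have x: "z < ?x" "?x \<le> z'" "blk ?x = blk z + 2"
  proof -
    have "(blk z + 2) * Suc N \<le> blk z' * Suc N"
      using assms(5) by (rule mult_le_mono1)
    then show "?x \<le> z'"
      using z_eq[OF \<open>3 \<le> z'\<close>] by linarith
    show "z < ?x"
      using y(1) by simp
    show "blk ?x = blk z + 2"
      by (rule blk_start) simp
  qed
  have in_kinds: "blk u mod 3 \<in> kinds point {p..q}" if "z \<le> u" "u \<le> z'" for u
  proof -
    have "u \<in> {p..q}" "blk u mod 3 \<in> point u"
      using that assms by (auto simp: kind_point)
    then show ?thesis
      unfolding kinds_def by auto
  qed
  have "blk z mod 3 \<in> kinds point {p..q}" "Suc (blk z) mod 3 \<in> kinds point {p..q}"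
    "(blk z + 2) mod 3 \<in> kinds point {p..q}"
    using in_kinds[of z] in_kinds[of ?y, unfolded blk_y] in_kinds[of ?x, unfolded x(3)] x(1,2) y
    by linarith+
  moreover have "{..<3} = {blk z mod 3, Suc (blk z) mod 3, (blk z + 2) mod 3}"
  proof -
    have "blk z mod 3 < 3" by simp
    then show ?thesis
      by (auto simp: less_3 mod_Suc numeral_2_eq_2)
  qed
  ultimately show ?thesis by simp
qed

text \<open>For numbers at distance at most one, residues modulo 3 tell equality, successor and
  predecessor apart; two kinds could not separate the last two.\<close>

lemma mod_3_cases:
  assumes "b \<le> Suc b0" "b0 \<le> Suc b"
  shows "b mod 3 = b0 mod 3 \<longleftrightarrow> b = b0" "(b0 mod 3 + 1) mod 3 = b mod 3 \<longleftrightarrow> b = Suc b0"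
proof -
  consider "b = b0" | "b = Suc b0" | "b0 = Suc b"
    using assms by linarith
  then have "(b mod 3 = b0 mod 3 \<longleftrightarrow> b = b0) \<and> ((b0 mod 3 + 1) mod 3 = b mod 3 \<longleftrightarrow> b = Suc b0)"
    by cases (simp_all add: mod_Suc)
  then show "b mod 3 = b0 mod 3 \<longleftrightarrow> b = b0" "(b0 mod 3 + 1) mod 3 = b mod 3 \<longleftrightarrow> b = Suc b0"
    by blast+
qed

text \<open>\<open>u\<close> numbers the later of the two blocks that the interval meets. Points of
  kind \<open>k\<close> then lie in block \<open>u - 1\<close>; for \<open>u = 0\<close> there are
  none, and the first block plays the later role without a predecessor.\<close>

lemma row_index:
  assumes "k < 3" "(k + 2) mod 3 \<notin> kinds point {p..q}"
  shows "\<exists>u. \<forall>z\<in>{p..q}. (k \<in> point z \<longrightarrow> Suc (blk z) = u) \<and>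
    ((k + 1) mod 3 \<in> point z \<longrightarrow> blk z = u)"
proof -
  have near: "blk z' \<le> Suc (blk z)" if "z \<in> {p..q}" "z' \<in> {p..q}" "3 \<le> z" "z' + 3 < size" for z z'
  proof (rule ccontr)
    assume "\<not> ?thesis"
    then have "{..<3} \<subseteq> kinds point {p..q}"
      using kinds_three[OF that] by simp
    moreover have "(k + 2) mod 3 \<in> {..<3}"
      by simp
    ultimately show False using assms(2) by blast
  qed
  define Z where "Z = {z \<in> {p..q}. 3 \<le> z \<and> z + 3 < size}"
  have near: "blk z' \<le> Suc (blk z)" if "z \<in> Z" "z' \<in> Z" for z z'
    using near that by (auto simp: Z_def)
  have kp: "k' \<in> point z \<longleftrightarrow> z \<in> Z \<and> k' = blk z mod 3" if "z \<in> {p..q}" "k' < 3" for k' z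
    using kind_point[OF that(2)] that(1) by (auto simp: Z_def)
  show ?thesis
  proof (cases "\<exists>z\<in>Z. k = blk z mod 3")
    case True
    then obtain z0 where z0: "z0 \<in> Z" "k = blk z0 mod 3" by blast
    have "(k = blk z mod 3 \<longrightarrow> Suc (blk z) = Suc (blk z0)) \<and>
        ((k + 1) mod 3 = blk z mod 3 \<longrightarrow> blk z = Suc (blk z0))" if "z \<in> Z" for z
      using mod_3_cases[OF near[OF z0(1) that] near[OF that z0(1)]] z0(2) by metis
    then show ?thesis
      using kp assms(1) by (intro exI[of _ "Suc (blk z0)"]) auto
  next
    case False
    show ?thesis
    proof (cases "\<exists>z\<in>Z. (k + 1) mod 3 = blk z mod 3")
      case True
      then obtain z0 where z0: "z0 \<in> Z" "(k + 1) mod 3 = blk z0 mod 3" by blast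
      have "blk z = blk z0" if "z \<in> Z" "(k + 1) mod 3 = blk z mod 3" for z
        using mod_3_cases(1)[OF near[OF z0(1) that(1)] near[OF that(1) z0(1)]] z0(2) that(2) by metis
      then show ?thesis
        using kp assms(1) False by (intro exI[of _ "blk z0"]) auto
    qed (use kp assms(1) False in auto)
  qed
qed

text \<open>The row before the first one consists of the digit \<open>G\<close>, which no pattern mentions.\<close>

definition crow :: "nat \<Rightarrow> nat \<Rightarrow> nat" where
  "crow u = (case u of 0 \<Rightarrow> \<lambda>_. G | Suc t \<Rightarrow> c t)"

lemma allowed_crow: "allowed (crow u) (crow (Suc u))"
  using allowed_init allowed_Suc by (cases u) (auto simp: crow_def)

lemma viol_present:
  assumes "viol j Q (kinds point {p..q}) (letters point {p..q})" "set Q \<subseteq> set P0 \<union> set P \<union> set PN"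
  shows "\<exists>u. present j Q (crow u) (crow (Suc u))"
proof -
  from assms(1) obtain k pat where k: "k < 3" "(k + 2) mod 3 \<notin> kinds point {p..q}"
    and pat: "pat \<in> set Q" "occurs j k (letters point {p..q}) pat"
    by (auto simp: viol_def)
  obtain u where u: "\<And>z. z \<in> {p..q} \<Longrightarrow> (k \<in> point z \<longrightarrow> Suc (blk z) = u) \<and>
    ((k + 1) mod 3 \<in> point z \<longrightarrow> blk z = u)"
    using row_index[OF k] by blast
  have "(if dk = 0 then crow u else crow (Suc u)) (j + dj) = g" if pd: "(dk, dj, g) \<in> set pat" for dk dj g
  proof -
    have dk: "dk = 0 \<or> dk = 1" and g: "g < G"
      using digits[OF _ that] pat(1) assms(2) by auto
    obtain z where z: "z \<in> {p..q}" "(k + dk) mod 3 \<in> point z" "2 ^ ((j + dj) * G + g + 2) \<in> point z"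
    proof -
      have "((k + dk) mod 3, (j + dj) * G + g) \<in> letters point {p..q}"
        using pat(2) pd unfolding occurs_def by fast
      then show thesis
        using that unfolding letters_def by blast
    qed
    then have "(j + dj) * G + g = off z * G + c (blk z) (off z)"
      using letter_point by blast
    then have "off z = j + dj \<and> c (blk z) (off z) = g"
      using digits_unique[OF _ g c_less[OF off_le]] by metis
    moreover have "crow (Suc (blk z)) = c (blk z)"
      by (simp add: crow_def)
    ultimately show ?thesis
      using dk u[OF z(1)] z(2) k(1) by auto
  qed
  then show ?thesis
    using pat(1) unfolding present_def by blast
qed

lemma point_not_bad: "\<not> bad (kinds point {p..q}) (letters point {p..q})"
proof
  assume "bad (kinds point {p..q}) (letters point {p..q})"
  then consider "viol 0 P0 (kinds point {p..q}) (letters point {p..q})"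
    | j where "j < N" "viol j P (kinds point {p..q}) (letters point {p..q})"
    | "viol N PN (kinds point {p..q}) (letters point {p..q})"
    | "{..<3} \<subseteq> kinds point {p..q}" "\<And>k. k < 3 \<Longrightarrow> \<not> full {..<G} k (letters point {p..q})"
    by (auto simp: bad_def)
  then show False
  proof cases
    case 1
    then obtain u where "present 0 P0 (crow u) (crow (Suc u))"
      using viol_present by blast
    with allowed_crow[of u] show False by (auto simp: allowed_def)
  next
    case 2
    then obtain u where "present j P (crow u) (crow (Suc u))"
      using viol_present by blast
    with allowed_crow[of u] 2(1) show False by (auto simp: allowed_def)
  next
    case 3
    then obtain u where "present N PN (crow u) (crow (Suc u))"
      using viol_present by blast
    with allowed_crow[of u] show False by (auto simp: allowed_def)
  next
    case 4
    have "\<exists>z\<in>{p..q}. 3 \<le> z \<and> z + 3 < size \<and> k = blk z mod 3" if "k < 3" for k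
    proof -
      have "k \<in> kinds point {p..q}"
        using 4(1) that by blast
      then show ?thesis
        using kind_point[OF that] by (auto simp: kinds_def)
    qed
    from this[of 0] this[of 1] this[of 2] obtain z0 z1 z2 where z:
      "z0 \<in> {p..q}" "3 \<le> z0" "z0 + 3 < size" "0 = blk z0 mod 3"
      "z1 \<in> {p..q}" "3 \<le> z1" "z1 + 3 < size" "1 = blk z1 mod 3"
      "z2 \<in> {p..q}" "3 \<le> z2" "z2 + 3 < size" "2 = blk z2 mod 3"
      by auto
    obtain y y' where y: "y \<in> {p..q}" "3 \<le> y" "y' \<in> {p..q}" "3 \<le> y'" "y' + 3 < size" "blk y + 2 \<le> blk y'"
    proof -
      \<comment> \<open>The three block numbers have distinct residues modulo 3, hence are distinct,
        and among three distinct numbers two differ by at least two.\<close>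
      have "blk z0 + 2 \<le> blk z1 \<or> blk z0 + 2 \<le> blk z2 \<or> blk z1 + 2 \<le> blk z0 \<or>
          blk z1 + 2 \<le> blk z2 \<or> blk z2 + 2 \<le> blk z0 \<or> blk z2 + 2 \<le> blk z1"
      proof -
        have "blk z0 = 3 * (blk z0 div 3)" "blk z1 = 3 * (blk z1 div 3) + 1"
          "blk z2 = 3 * (blk z2 div 3) + 2"
          using z(4,8,12) by (metis add.right_neutral mult_div_mod_eq)+
        moreover have "b0 + 2 \<le> b1 \<or> b0 + 2 \<le> b2 \<or> b1 + 2 \<le> b0 \<or>
            b1 + 2 \<le> b2 \<or> b2 + 2 \<le> b0 \<or> b2 + 2 \<le> b1"
          if "b0 = 3 * m0" "b1 = 3 * m1 + 1" "b2 = 3 * m2 + 2" for b0 b1 b2 m0 m1 m2 :: nat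
        proof (rule ccontr)
          assume "\<not> ?thesis"
          then have "b1 \<le> b0 + 1" "b0 \<le> b1 + 1" "b2 \<le> b0 + 1" "b1 \<le> b2 + 1"
            by auto
          with that show False by presburger
        qed
        ultimately show ?thesis by blast
      qed
      with z that show thesis by blast
    qed
    \<comment> \<open>The block after that of \<open>y\<close> lies strictly between
      \<open>y\<close> and \<open>y'\<close>, so all its columns are in the interval.\<close>
    let ?b = "Suc (blk y)"
    have "(?b mod 3, j * G + c ?b j) \<in> letters point {p..q}" if "j \<le> N" for j
    proof -
      let ?u = "3 + ?b * Suc N + j"
      have "y < ?u" "?u < y'"
        using block_between[OF y(2,4), of ?b j] y(6) that by simp_all
      then have u: "?u \<in> {p..q}" "3 \<le> ?u" "?u + 3 < size"
        using y by auto
      then have "?b mod 3 \<in> point ?u" "2 ^ (j * G + c ?b j + 2) \<in> point ?u"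
        using blk_start[OF that, of ?b] by (simp_all add: point_def del: mult_Suc)
      with u(1) show ?thesis
        unfolding letters_def by auto
    qed
    then have "full {..<G} (?b mod 3) (letters point {p..q})"
      using c_less by (auto simp: full_def)
    with 4(2) show False by simp
  qed
qed

lemma point_no_clash:
  assumes "V \<noteq> {}"
  shows "\<not> clash point V"
proof
  obtain z where z: "z \<in> V"
    using assms by blast
  assume "clash point V"
  then consider k k' where "k < 3" "k' < 3" "k \<noteq> k'" "k \<in> point z" "k' \<in> point z"
    | g g' where "g < G" "g' < G" "2 ^ (g + 2) \<in> point z" "2 ^ (G + g' + 2) \<in> point z"
    using z by (auto simp: clash_def)
  then show False
  proof cases
    case 1
    then show ?thesis using kind_point by metis
  next
    case 2
    then show ?thesis using letter_point[of g z] letter_point[of "G + g'" z] by auto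
  qed
qed

lemma point_row:
  assumes "t \<le> T" "{3 + t * Suc N..3 + t * Suc N + N} \<subseteq> V"
  shows "row (t mod 3) (c t) (letters point V)"
  unfolding row_def
proof (intro allI impI conjI)
  fix j assume j: "j \<le> N"
  show "c t j < G" using c_less[OF j] .
  let ?u = "3 + t * Suc N + j"
  have "t * Suc N \<le> T * Suc N"
    using assms(1) by (rule mult_le_mono1)
  then have "?u + 3 < size"
    using j by (simp add: size_def)
  then have "t mod 3 \<in> point ?u" "2 ^ (j * G + c t j + 2) \<in> point ?u"
    using blk_start[OF j, of t] by (simp_all add: point_def)
  moreover have "?u \<in> V"
    using assms(2) j by auto
  ultimately show "(t mod 3, j * G + c t j) \<in> letters point V"
    unfolding letters_def by auto
qed

end


section \<open>Formula schemas\<close>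

definition subinterval_relation :: "nat subrel \<Rightarrow> bool" where
  "subinterval_relation sub \<longleftrightarrow> sub = proper_sub \<or> sub = strict_sub"

lemma proper_sub_nat:
  "proper_sub less_than (x', y') (x, y) \<longleftrightarrow> x \<le> x' \<and> y' \<le> y \<and> (x', y') \<noteq> (x, y)"
  by (auto simp: proper_sub_def)

lemma strict_sub_nat: "strict_sub less_than (x', y') (x, y) \<longleftrightarrow> x < x' \<and> y' < y"
  by (auto simp: strict_sub_def)

lemma intervals_nat: "(x, y) \<in> intervals {0..<n} less_than \<longleftrightarrow> x \<le> y \<and> y < n"
  by (auto simp: intervals_def)

lemma trace_model_simps:
  "points (trace_model w) = {0..<length w}" "lt (trace_model w) = less_than"
  "(x, y) \<in> val (trace_model w) p \<longleftrightarrow> x \<le> y \<and> y < length w \<and> (\<forall>z\<in>{x..y}. p \<in> w ! z)"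
  by (simp_all add: trace_model_def)

text \<open>For the proper relation these are all points of an interval that is not a point, for the
  strict one the interior points.\<close>

definition visible :: "nat subrel \<Rightarrow> nat \<times> nat \<Rightarrow> nat set" where
  "visible sub I = {z. sub less_than (z, z) I}"

lemma visible_eq:
  "visible proper_sub (x, y) = (if x = y then {} else {x..y})"
  "visible strict_sub (x, y) = {x<..<y}"
  by (auto simp: visible_def proper_sub_nat strict_sub_nat)

lemma visible_interval:
  assumes "subinterval_relation sub" "z \<in> visible sub (x, y)"
  obtains p q where "visible sub (x, y) = {p..q}" "x \<le> p" "q \<le> y"
  using assms
proof (elim subinterval_relation_def[THEN iffD1, THEN disjE])
  assume "sub = strict_sub"
  then show thesis
    using that[of "Suc x" "y - 1"] assms(2) by (force simp: visible_eq)
qed (use that[of x y] assms(2) in \<open>auto simp: visible_eq split: if_splits\<close>)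

lemma visible_inner:
  assumes "subinterval_relation sub" "sub less_than (x', y') (x, y)" "x' \<le> y'"
  shows "visible sub (x', y') \<subseteq> visible sub (x, y)" "y' \<le> y" "x \<le> x'"
  using assms
  by (auto simp: subinterval_relation_def visible_def proper_sub_nat strict_sub_nat)

lemma visible_sub:
  assumes "subinterval_relation sub" "sub less_than (x', y') (x, y)" "x' \<le> z" "z \<le> y'"
  shows "z \<in> visible sub (x, y)"
  using assms
  by (auto simp: subinterval_relation_def visible_def proper_sub_nat strict_sub_nat)

text \<open>The witness is \<open>[p, q]\<close> for the proper relation, where \<open>p < q\<close>
  keeps it from being a blind one-point interval, and \<open>[p - 1, q + 1]\<close> for the strict
  one. The latter fits strictly inside \<open>[x, y]\<close> because \<open>p\<close> and
  \<open>q\<close> are already interior to the inner interval \<open>[x', y']\<close>.\<close>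

lemma visible_cover:
  assumes "subinterval_relation sub" "sub less_than (x', y') (x, y)"
    and "p < q" "p \<in> visible sub (x', y')" "q \<in> visible sub (x', y')"
  shows "\<exists>x'' y''. sub less_than (x'', y'') (x, y) \<and> x'' \<le> y'' \<and> visible sub (x'', y'') = {p..q}"
proof (cases "sub = proper_sub")
  case True
  with assms show ?thesis
    by (intro exI[of _ p] exI[of _ q]) (auto simp: visible_eq proper_sub_nat split: if_splits)
next
  case False
  with assms(1) have "sub = strict_sub"
    by (simp add: subinterval_relation_def)
  with assms show ?thesis
    by (intro exI[of _ "p - 1"] exI[of _ "Suc q"]) (auto simp: visible_eq strict_sub_nat)
qed

lemma holds_Dia_trace:
  "holds sub (trace_model w) (x, y) (Dia \<phi>) \<longleftrightarrow>
    (\<exists>x' y'. x' \<le> y' \<and> y' < length w \<and> sub less_than (x', y') (x, y) \<and>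
      holds sub (trace_model w) (x', y') \<phi>)"
  unfolding holds.simps trace_model_simps Bex_def split_paired_Ex intervals_nat by blast

text \<open>A property that holds on an interval iff it holds at all its points can always be
  witnessed by a one-point sub-interval. Thus a diamond in front of a conjunction of atoms asks for
  one visible point.\<close>

lemma holds_Dia_points:
  assumes "subinterval_relation sub" "y < length w"
    and "\<And>x' y'. x' \<le> y' \<Longrightarrow> y' < length w \<Longrightarrow>
      holds sub (trace_model w) (x', y') \<phi> \<longleftrightarrow> (\<forall>z\<in>{x'..y'}. A (w ! z))"
  shows "holds sub (trace_model w) (x, y) (Dia \<phi>) \<longleftrightarrow> (\<exists>z\<in>visible sub (x, y). A (w ! z))"
proof
  assume "holds sub (trace_model w) (x, y) (Dia \<phi>)"
  then obtain x' y' where I: "x' \<le> y'" "y' < length w" "sub less_than (x', y') (x, y)"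
    "\<forall>z\<in>{x'..y'}. A (w ! z)"
    unfolding holds_Dia_trace using assms(3) by blast
  then show "\<exists>z\<in>visible sub (x, y). A (w ! z)"
    using visible_sub[OF assms(1) I(3), of x'] by auto
next
  assume "\<exists>z\<in>visible sub (x, y). A (w ! z)"
  then obtain z where z: "sub less_than (z, z) (x, y)" "A (w ! z)"
    by (auto simp: visible_def)
  moreover from z(1) assms(1,2) have "z < length w"
    by (auto simp: subinterval_relation_def proper_sub_nat strict_sub_nat)
  ultimately show "holds sub (trace_model w) (x, y) (Dia \<phi>)"
    unfolding holds_Dia_trace using assms(3)[of z z] by auto
qed

text \<open>A fixed description of a family of formulas, with loops over registers and tests of the
  input letter under head 0. It is read in two ways: \<open>inst\<close> yields the formula,
  \<open>code\<close> a generator for its encoding.\<close>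

datatype schema = SAtom nat | SVar nat nat nat | SNeg schema | SOr schema schema | SDia schema
  | SBig nat nat schema schema | SCase symbol schema schema

primrec inst :: "bool list \<Rightarrow> schema \<Rightarrow> (nat \<Rightarrow> nat) \<Rightarrow> form" where
  "inst x (SAtom p) e = Atom p"
| "inst x (SVar v G c) e = Atom (2 ^ (e v * G + c))"
| "inst x (SNeg s) e = Neg (inst x s e)"
| "inst x (SOr s t) e = Or (inst x s e) (inst x t e)"
| "inst x (SDia s) e = Dia (inst x s e)"
| "inst x (SBig v u s t) e =
    foldr Or (map (\<lambda>i. inst x s (e(v := i, u := e u - Suc i))) [0..<e u]) (inst x t e)"
| "inst x (SCase a s t) e = (if word_tape x (e 0) = a then inst x s e else inst x t e)"

text \<open>Register 10 is reserved for the loops that print exponents.\<close>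

definition power_code :: "nat \<Rightarrow> nat \<Rightarrow> nat \<Rightarrow> gen" where
  "power_code v G c = Cat (For 10 v (Lit (concat (replicate G [True, False]))))
     (Lit (concat (replicate c [True, False]) @ [True, True, False]))"

primrec code :: "schema \<Rightarrow> gen" where
  "code (SAtom p) = Lit ([False, False] @ enc_nat p)"
| "code (SVar v G c) = Cat (Lit [False, False]) (power_code v G c)"
| "code (SNeg s) = Cat (Lit [False, True]) (code s)"
| "code (SOr s t) = Cat (Lit [True, False]) (Cat (code s) (code t))"
| "code (SDia s) = Cat (Lit [True, True]) (code s)"
| "code (SBig v u s t) = Cat (For v u (Cat (Lit [True, False]) (code s))) (code t)"
| "code (SCase a s t) = Case a (code s) (code t)"

lemma bits_power: "bits (2 ^ m) = replicate m False @ [True]"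
proof (induction m)
  case 0
  then show ?case by (simp add: bits.simps[of "Suc 0"] bits.simps[of 0])
next
  case (Suc m)
  then show ?case by (subst bits.simps) simp
qed

lemma enc_nat_power: "enc_nat (2 ^ m) = concat (replicate m [True, False]) @ [True, True, False]"
  by (simp add: enc_nat_def enc_list_def bits_power map_replicate_const)

lemma concat_replicate_mult: "concat (replicate n (concat (replicate m xs))) = concat (replicate (n * m) xs)"
  by (induction n) (simp_all add: replicate_add)

lemma emit_power_code: "emit x (power_code v G c) e = enc_nat (2 ^ (e v * G + c))"
  by (simp add: power_code_def enc_nat_power map_replicate_const concat_replicate_mult replicate_add)

lemma enc_form_foldr_Or:
  "enc_form (foldr Or \<phi>s \<psi>) = concat (map (\<lambda>\<phi>. [True, False] @ enc_form \<phi>) \<phi>s) @ enc_form \<psi>"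
  by (induction \<phi>s) simp_all

lemma emit_code: "emit x (code s) e = enc_form (inst x s e)"
  by (induction s arbitrary: e) (simp_all add: emit_power_code enc_form_foldr_Or o_def)

lemma holds_foldr_Or:
  "holds sub M I (foldr Or \<phi>s \<psi>) \<longleftrightarrow> (\<exists>\<phi>\<in>set \<phi>s. holds sub M I \<phi>) \<or> holds sub M I \<psi>"
  by (induction \<phi>s) auto

lemma atoms_foldr_Or: "atoms (foldr Or \<phi>s \<psi>) = (\<Union>\<phi>\<in>set \<phi>s. atoms \<phi>) \<union> atoms \<psi>"
  by (induction \<phi>s) auto

definition SAnd :: "schema \<Rightarrow> schema \<Rightarrow> schema" where
  "SAnd s t = SNeg (SOr (SNeg s) (SNeg t))"

text \<open>Formulas have no constant for falsity. Atom 0 is used because it is a kind and hence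
  always among the propositions.\<close>

definition SBot :: schema where
  "SBot = SNeg (SOr (SAtom 0) (SNeg (SAtom 0)))"

definition SAny :: "schema list \<Rightarrow> schema" where
  "SAny ss = foldr SOr ss SBot"

definition SAll :: "schema list \<Rightarrow> schema" where
  "SAll ss = SNeg (SAny (map SNeg ss))"

lemma holds_SAnd [simp]: "holds sub M I (inst x (SAnd s t) e) \<longleftrightarrow>
    holds sub M I (inst x s e) \<and> holds sub M I (inst x t e)"
  by (simp add: SAnd_def)

lemma holds_SBot [simp]: "\<not> holds sub M I (inst x SBot e)"
  by (simp add: SBot_def)

lemma holds_SAny [simp]: "holds sub M I (inst x (SAny ss) e) \<longleftrightarrow> (\<exists>s\<in>set ss. holds sub M I (inst x s e))"
  by (induction ss) (simp_all add: SAny_def)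

lemma holds_SAll [simp]: "holds sub M I (inst x (SAll ss) e) \<longleftrightarrow> (\<forall>s\<in>set ss. holds sub M I (inst x s e))"
  by (simp add: SAll_def)

lemma scoped_SAnd [simp]: "scoped Z (code (SAnd s t)) \<longleftrightarrow> scoped Z (code s) \<and> scoped Z (code t)"
  by (simp add: SAnd_def)

lemma scoped_SBot [simp]: "scoped Z (code SBot)"
  by (simp add: SBot_def)

lemma scoped_SAny [simp]: "scoped Z (code (SAny ss)) \<longleftrightarrow> (\<forall>s\<in>set ss. scoped Z (code s))"
  by (induction ss) (simp_all add: SAny_def)

lemma scoped_SAll [simp]: "scoped Z (code (SAll ss)) \<longleftrightarrow> (\<forall>s\<in>set ss. scoped Z (code s))"
  by (simp add: SAll_def)

lemma atoms_SAnd [simp]: "atoms (inst x (SAnd s t) e) = atoms (inst x s e) \<union> atoms (inst x t e)"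
  by (simp add: SAnd_def)

lemma atoms_SBot [simp]: "atoms (inst x SBot e) = {0}"
  by (simp add: SBot_def)

lemma atoms_SAny [simp]: "atoms (inst x (SAny ss) e) = insert 0 (\<Union>s\<in>set ss. atoms (inst x s e))"
  by (induction ss) (auto simp: SAny_def)

lemma atoms_SAll [simp]: "atoms (inst x (SAll ss) e) = insert 0 (\<Union>s\<in>set ss. atoms (inst x s e))"
  by (simp add: SAll_def)

section \<open>The formula of a tiling and its meaning on traces\<close>

context tiling
begin

definition has_kind :: "nat \<Rightarrow> schema" where
  "has_kind k = SDia (SAtom k)"

definition has :: "nat \<Rightarrow> nat \<Rightarrow> nat \<Rightarrow> schema" where
  "has k v c = SDia (SAnd (SAtom k) (SVar v G (c + 2)))"

definition occurs_schema :: "nat \<Rightarrow> nat \<Rightarrow> pattern \<Rightarrow> schema" where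
  "occurs_schema v k pat = SAnd (SNeg (has_kind ((k + 2) mod 3)))
     (SAll (map (\<lambda>(dk, dj, g). has ((k + dk) mod 3) v (dj * G + g)) pat))"

definition viol_schema :: "nat \<Rightarrow> pattern list \<Rightarrow> schema" where
  "viol_schema v Q = SAny (concat (map (\<lambda>k. map (occurs_schema v k) Q) [0..<3]))"

text \<open>Register 6 holds \<open>N + 1\<close>, so the counter 8 ranges over the columns 0 to
  \<open>N\<close>; the conjunction over columns is a negated disjunction.\<close>

definition full_schema :: "nat list \<Rightarrow> nat \<Rightarrow> schema" where
  "full_schema L k = SNeg (SBig 8 6 (SNeg (SAny (map (has k 8) L))) SBot)"

definition clash_schema :: schema where
  "clash_schema = SAny (
     concat (map (\<lambda>k. map (\<lambda>k'. SAnd (SAtom k) (SAtom k')) (filter (\<lambda>k'. k \<noteq> k') [0..<3])) [0..<3]) @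
     concat (map (\<lambda>g. map (\<lambda>g'. SAnd (SVar 8 G (g + 2)) (SVar 8 G (G + g' + 2))) [0..<G]) [0..<G]))"

text \<open>Registers double as column numbers: outside a loop register 8 is 0 and gives column 0,
  while register 5 holds \<open>N\<close>, which makes it the bound of the loop over
  \<open>P\<close> and the column for \<open>PN\<close>. Likewise \<open>clash_schema\<close> sees
  register 8 as 0.\<close>

definition bad_schema :: schema where
  "bad_schema = SAny [viol_schema 8 P0, SBig 8 5 (viol_schema 8 P) SBot, viol_schema 5 PN,
     SAll (map has_kind [0..<3] @ map (\<lambda>k. SNeg (full_schema [0..<G] k)) [0..<3]), clash_schema]"

definition letter_schema :: "(symbol \<Rightarrow> nat) \<Rightarrow> schema" where
  "letter_schema ini = SCase Left_End (has 0 0 (ini Left_End))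
     (SCase Blank (has 0 0 (ini Blank))
       (SCase (Bit False) (has 0 0 (ini (Bit False))) (has 0 0 (ini (Bit True)))))"

text \<open>The counter is register 0, the input head itself. When the requirement for column
  \<open>j\<close> is printed, the head scans cell \<open>j\<close>, so \<open>SCase\<close> selects
  the initial letter of exactly that column; past the input it reads \<open>Blank\<close>.\<close>

definition start_schema :: "(symbol \<Rightarrow> nat) \<Rightarrow> schema" where
  "start_schema ini = SNeg (SBig 0 6 (SNeg (letter_schema ini)) SBot)"

text \<open>The last block of a run is chosen to have kind 0: its left neighbour, which the proper relation
  may show partially, then has kind 2, and kind 1 is missing.\<close>

definition run_schema :: "(symbol \<Rightarrow> nat) \<Rightarrow> nat list \<Rightarrow> schema" where
  "run_schema ini L = SAnd (SNeg (SDia bad_schema))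
     (SDia (SAnd (SDia (SAnd (SNeg (has_kind 2)) (start_schema ini)))
       (SDia (SAnd (SNeg (has_kind 1)) (full_schema L 0)))))"

lemma set_upt_0: "set [0..<n] = {..<n}"
  by auto

lemma word_tape_cases: "word_tape x i \<in> {Left_End, Blank, Bit False, Bit True}"
  by (auto simp: word_tape_def)

context
  fixes sub :: "nat subrel" and w :: "nat set list" and x :: "bool list" and e :: "nat \<Rightarrow> nat"
  assumes sub: "subinterval_relation sub"
    and e: "e 0 = 0" "e 5 = N" "e 6 = Suc N" "e 8 = 0"
begin

abbreviation sat :: "nat \<times> nat \<Rightarrow> schema \<Rightarrow> (nat \<Rightarrow> nat) \<Rightarrow> bool" where
  "sat I s e' \<equiv> holds sub (trace_model w) I (inst x s e')"

lemma sat_has_kind: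
  assumes "q < length w" "k < 3"
  shows "sat (p, q) (has_kind k) e' \<longleftrightarrow> k \<in> kinds ((!) w) (visible sub (p, q))"
proof -
  have "sat (p, q) (has_kind k) e' \<longleftrightarrow> (\<exists>z\<in>visible sub (p, q). k \<in> w ! z)"
    unfolding has_kind_def inst.simps
    by (rule holds_Dia_points[OF sub assms(1)]) (auto simp: trace_model_simps)
  then show ?thesis
    using assms(2) by (simp add: kinds_def)
qed

lemma sat_has:
  assumes "q < length w" "k < 3"
  shows "sat (p, q) (has k v c) e' \<longleftrightarrow> (k, e' v * G + c) \<in> letters ((!) w) (visible sub (p, q))"
proof -
  have "sat (p, q) (has k v c) e' \<longleftrightarrow>
      (\<exists>z\<in>visible sub (p, q). k \<in> w ! z \<and> 2 ^ (e' v * G + (c + 2)) \<in> w ! z)"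
    unfolding has_def inst.simps
    by (rule holds_Dia_points[OF sub assms(1)]) (auto simp: trace_model_simps)
  then show ?thesis
    using assms(2) by (simp add: letters_def add.assoc)
qed

lemma sat_viol_schema:
  assumes "q < length w"
  shows "sat (p, q) (viol_schema v Q) e' \<longleftrightarrow>
    viol (e' v) Q (kinds ((!) w) (visible sub (p, q))) (letters ((!) w) (visible sub (p, q)))"
proof -
  have "sat (p, q) (occurs_schema v k pat) e' \<longleftrightarrow>
      (k + 2) mod 3 \<notin> kinds ((!) w) (visible sub (p, q)) \<and>
      occurs (e' v) k (letters ((!) w) (visible sub (p, q))) pat" for k pat
    using assms by (auto simp: occurs_schema_def occurs_def sat_has_kind sat_has distrib_right
        add.assoc split: prod.splits)
  then show ?thesis
    by (auto simp: viol_schema_def viol_def)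
qed

lemma sat_full_schema:
  assumes "q < length w" "k < 3" "e' 6 = Suc N"
  shows "sat (p, q) (full_schema L k) e' \<longleftrightarrow> full (set L) k (letters ((!) w) (visible sub (p, q)))"
  using assms
  by (auto simp: full_schema_def full_def holds_foldr_Or sat_has less_Suc_eq_le set_upt_0
      simp del: upt_Suc set_upt)

lemma sat_clash_schema:
  assumes "p \<le> q" "q < length w"
  shows "sat (p, q) clash_schema e \<longleftrightarrow> clash ((!) w) {p..q}"
proof -
  have "sat (p, q) clash_schema e \<longleftrightarrow>
     (\<exists>k\<in>{..<3}. \<exists>k'\<in>{..<3}. k \<noteq> k' \<and> (\<forall>z\<in>{p..q}. k \<in> w ! z) \<and> (\<forall>z\<in>{p..q}. k' \<in> w ! z)) \<or>
     (\<exists>g\<in>{..<G}. \<exists>g'\<in>{..<G}. (\<forall>z\<in>{p..q}. 2 ^ (g + 2) \<in> w ! z) \<and>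
       (\<forall>z\<in>{p..q}. 2 ^ (G + g' + 2) \<in> w ! z))"
    using assms e by (auto simp: clash_schema_def trace_model_simps bex_Un simp del: upt_Suc power_Suc)
  then show ?thesis
    unfolding clash_def by blast
qed

lemma sat_bad_schema:
  assumes "p \<le> q" "q < length w"
  shows "sat (p, q) bad_schema e \<longleftrightarrow>
    bad (kinds ((!) w) (visible sub (p, q))) (letters ((!) w) (visible sub (p, q))) \<or>
    clash ((!) w) {p..q}"
  using assms
  by (auto simp: bad_schema_def bad_def sat_viol_schema sat_clash_schema sat_has_kind
      sat_full_schema holds_foldr_Or bex_Un ball_Un subset_eq set_upt_0 e simp del: upt_Suc set_upt)

lemma sat_start_schema:
  assumes "q < length w"
  shows "sat (p, q) (start_schema ini) e \<longleftrightarrow>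
    (\<forall>j\<le>N. (0, j * G + ini (word_tape x j)) \<in> letters ((!) w) (visible sub (p, q)))"
proof -
  have letter: "sat (p, q) (letter_schema ini) e' \<longleftrightarrow>
      (0, e' 0 * G + ini (word_tape x (e' 0))) \<in> letters ((!) w) (visible sub (p, q))" for e'
    using word_tape_cases[of x "e' 0"] assms by (auto simp: sat_has letter_schema_def)
  show ?thesis
    by (auto simp: start_schema_def holds_foldr_Or letter e less_Suc_eq_le set_upt_0
        simp del: upt_Suc set_upt)
qed

lemma sat_run_schema:
  "sat I (run_schema ini L) e \<longleftrightarrow>
    \<not> sat I (SDia bad_schema) e \<and>
    sat I (SDia (SAnd (SDia (SAnd (SNeg (has_kind 2)) (start_schema ini)))
       (SDia (SAnd (SNeg (has_kind 1)) (full_schema L 0))))) e"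
  by (simp add: run_schema_def del: holds.simps(4))

end

end

text \<open>Bad visible sets are excluded only for sub-intervals of the root \<open>[a, b]\<close>.
  By \<open>visible_cover\<close> these yield every \<open>{p..q}\<close> with \<open>p < q\<close>
  among the points seen from the intermediate interval \<open>[x0, y0]\<close>, and both rows are
  found within those points. The global comparison of fates therefore applies between
  \<open>p0\<close> and \<open>q0\<close>.\<close>

lemma (in tiling_fate) run_schema_sound:
  assumes sub: "subinterval_relation sub"
    and e: "e 0 = 0" "e 5 = N" "e 6 = Suc N" "e 8 = 0"
    and ab: "b < length w"
    and hold: "holds sub (trace_model w) (a, b) (inst x (run_schema ini L) e)"
    and ini: "\<And>s. ini s < G" and L: "set L \<subseteq> {..<G}"
  shows "\<exists>c. (\<forall>j\<le>N. c j \<in> set L) \<and> fate (\<lambda>j. ini (word_tape x j)) = fate c"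
proof -
  let ?sat = "\<lambda>I s. holds sub (trace_model w) I (inst x s e)"
  let ?c0 = "\<lambda>j. ini (word_tape x j)"
  note hold' = hold[unfolded sat_run_schema[OF sub e]]
  from hold' obtain x0 y0 where J0: "x0 \<le> y0" "y0 < length w" "sub less_than (x0, y0) (a, b)"
    "?sat (x0, y0) (SAnd (SDia (SAnd (SNeg (has_kind 2)) (start_schema ini)))
       (SDia (SAnd (SNeg (has_kind 1)) (full_schema L 0))))"
    unfolding inst.simps holds_Dia_trace by blast
  then have "?sat (x0, y0) (SDia (SAnd (SNeg (has_kind 2)) (start_schema ini)))"
    "?sat (x0, y0) (SDia (SAnd (SNeg (has_kind 1)) (full_schema L 0)))"
    by (simp_all del: inst.simps holds.simps)
  then obtain x1 y1 x2 y2 where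
    J1: "x1 \<le> y1" "y1 < length w" "sub less_than (x1, y1) (x0, y0)"
      "?sat (x1, y1) (SAnd (SNeg (has_kind 2)) (start_schema ini))" and
    J2: "x2 \<le> y2" "y2 < length w" "sub less_than (x2, y2) (x0, y0)"
      "?sat (x2, y2) (SAnd (SNeg (has_kind 1)) (full_schema L 0))"
    unfolding inst.simps holds_Dia_trace by blast
  have row1: "2 \<notin> kinds ((!) w) (visible sub (x1, y1))"
    "row 0 ?c0 (letters ((!) w) (visible sub (x1, y1)))"
    using J1 ini by (auto simp: row_def sat_has_kind[OF sub e] sat_start_schema[OF sub e])
  have full2: "1 \<notin> kinds ((!) w) (visible sub (x2, y2))"
    "full (set L) 0 (letters ((!) w) (visible sub (x2, y2)))"
    using J2 e by (auto simp: sat_has_kind[OF sub e] sat_full_schema[OF sub e])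
  obtain c where c: "row 0 c (letters ((!) w) (visible sub (x2, y2)))" "\<And>j. j \<le> N \<Longrightarrow> c j \<in> set L"
    using full_row[OF full2(2) L] by blast
  have nonempty: "V \<noteq> {}" if "row k c' (letters ((!) w) V)" for k c' V
    using that by (auto simp: row_def letters_def)
  obtain p1 q1 where V1: "visible sub (x1, y1) = {p1..q1}"
    using nonempty[OF row1(2)] visible_interval[OF sub] by (metis ex_in_conv)
  obtain p2 q2 where V2: "visible sub (x2, y2) = {p2..q2}"
    using nonempty[OF c(1)] visible_interval[OF sub] by (metis ex_in_conv)
  have le: "p1 \<le> q1" "p2 \<le> q2"
    using nonempty[OF row1(2)] nonempty[OF c(1)] by (simp_all add: V1 V2)
  have in0: "{p1..q1} \<subseteq> visible sub (x0, y0)" "{p2..q2} \<subseteq> visible sub (x0, y0)"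
    using visible_inner(1)[OF sub J1(3,1)] visible_inner(1)[OF sub J2(3,1)] by (simp_all add: V1 V2)
  then have "p1 \<in> visible sub (x0, y0)"
    using le by auto
  then obtain p0 q0 where V0: "visible sub (x0, y0) = {p0..q0}" "x0 \<le> p0" "q0 \<le> y0"
    by (rule visible_interval[OF sub])
  have no_bad: "\<not> ?sat (p, q) bad_schema" if "p \<le> q" "q < length w" "sub less_than (p, q) (a, b)" for p q
    using hold' that unfolding inst.simps holds_Dia_trace by blast
  have "\<not> bad (kinds ((!) w) {p..q}) (letters ((!) w) {p..q})" if pq: "p0 \<le> p" "p < q" "q \<le> q0" for p q
  proof -
    have "p \<in> visible sub (x0, y0)" "q \<in> visible sub (x0, y0)"
      using pq V0 by auto
    then obtain x' y' where J: "sub less_than (x', y') (a, b)" "x' \<le> y'" "visible sub (x', y') = {p..q}"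
      using visible_cover[OF sub J0(3) pq(2)] by blast
    then have "y' < length w"
      using visible_inner(2)[OF sub J(1,2)] ab by simp
    then show ?thesis
      using no_bad[OF J(2) _ J(1)] J(2,3) by (simp add: sat_bad_schema[OF sub e])
  qed
  moreover have "\<not> clash ((!) w) {z}" if "p0 \<le> z" "z \<le> q0" for z
  proof -
    have "z \<in> visible sub (a, b)"
      using visible_inner(1)[OF sub J0(3,1)] V0(1) that by auto
    then have "sub less_than (z, z) (a, b)"
      by (simp add: visible_def)
    moreover have "z < length w"
      using that V0(3) J0(2) by simp
    ultimately show ?thesis
      using no_bad[of z z] by (simp add: sat_bad_schema[OF sub e])
  qed
  ultimately have "fate ?c0 = fate c"
    using fate_eq_global[of p0 q0 "(!) w" p1 q1 0 ?c0 2 p2 q2 0 c 1] row1 c(1) full2 in0 V0 V1 V2 le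
    by simp
  with c(2) show ?thesis by blast
qed

lemma kinds_cong: "(\<And>z. z \<in> V \<Longrightarrow> w z = w' z) \<Longrightarrow> kinds w V = kinds w' V"
  by (auto simp: kinds_def)

lemma letters_cong: "(\<And>z. z \<in> V \<Longrightarrow> w z = w' z) \<Longrightarrow> letters w V = letters w' V"
  by (auto simp: letters_def)

lemma (in tiling_rows) run_schema_complete:
  assumes sub: "subinterval_relation sub"
    and e: "e 0 = 0" "e 5 = N" "e 6 = Suc N" "e 8 = 0"
    and T: "T mod 3 = 0"
    and start: "\<And>j. j \<le> N \<Longrightarrow> c 0 j = ini (word_tape x j)"
    and final: "\<And>j. j \<le> N \<Longrightarrow> c T j \<in> set L"
  shows "holds sub (trace_model (map point [0..<size])) (0, size - 1) (inst x (run_schema ini L) e)"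
proof -
  let ?w = "map point [0..<size]"
  let ?sat = "\<lambda>I s. holds sub (trace_model ?w) I (inst x s e)"
  have vis_sub: "visible sub (p, q) \<subseteq> {p..q}" for p q
    using sub by (auto simp: subinterval_relation_def visible_eq split: if_splits)
  have w: "?w ! z = point z" if "z < size" for z
    using that by simp
  have eqs: "kinds ((!) ?w) (visible sub (p, q)) = kinds point (visible sub (p, q))"
    "letters ((!) ?w) (visible sub (p, q)) = letters point (visible sub (p, q))" if "q < size" for p q
    using vis_sub[of p q] w that by (intro kinds_cong letters_cong; force)+
  have "\<not> ?sat (p, q) bad_schema" if "p \<le> q" "q < size" for p q
  proof -
    obtain p' q' where "visible sub (p, q) = {p'..q'}"
    proof (cases "visible sub (p, q) = {}")
      case True
      then show thesis using that[of 1 0] by simp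
    next
      case False
      then show thesis using that visible_interval[OF sub] by (metis ex_in_conv)
    qed
    then have "\<not> bad (kinds point (visible sub (p, q))) (letters point (visible sub (p, q)))"
      using point_not_bad by simp
    moreover have "\<not> clash ((!) ?w) {p..q}"
      using point_no_clash[of "{p..q}"] w that by (auto simp: clash_def)
    ultimately show ?thesis
      using that by (simp add: sat_bad_schema[OF sub e] eqs)
  qed
  then have no_bad: "\<not> ?sat (0, size - 1) (SDia bad_schema)"
    unfolding inst.simps holds_Dia_trace by simp
  have size: "size = 6 + T * Suc N + Suc N"
    by (simp add: size_def)
  \<comment> \<open>The second interval frames block 0, at points 3 to \<open>N + 3\<close>: point 2
    is empty, and \<open>N + 4\<close> is empty or opens block 1, so kind 2 is absent. The third
    frames block \<open>T\<close>, of kind 0: on its left is an empty point or the end of a block of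
    kind 2, on its right an empty point, so kind 1 is absent. The proper relation shows these end
    points, the strict one hides them.\<close>
  have subs: "sub less_than (1, size - 2) (0, size - 1)" "sub less_than (2, N + 4) (1, size - 2)"
    "sub less_than (2 + T * Suc N, 3 + T * Suc N + Suc N) (1, size - 2)"
    using sub by (auto simp: subinterval_relation_def proper_sub_nat strict_sub_nat size simp del: mult_Suc_right)
  have kind0: "2 \<notin> kinds point (visible sub (2, N + 4))"
  proof -
    have "blk z \<le> 1" if "z \<le> N + 4" for z
    proof -
      have "blk z \<le> Suc N div Suc N"
        unfolding blk_def by (rule div_le_mono) (use that in simp)
      then show ?thesis by simp
    qed
    then have "2 \<noteq> blk z mod 3" if "z \<le> N + 4" for z
      using that by (metis One_nat_def le_trans mod_less_eq_dividend not_less_eq_eq numeral_2_eq_2 le_refl)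
    then show ?thesis
      using vis_sub[of 2 "N + 4"] kind_point[of 2] by (fastforce simp: kinds_def)
  qed
  have "{3..3 + N} \<subseteq> visible sub (2, N + 4)"
    using sub by (auto simp: subinterval_relation_def visible_eq)
  then have row0: "row 0 (c 0) (letters point (visible sub (2, N + 4)))"
    using point_row[of 0 "visible sub (2, N + 4)"] by simp
  have init: "?sat (2, N + 4) (SAnd (SNeg (has_kind 2)) (start_schema ini))"
  proof -
    have "N + 4 < size"
      by (simp add: size)
    then show ?thesis
      using kind0 row0 start
      by (simp add: sat_has_kind[OF sub e] sat_start_schema[OF sub e] eqs row_def del: upt_Suc)
  qed
  let ?I = "(2 + T * Suc N, 3 + T * Suc N + Suc N)"
  have kind1: "1 \<notin> kinds point (visible sub ?I)"
  proof
    assume "1 \<in> kinds point (visible sub ?I)"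
    then obtain z where z: "z \<in> visible sub ?I" "1 \<in> point z"
      by (auto simp: kinds_def)
    have z1: "3 \<le> z" "z + 3 < size" "1 = blk z mod 3"
      using z(2) kind_point[of 1 z] by auto
    have "2 + T * Suc N \<le> z"
      using z(1) vis_sub[of "2 + T * Suc N" "3 + T * Suc N + Suc N"] by (auto simp del: mult_Suc_right)
    then have "T * Suc N \<le> blk z * Suc N + N + 1"
      using z_eq[OF z1(1)] off_le[of z] by linarith
    then have "T * Suc N \<le> Suc (blk z) * Suc N"
      by simp
    then have 1: "T \<le> Suc (blk z)"
      by (metis mult_le_cancel2 zero_less_Suc)
    have "blk z * Suc N < Suc T * Suc N"
      using z_eq[OF z1(1)] z1(2) size by simp
    then have 2: "blk z < Suc T"
      by (metis mult_less_cancel2)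
    show False
      using 1 2 T z1(3) by presburger
  qed
  have "{3 + T * Suc N..3 + T * Suc N + N} \<subseteq> visible sub ?I"
    using sub by (auto simp: subinterval_relation_def visible_eq simp del: mult_Suc_right)
  then have "row 0 (c T) (letters point (visible sub ?I))"
    using point_row[of T "visible sub ?I"] T by simp
  then have full1: "full (set L) 0 (letters point (visible sub ?I))"
    using final by (auto simp: row_def full_def)
  have final: "?sat ?I (SAnd (SNeg (has_kind 1)) (full_schema L 0))"
  proof -
    have "3 + T * Suc N + Suc N < size"
      by (simp add: size)
    then show ?thesis
      using kind1 full1 e(3)
      by (simp add: sat_has_kind[OF sub e] sat_full_schema[OF sub e] eqs del: mult_Suc_right upt_Suc One_nat_def)
  qed
  have SDiaI: "?sat (p, q) (SDia s)"
    if "p' \<le> q'" "q' < size" "sub less_than (p', q') (p, q)" "?sat (p', q') s" for p q p' q' s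
    unfolding inst.simps holds_Dia_trace using that by auto
  have "?sat (1, size - 2) (SAnd (SDia (SAnd (SNeg (has_kind 2)) (start_schema ini)))
       (SDia (SAnd (SNeg (has_kind 1)) (full_schema L 0))))"
    unfolding holds_SAnd[of _ _ _ _ "SDia _" "SDia _"]
    by (intro conjI SDiaI[OF _ _ subs(2) init] SDiaI[OF _ _ subs(3) final]) (simp_all add: size)
  from SDiaI[OF _ _ subs(1) this]
  have "?sat (0, size - 1) (SDia (SAnd (SDia (SAnd (SNeg (has_kind 2)) (start_schema ini)))
       (SDia (SAnd (SNeg (has_kind 1)) (full_schema L 0)))))"
    by (simp add: size del: holds.simps inst.simps)
  with no_bad show ?thesis
    unfolding sat_run_schema[OF sub e] by blast
qed


section \<open>Turing machine computations as tilings\<close>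

text \<open>The position of a cell relative to the head.\<close>

datatype place = Before | At | After

definition place :: "nat \<Rightarrow> nat \<Rightarrow> place" where
  "place j h = (if j < h then Before else if j = h then At else After)"

lemma place_simps [simp]:
  "place j h = Before \<longleftrightarrow> j < h" "place j h = At \<longleftrightarrow> j = h" "place j h = After \<longleftrightarrow> h < j"
  by (auto simp: place_def)

type_synonym letter = "nat \<times> symbol list \<times> (symbol \<times> place) list"

definition letter_of :: "nat config \<Rightarrow> nat \<Rightarrow> letter" where
  "letter_of cf j = (fst cf, reads (snd cf), map (\<lambda>(c, h). (c j, place j h)) (snd cf))"

abbreviation cell :: "letter \<Rightarrow> nat \<Rightarrow> symbol" where
  "cell l t \<equiv> fst (snd (snd l) ! t)"

abbreviation pos :: "letter \<Rightarrow> nat \<Rightarrow> place" where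
  "pos l t \<equiv> snd (snd (snd l) ! t)"

lemma place_sequence:
  assumes "f 0 \<noteq> After" "f N = After"
    and "\<And>j. j < N \<Longrightarrow> (f j, f (Suc j)) \<in> {(Before, Before), (Before, At), (At, After), (After, After)}"
  shows "\<exists>h<N. \<forall>j\<le>N. f j = place j h"
proof -
  define h where "h = (LEAST j. f j = After) - 1"
  let ?m = "LEAST j. f j = After"
  have m1: "f ?m = After" "?m \<le> N"
    using LeastI[of "\<lambda>j. f j = After" N] Least_le[of "\<lambda>j. f j = After" N] assms(2) by auto
  moreover have "?m \<noteq> 0"
    using m1(1) assms(1) by metis
  ultimately have m: "f ?m = After" "?m \<le> N" "?m \<noteq> 0"
    by simp_all
  have before: "f j \<noteq> After" if "j < ?m" for j
    using not_less_Least that by blast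
  have hm: "Suc h = ?m"
    using m(3) by (simp add: h_def)
  have at: "f h = At"
    using assms(3)[of h] before[of h] m hm by auto
  have after: "f j = After" if "?m \<le> j" "j \<le> N" for j
    using that
  proof (induction j rule: dec_induct)
    case (step j)
    then show ?case using assms(3)[of j] by auto
  qed (use m in simp)
  have "f (h - i) = Before" if "0 < i" "i \<le> h" for i
    using that
  proof (induction i)
    case (Suc i)
    have "f (Suc (h - Suc i)) = (if i = 0 then At else Before)"
      using Suc at by (auto simp: Suc_diff_Suc)
    then show ?case
      using assms(3)[of "h - Suc i"] m hm Suc.prems by (auto split: if_splits)
  qed simp
  then have less: "f j = Before" if "j < h" for j
    using that by (metis diff_diff_cancel diff_le_self less_imp_le zero_less_diff)
  have "f j = place j h" if "j \<le> N" for j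
    using less[of j] at after[of j] hm that by (cases j h rule: linorder_cases) (auto simp: place_def)
  moreover have "h < N"
    using m hm by simp
  ultimately show ?thesis by blast
qed

locale tm_tiling =
  fixes M :: "nat tm"
  assumes wf: "wf_tm M"
begin

lemma delta_wf:
  assumes "q \<in> states M" "length r = ntapes M" "set r \<subseteq> alphabet M"
  shows "fst (delta M q r) \<in> states M \<and> length (snd (delta M q r)) = ntapes M \<and>
    fst ` set (snd (delta M q r)) \<subseteq> alphabet M"
  using wf assms unfolding wf_tm_def case_prod_unfold by blast

text \<open>Halted configurations perform an idle step, so that all steps have the same form.\<close>

definition eff :: "nat \<Rightarrow> symbol list \<Rightarrow> nat \<times> (symbol \<times> direction) list" where
  "eff q r = (if q \<in> {accept M, reject M} then (q, stay r) else delta M q r)"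

lemma step_eff: "step M cf =
  (fst (eff (fst cf) (reads (snd cf))), map2 act (snd (eff (fst cf) (reads (snd cf)))) (snd cf))"
  by (cases cf) (auto simp: step_def eff_def halted_def map2_act_stay split: prod.split)

text \<open>The last condition ties the recorded symbol under each head to the cell where that head
  stands; every other column only repeats the record.\<close>

definition Letters :: "letter set" where
  "Letters = {(q, r, cs). q \<in> states M \<and> length r = ntapes M \<and> set r \<subseteq> alphabet M \<and>
     length cs = ntapes M \<and> fst ` set cs \<subseteq> alphabet M \<and>
     (\<forall>t<ntapes M. snd (cs ! t) = At \<longrightarrow> fst (cs ! t) = r ! t)}"

lemma finite_Letters: "finite Letters"
proof -
  have "UNIV = {Before, At, After}"
    using place.exhaust by blast
  then have "finite (UNIV :: place set)"
    by (metis finite.emptyI finite_insert)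
  then have "finite (states M \<times> {r. set r \<subseteq> alphabet M \<and> length r = ntapes M} \<times>
      {cs. set cs \<subseteq> alphabet M \<times> (UNIV :: place set) \<and> length cs = ntapes M})"
    using wf by (intro finite_cartesian_product finite_lists_length_eq) (auto simp: wf_tm_def)
  then show ?thesis
    by (rule rev_finite_subset) (force simp: Letters_def)
qed

definition Ls :: "letter list" where
  "Ls = (SOME ls. set ls = Letters \<and> distinct ls)"

lemma Ls: "set Ls = Letters" "distinct Ls"
  using someI_ex[OF finite_distinct_list[OF finite_Letters]] by (simp_all add: Ls_def)

definition G :: nat where
  "G = length Ls"

text \<open>The default 0 keeps every index below \<open>G\<close>, also for triples outside
  \<open>Letters\<close>, which \<open>ini\<close> can form from a symbol that is not in the
  alphabet.\<close>

definition idx :: "letter \<Rightarrow> nat" where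
  "idx l = (if l \<in> Letters then LEAST i. i < G \<and> Ls ! i = l else 0)"

lemma idx: "l \<in> Letters \<Longrightarrow> idx l < G \<and> Ls ! idx l = l"
proof -
  assume l: "l \<in> Letters"
  then obtain i where "i < G \<and> Ls ! i = l"
    using Ls(1) by (metis G_def in_set_conv_nth)
  from LeastI[of "\<lambda>i. i < G \<and> Ls ! i = l", OF this] l show ?thesis
    by (simp add: idx_def)
qed

lemma Ls_nth: "i < G \<Longrightarrow> Ls ! i \<in> Letters"
  using Ls(1) by (metis G_def nth_mem)

text \<open>Patterns are forbidden, so a relation required between the letters at two positions is
  turned into the list of all pairs outside it.\<close>

definition mk :: "nat \<times> nat \<Rightarrow> nat \<times> nat \<Rightarrow> (letter \<Rightarrow> letter \<Rightarrow> bool) \<Rightarrow> pattern list" where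
  "mk a b R = concat (map (\<lambda>g. map (\<lambda>h. [(fst a, snd a, g), (fst b, snd b, h)])
     (filter (\<lambda>h. \<not> R (Ls ! g) (Ls ! h)) [0..<G])) [0..<G])"

lemma in_mk: "pat \<in> set (mk a b R) \<longleftrightarrow>
  (\<exists>g<G. \<exists>h<G. \<not> R (Ls ! g) (Ls ! h) \<and> pat = [(fst a, snd a, g), (fst b, snd b, h)])"
  by (auto simp: mk_def)

definition adjacent :: "letter \<Rightarrow> letter \<Rightarrow> bool" where
  "adjacent l l' \<longleftrightarrow> fst l = fst l' \<and> fst (snd l) = fst (snd l') \<and>
     (\<forall>t<ntapes M. (pos l t, pos l' t) \<in> {(Before, Before), (Before, At), (At, After), (After, After)})"

definition updated :: "letter \<Rightarrow> letter \<Rightarrow> bool" where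
  "updated l l' \<longleftrightarrow> fst l' = fst (eff (fst l) (fst (snd l))) \<and>
     (\<forall>t<ntapes M. cell l' t =
       (if pos l t = At then fst (snd (eff (fst l) (fst (snd l))) ! t) else cell l t))"

text \<open>Only the arrival of a head is stated. That no second head appears in the new row follows
  from the conditions on that row alone, by \<open>place_sequence\<close>.\<close>

definition moved :: "direction \<Rightarrow> letter \<Rightarrow> letter \<Rightarrow> bool" where
  "moved d l l' \<longleftrightarrow> (\<forall>t<ntapes M. pos l t = At \<longrightarrow>
     snd (snd (eff (fst l) (fst (snd l))) ! t) = d \<longrightarrow> pos l' t = At)"

text \<open>Written as a relation so that \<open>mk\<close> accepts it; the two positions are then
  the same.\<close>

definition leftmost :: "letter \<Rightarrow> letter \<Rightarrow> bool" where
  "leftmost l l' \<longleftrightarrow> (\<forall>t<ntapes M. pos l t \<noteq> After)"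

definition rightmost :: "letter \<Rightarrow> letter \<Rightarrow> bool" where
  "rightmost l l' \<longleftrightarrow> (\<forall>t<ntapes M. pos l t = After)"

text \<open>Here \<open>moved Left\<close> relates column 0 to column 0, as a left move from cell 0
  leaves the head in place. All other left moves are covered in \<open>P\<close>, from the right
  column of a pair to the left one.\<close>

definition P0 :: "pattern list" where
  "P0 = mk (0, 0) (0, 0) leftmost @ mk (1, 0) (1, 0) leftmost @ mk (0, 0) (1, 0) (moved Left)"

definition P :: "pattern list" where
  "P = mk (0, 0) (0, 0) (=) @ mk (1, 0) (1, 0) (=) @ mk (0, 0) (0, 1) adjacent @
     mk (1, 0) (1, 1) adjacent @ mk (0, 0) (1, 0) updated @ mk (0, 0) (1, 0) (moved Stay) @
     mk (0, 0) (1, 1) (moved Right) @ mk (0, 1) (1, 0) (moved Left)"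

definition PN :: "pattern list" where
  "PN = mk (0, 0) (0, 0) (=) @ mk (1, 0) (1, 0) (=) @ mk (0, 0) (0, 0) rightmost @
     mk (1, 0) (1, 0) rightmost @ mk (0, 0) (1, 0) updated"

definition valid :: "nat \<Rightarrow> (nat \<Rightarrow> letter) \<Rightarrow> bool" where
  "valid N A \<longleftrightarrow> leftmost (A 0) (A 0) \<and> (\<forall>j<N. adjacent (A j) (A (Suc j))) \<and> rightmost (A N) (A N)"

definition linked :: "nat \<Rightarrow> (nat \<Rightarrow> letter) \<Rightarrow> (nat \<Rightarrow> letter) \<Rightarrow> bool" where
  "linked N A A' \<longleftrightarrow> moved Left (A 0) (A' 0) \<and> (\<forall>j\<le>N. updated (A j) (A' j)) \<and>
     (\<forall>j<N. moved Stay (A j) (A' j) \<and> moved Right (A j) (A' (Suc j)) \<and> moved Left (A (Suc j)) (A' j))"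

section \<open>Decoding rows of letters into configurations\<close>

definition decode :: "nat \<Rightarrow> (nat \<Rightarrow> letter) \<Rightarrow> nat config" where
  "decode N A = (fst (A 0), map (\<lambda>t. (\<lambda>j. if j \<le> N then cell (A j) t else Blank,
     LEAST j. j \<le> N \<and> pos (A j) t = At)) [0..<ntapes M])"

lemma decode_cong: "(\<And>j. j \<le> N \<Longrightarrow> A j = A' j) \<Longrightarrow> decode N A = decode N A'"
  unfolding decode_def by (auto cong: conj_cong if_cong)

lemma decode_letter_of:
  assumes "\<And>j. j \<le> N \<Longrightarrow> A j = letter_of cf j" "length (snd cf) = ntapes M"
    and "\<And>c h. (c, h) \<in> set (snd cf) \<Longrightarrow> h \<le> N \<and> (\<forall>j>N. c j = Blank)"
  shows "decode N A = cf"
proof -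
  have "decode N A = decode N (letter_of cf)"
    using assms(1) by (rule decode_cong)
  also have "\<dots> = (fst cf, snd cf)"
  proof -
    have "(\<lambda>j. if j \<le> N then cell (letter_of cf j) t else Blank,
        LEAST j. j \<le> N \<and> pos (letter_of cf j) t = At) = snd cf ! t" if t: "t < ntapes M" for t
    proof -
      obtain c h where ch: "snd cf ! t = (c, h)"
        by fastforce
      with assms(2) t have "(c, h) \<in> set (snd cf)"
        by (metis nth_mem)
      note bounds = assms(3)[OF this]
      have "(LEAST j. j \<le> N \<and> j = h) = h"
        using bounds by (intro Least_equality) auto
      moreover have "(\<lambda>j. if j \<le> N then c j else Blank) = c"
        using bounds by auto
      moreover have "cell (letter_of cf j) t = c j" "pos (letter_of cf j) t = place j h" for j
        using t ch assms(2) by (simp_all add: letter_of_def)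
      ultimately show ?thesis
        using ch by (simp cong: if_cong)
    qed
    then have "snd (decode N (letter_of cf)) = snd cf"
      unfolding decode_def snd_conv by (intro nth_equalityI) (simp_all add: assms(2) cong: if_cong)
    then show ?thesis
      by (simp add: decode_def letter_of_def)
  qed
  finally show ?thesis by simp
qed

lemma valid_heads:
  assumes "valid N A" "t < ntapes M"
  obtains h where "h < N" "\<And>j. j \<le> N \<Longrightarrow> pos (A j) t = place j h"
    "(LEAST j. j \<le> N \<and> pos (A j) t = At) = h"
proof -
  obtain h where h: "h < N" "\<And>j. j \<le> N \<Longrightarrow> pos (A j) t = place j h"
    using place_sequence[of "\<lambda>j. pos (A j) t" N] assms
    unfolding valid_def leftmost_def rightmost_def adjacent_def by blast
  have "(\<lambda>j. j \<le> N \<and> pos (A j) t = At) = (\<lambda>j. j = h)"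
    using h by (auto simp: fun_eq_iff)
  moreover have "(LEAST j. j = h) = h"
    by (rule Least_equality) auto
  ultimately have "(LEAST j. j \<le> N \<and> pos (A j) t = At) = h"
    by metis
  with h that show thesis by blast
qed

lemma valid_global:
  assumes "valid N A" "j \<le> N"
  shows "fst (A j) = fst (A 0)" "fst (snd (A j)) = fst (snd (A 0))"
  using assms(2)
  by (induction j) (use assms(1) in \<open>auto simp: valid_def adjacent_def Suc_le_eq\<close>)

text \<open>By adjacency all letters of a row agree on the state and the symbols read, so every
  column evaluates the same transition. Cell contents then follow locally from
  \<open>updated\<close>. For each head, \<open>moved\<close> shows one column of the new row where
  it stands, and validity of that row makes this column the only one.\<close>

lemma decode_step:
  assumes valid: "valid N A" "valid N A'" and linked: "linked N A A'"
    and letters: "\<And>j. j \<le> N \<Longrightarrow> A j \<in> Letters"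
  shows "decode N A' = step M (decode N A)"
proof -
  let ?q = "fst (A 0)" and ?r = "fst (snd (A 0))"
  let ?e = "eff ?q ?r"
  have len_r: "length ?r = ntapes M"
    using letters[of 0] by (auto simp: Letters_def)
  have len_acts: "length (snd ?e) = ntapes M"
  proof (cases "?q \<in> {accept M, reject M}")
    case True
    then show ?thesis using len_r by (simp add: eff_def stay_def)
  next
    case False
    have "?q \<in> states M" "set ?r \<subseteq> alphabet M"
      using letters[of 0] by (auto simp: Letters_def)
    with len_r have "length (snd (delta M ?q ?r)) = ntapes M"
      using delta_wf by blast
    with False show ?thesis by (simp add: eff_def)
  qed
  have reads: "reads (snd (decode N A)) = ?r"
  proof (rule nth_equalityI)
    fix t assume "t < length (reads (snd (decode N A)))"
    then have t: "t < ntapes M"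
      by (simp add: decode_def)
    obtain h where h: "h < N" "\<And>j. j \<le> N \<Longrightarrow> pos (A j) t = place j h"
      "(LEAST j. j \<le> N \<and> pos (A j) t = At) = h"
      using valid_heads[OF valid(1) t] by blast
    have "cell (A h) t = fst (snd (A h)) ! t"
    proof -
      have "pos (A h) t = At"
        using h(1) h(2)[of h] by simp
      then show ?thesis
        using letters[of h] h(1) t by (auto simp: Letters_def)
    qed
    then show "reads (snd (decode N A)) ! t = ?r ! t"
      using t h valid_global(2)[OF valid(1), of h] by (simp add: decode_def)
  qed (simp add: decode_def len_r)
  have step: "step M (decode N A) = (fst ?e, map2 act (snd ?e) (snd (decode N A)))"
    unfolding step_eff reads by (simp add: decode_def)
  have upd: "updated (A j) (A' j)" if "j \<le> N" for j
    using linked that by (auto simp: linked_def)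
  have "snd (decode N A') ! t = map2 act (snd ?e) (snd (decode N A)) ! t" if t: "t < ntapes M" for t
  proof -
    obtain h where h: "h < N" "\<And>j. j \<le> N \<Longrightarrow> pos (A j) t = place j h"
      "(LEAST j. j \<le> N \<and> pos (A j) t = At) = h"
      using valid_heads[OF valid(1) t] by blast
    obtain h' where h': "h' < N" "\<And>j. j \<le> N \<Longrightarrow> pos (A' j) t = place j h'"
      "(LEAST j. j \<le> N \<and> pos (A' j) t = At) = h'"
      using valid_heads[OF valid(2) t] by blast
    obtain b d where bd: "snd ?e ! t = (b, d)"
      by fastforce
    have e: "eff (fst (A j)) (fst (snd (A j))) = ?e" if "j \<le> N" for j
      using valid_global[OF valid(1) that] by simp
    have cells: "cell (A' j) t = (if j = h then b else cell (A j) t)" if "j \<le> N" for j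
      using upd[OF that] t e[OF that] e[of h] h(1) h(2)[OF that] bd by (auto simp: updated_def)
    have move: "pos l' t = At" if "moved d (A h) l'" for l'
      using that t e[of h] h(1) h(2)[of h] bd by (simp add: moved_def)
    have "h' = (case d of Left \<Rightarrow> h - 1 | Stay \<Rightarrow> h | Right \<Rightarrow> Suc h)"
    proof (cases d)
      case Left
      show ?thesis
      proof (cases h)
        case 0
        then have "pos (A' 0) t = At"
          using move[of "A' 0"] linked Left by (simp add: linked_def)
        then show ?thesis using h'(2)[of 0] 0 Left by simp
      next
        case (Suc i)
        then have "pos (A' i) t = At"
          using move[of "A' i"] linked Left h(1) by (simp add: linked_def)
        then show ?thesis using h'(2)[of i] h(1) Suc Left by simp
      qed
    next
      case Stay
      then have "pos (A' h) t = At"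
        using move[of "A' h"] linked h(1) by (simp add: linked_def)
      then show ?thesis using h'(2)[of h] h(1) Stay by simp
    next
      case Right
      then have "pos (A' (Suc h)) t = At"
        using move[of "A' (Suc h)"] linked h(1) by (simp add: linked_def)
      then show ?thesis using h'(2)[of "Suc h"] h(1) Right by simp
    qed
    then show ?thesis
      using t h h' bd cells len_acts by (auto simp: decode_def fun_eq_iff)
  qed
  then have "snd (decode N A') = map2 act (snd ?e) (snd (decode N A))"
    by (intro nth_equalityI) (simp_all add: decode_def len_acts)
  moreover have "fst (decode N A') = fst ?e"
    using upd[of 0] by (simp add: decode_def updated_def)
  ultimately show ?thesis
    by (simp add: step prod_eq_iff)
qed

definition cls :: "(nat \<Rightarrow> nat) \<Rightarrow> nat \<Rightarrow> letter" where
  "cls c j = Ls ! c j"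

definition fate :: "nat \<Rightarrow> nat \<Rightarrow> (nat \<Rightarrow> nat) \<Rightarrow> bool" where
  "fate N q c \<longleftrightarrow> (\<exists>n. fst ((step M ^^ n) (decode N (cls c))) = q)"

lemma reach_step:
  assumes "q \<in> {accept M, reject M}"
  shows "(\<exists>n. fst ((step M ^^ n) cf) = q) \<longleftrightarrow> (\<exists>n. fst ((step M ^^ n) (step M cf)) = q)"
proof
  assume "\<exists>n. fst ((step M ^^ n) cf) = q"
  then obtain n where n: "fst ((step M ^^ n) cf) = q" ..
  show "\<exists>n. fst ((step M ^^ n) (step M cf)) = q"
  proof (cases n)
    case 0
    with n assms have "halted M cf"
      by (simp add: halted_def)
    with n 0 show ?thesis
      by (intro exI[of _ 0]) (simp add: step_def)
  next
    case (Suc m)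
    with n show ?thesis
      by (intro exI[of _ m]) (simp add: funpow_swap1)
  qed
next
  assume "\<exists>n. fst ((step M ^^ n) (step M cf)) = q"
  then obtain n where "fst ((step M ^^ Suc n) cf) = q"
    by (auto simp: funpow_swap1)
  then show "\<exists>n. fst ((step M ^^ n) cf) = q" ..
qed

lemma present_mk:
  "tiling.present j (mk (dk, dj) (dk', dj') R) c c' \<longleftrightarrow>
    (let g = (if dk = 0 then c else c') (j + dj); h = (if dk' = 0 then c else c') (j + dj')
     in g < G \<and> h < G \<and> \<not> R (Ls ! g) (Ls ! h))"
proof -
  have "tiling.present j (mk (dk, dj) (dk', dj') R) c c' \<longleftrightarrow>
    (\<exists>g<G. \<exists>h<G. \<not> R (Ls ! g) (Ls ! h) \<and>
      (if dk = 0 then c else c') (j + dj) = g \<and> (if dk' = 0 then c else c') (j + dj') = h)"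
    unfolding tiling.present_def Bex_def in_mk by (force split del: if_split)
  then show ?thesis
    unfolding Let_def by blast
qed

lemma present_append:
  "tiling.present j (Q @ Q') c c' \<longleftrightarrow> tiling.present j Q c c' \<or> tiling.present j Q' c c'"
  by (auto simp: tiling.present_def)

lemma allowed_iff:
  assumes "\<And>j. j \<le> N \<Longrightarrow> c j < G" "\<And>j. j \<le> N \<Longrightarrow> c' j < G"
  shows "tiling.allowed N P0 P PN c c' \<longleftrightarrow>
    valid N (cls c) \<and> valid N (cls c') \<and> linked N (cls c) (cls c')"
proof -
  have 1: "\<not> tiling.present 0 P0 c c' \<longleftrightarrow> leftmost (cls c 0) (cls c 0) \<and> leftmost (cls c' 0) (cls c' 0) \<and>
      moved Left (cls c 0) (cls c' 0)"
    using assms by (auto simp: P0_def present_append present_mk Let_def cls_def)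
  have 2: "\<not> tiling.present j P c c' \<longleftrightarrow>
      adjacent (cls c j) (cls c (Suc j)) \<and> adjacent (cls c' j) (cls c' (Suc j)) \<and>
      updated (cls c j) (cls c' j) \<and> moved Stay (cls c j) (cls c' j) \<and>
      moved Right (cls c j) (cls c' (Suc j)) \<and> moved Left (cls c (Suc j)) (cls c' j)" if "j < N" for j
    using assms[of j] assms[of "Suc j"] that by (auto simp: P_def present_append present_mk Let_def cls_def)
  have 3: "\<not> tiling.present N PN c c' \<longleftrightarrow> rightmost (cls c N) (cls c N) \<and>
      rightmost (cls c' N) (cls c' N) \<and> updated (cls c N) (cls c' N)"
    using assms by (auto simp: PN_def present_append present_mk Let_def cls_def)
  show ?thesis
    unfolding tiling.allowed_def valid_def linked_def 1 3 using 2 by (auto simp: le_less)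
qed

lemma allowed_first:
  assumes "\<And>j. j \<le> N \<Longrightarrow> c j < G" "valid N (cls c)"
  shows "tiling.allowed N P0 P PN (\<lambda>_. G) c"
proof -
  have "\<not> tiling.present 0 P0 (\<lambda>_. G) c"
    using assms by (simp add: P0_def present_append present_mk Let_def cls_def valid_def)
  moreover have "\<not> tiling.present j P (\<lambda>_. G) c" if "j < N" for j
    using assms that by (simp add: P_def present_append present_mk Let_def cls_def valid_def)
  moreover have "\<not> tiling.present N PN (\<lambda>_. G) c"
    using assms by (simp add: PN_def present_append present_mk Let_def cls_def valid_def)
  ultimately show ?thesis
    by (simp add: tiling.allowed_def)
qed

lemma tiling_fate_machine:
  assumes "N \<ge> 1" "q \<in> {accept M, reject M}"
  shows "tiling_fate G N P0 P PN (fate N q)"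
proof
  show "N \<ge> 1" by fact
  show "dk \<le> 1 \<and> dj = 0" if "pat \<in> set P0" "(dk, dj, g) \<in> set pat" for pat dk dj g
    using that by (auto simp: P0_def in_mk)
  show "dk \<le> 1 \<and> dj \<le> 1" if "pat \<in> set P" "(dk, dj, g) \<in> set pat" for pat dk dj g
    using that by (auto simp: P_def in_mk)
  show "dk \<le> 1 \<and> dj = 0" if "pat \<in> set PN" "(dk, dj, g) \<in> set pat" for pat dk dj g
    using that by (auto simp: PN_def in_mk)
  show "[(dk, 0, g), (dk, 0, g')] \<in> set P \<inter> set PN"
    if "g < G" "g' < G" "g \<noteq> g'" "dk \<le> 1" for g g' dk
  proof -
    have "Ls ! g \<noteq> Ls ! g'"
      using that Ls(2) by (simp add: G_def nth_eq_iff_index_eq)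
    moreover have "dk = 0 \<or> dk = 1"
      using that by auto
    ultimately show ?thesis
      using that by (auto simp: P_def PN_def in_mk)
  qed
  show "fate N q c = fate N q c'" if "\<And>j. j \<le> N \<Longrightarrow> c j = c' j" for c c'
  proof -
    have "decode N (cls c) = decode N (cls c')"
      by (rule decode_cong) (simp add: cls_def that)
    then show ?thesis by (simp add: fate_def)
  qed
  show "fate N q c = fate N q c'"
    if less: "\<And>j. j \<le> N \<Longrightarrow> c j < G \<and> c' j < G" and allowed: "tiling.allowed N P0 P PN c c'" for c c'
  proof -
    have "valid N (cls c)" "valid N (cls c')" "linked N (cls c) (cls c')"
      using allowed_iff[of N c c'] less allowed by auto
    then have "decode N (cls c') = step M (decode N (cls c))"
      by (rule decode_step) (use less Ls_nth in \<open>simp add: cls_def\<close>)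
    then show ?thesis
      unfolding fate_def using reach_step[OF assms(2)] by simp
  qed
qed

section \<open>Rows of an actual computation\<close>

definition good :: "nat config \<Rightarrow> bool" where
  "good cf \<longleftrightarrow> fst cf \<in> states M \<and> length (snd cf) = ntapes M \<and>
     (\<forall>(c, h) \<in> set (snd cf). range c \<subseteq> alphabet M)"

lemma good_reads: "good cf \<Longrightarrow> length (reads (snd cf)) = ntapes M \<and> set (reads (snd cf)) \<subseteq> alphabet M"
  by (fastforce simp: good_def)

lemma good_letter: "good cf \<Longrightarrow> letter_of cf j \<in> Letters"
  using good_reads[of cf]
  by (force simp: good_def letter_of_def Letters_def split: prod.splits)

lemma eff_wf:
  assumes "q \<in> states M" "length r = ntapes M" "set r \<subseteq> alphabet M"
  shows "fst (eff q r) \<in> states M \<and> length (snd (eff q r)) = ntapes M \<and>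
    fst ` set (snd (eff q r)) \<subseteq> alphabet M"
  using delta_wf[OF assms] assms by (auto simp: eff_def stay_def)

lemma good_step:
  assumes "good cf"
  shows "good (step M cf)"
proof -
  let ?e = "eff (fst cf) (reads (snd cf))"
  have e: "fst ?e \<in> states M" "length (snd ?e) = ntapes M" "fst ` set (snd ?e) \<subseteq> alphabet M"
    using eff_wf[of "fst cf" "reads (snd cf)"] good_reads[OF assms] assms by (auto simp: good_def)
  have "range c \<subseteq> alphabet M" if "(c, h) \<in> set (map2 act (snd ?e) (snd cf))" for c h
  proof -
    from that obtain p tp where "(p, tp) \<in> set (zip (snd ?e) (snd cf))" "(c, h) = act p tp"
      by auto
    moreover obtain a d c' h' where "p = (a, d)" "tp = (c', h')"
      by fastforce
    ultimately have "(a, d) \<in> set (snd ?e)" "(c', h') \<in> set (snd cf)" "(c, h) = act (a, d) (c', h')"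
      by (auto dest: set_zip_leftD set_zip_rightD)
    then have "a \<in> alphabet M" "range c' \<subseteq> alphabet M" "c = c'(h' := a)"
      using e(3) assms by (force simp: good_def)+
    then show ?thesis by auto
  qed
  then have "\<forall>(c, h) \<in> set (snd (step M cf)). range c \<subseteq> alphabet M"
    unfolding step_eff by (auto simp del: set_map)
  moreover have "fst (step M cf) \<in> states M" "length (snd (step M cf)) = ntapes M"
    using e assms by (simp_all add: good_def step_eff)
  ultimately show ?thesis
    by (simp add: good_def)
qed

lemma good_initial: "good (initial M x)"
proof -
  have "range (word_tape y) \<subseteq> alphabet M" for y
  proof -
    have "word_tape y i \<in> {Left_End, Blank, Bit False, Bit True}" for i
      by (auto simp: word_tape_def)
    moreover have "{Left_End, Blank, Bit False, Bit True} \<subseteq> alphabet M"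
      using wf by (auto simp: wf_tm_def)
    ultimately show ?thesis by blast
  qed
  then show ?thesis
    using wf by (auto simp: good_def initial_def wf_tm_def)
qed

lemma good_run: "good (run M x n)"
  by (induction n) (simp_all add: run_def good_initial good_step)

lemma letter_of_step:
  assumes "good cf"
  shows "updated (letter_of cf j) (letter_of (step M cf) j)"
    "t < ntapes M \<Longrightarrow> pos (letter_of cf j) t = At \<Longrightarrow>
      pos (letter_of (step M cf) j') t =
      place j' (case snd (snd (eff (fst cf) (reads (snd cf))) ! t) of Left \<Rightarrow> j - 1 | Stay \<Rightarrow> j | Right \<Rightarrow> Suc j)"
proof -
  let ?e = "eff (fst cf) (reads (snd cf))"
  have len: "length (snd ?e) = ntapes M" "length (snd cf) = ntapes M"
    using eff_wf[of "fst cf" "reads (snd cf)"] good_reads[OF assms] assms by (auto simp: good_def)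
  have act: "snd (step M cf) ! t = act (snd ?e ! t) (snd cf ! t)" if "t < ntapes M" for t
    using that len by (simp add: step_eff)
  have lens: "length (snd (step M cf)) = ntapes M"
    using len by (simp add: step_eff)
  have fst_act: "fst (act p tp) = (fst tp)(snd tp := fst p)" for p tp
    by (cases p; cases tp) simp
  show "updated (letter_of cf j) (letter_of (step M cf) j)"
    using act len lens
    by (auto simp: updated_def letter_of_def split_beta fst_act) (simp add: step_eff)
  show "pos (letter_of (step M cf) j') t =
      place j' (case snd (snd ?e ! t) of Left \<Rightarrow> j - 1 | Stay \<Rightarrow> j | Right \<Rightarrow> Suc j)"
    if "t < ntapes M" "pos (letter_of cf j) t = At"
  proof -
    obtain a d c h where "snd ?e ! t = (a, d)" "snd cf ! t = (c, h)"
      by fastforce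
    with that act[OF that(1)] len lens show ?thesis
      by (cases d) (simp_all add: letter_of_def)
  qed
qed

lemma valid_letter_of:
  assumes "good cf" "\<And>c h. (c, h) \<in> set (snd cf) \<Longrightarrow> h < N"
  shows "valid N (letter_of cf)"
proof -
  have "pos (letter_of cf 0) t \<noteq> After \<and> pos (letter_of cf N) t = After \<and>
      (\<forall>j. (pos (letter_of cf j) t, pos (letter_of cf (Suc j)) t) \<in>
        {(Before, Before), (Before, At), (At, After), (After, After)})" if "t < ntapes M" for t
  proof -
    obtain c h where "snd cf ! t = (c, h)"
      by fastforce
    moreover from this that assms have "h < N"
      by (metis good_def nth_mem)
    ultimately show ?thesis
      using that assms(1) by (auto simp: letter_of_def good_def place_def)
  qed
  moreover have "fst (letter_of cf j) = fst (letter_of cf i)"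
    "fst (snd (letter_of cf j)) = fst (snd (letter_of cf i))" for i j
    by (simp_all add: letter_of_def)
  ultimately show ?thesis
    unfolding valid_def leftmost_def rightmost_def adjacent_def by blast
qed

lemma linked_letter_of:
  assumes "good cf"
  shows "linked N (letter_of cf) (letter_of (step M cf))"
proof -
  have "fst (letter_of cf j) = fst cf" "fst (snd (letter_of cf j)) = reads (snd cf)" for j
    by (simp_all add: letter_of_def)
  then show ?thesis
    unfolding linked_def moved_def using letter_of_step[OF assms] by simp
qed

text \<open>The whole initial letter of a column is recoverable from its input symbol:
  \<open>Left_End\<close> occurs in cell 0 only, so the symbol tells whether the column carries the
  heads and whether the other tapes show \<open>Left_End\<close> or \<open>Blank\<close>. Initially
  every head reads \<open>Left_End\<close>.\<close>

definition ini :: "symbol \<Rightarrow> nat" where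
  "ini s = (let p = if s = Left_End then At else After in
     idx (start M, replicate (ntapes M) Left_End,
       (s, p) # replicate (ntapes M - 1) (if s = Left_End then Left_End else Blank, p)))"

lemma G_pos: "0 < G"
  using idx[OF good_letter[OF good_initial], of undefined 0] by auto

lemma idx_less: "idx l < G"
  using idx G_pos by (auto simp: idx_def)

lemma ini_less: "ini s < G"
  by (simp add: ini_def Let_def idx_less)

lemma ini_eq: "ini (word_tape x j) = idx (letter_of (initial M x) j)"
proof -
  have "ntapes M \<ge> 1"
    using wf by (simp add: wf_tm_def)
  then have "replicate (ntapes M) Left_End = Left_End # replicate (ntapes M - 1) Left_End"
    by (cases "ntapes M") simp_all
  moreover have "word_tape x j = Left_End \<longleftrightarrow> j = 0"
    by (simp add: word_tape_def)
  moreover have "word_tape [] j = (if j = 0 then Left_End else Blank)"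
    by (simp add: word_tape_def)
  moreover have "word_tape y 0 = Left_End" for y
    by (simp add: word_tape_def)
  ultimately show ?thesis
    by (auto simp: ini_def initial_def letter_of_def place_def)
qed

definition targets :: "nat \<Rightarrow> nat list" where
  "targets q = filter (\<lambda>g. fst (Ls ! g) = q) [0..<G]"

lemma decode_initial:
  assumes "length x \<le> N"
  shows "decode N (cls (\<lambda>j. ini (word_tape x j))) = initial M x"
proof (rule decode_letter_of)
  show "cls (\<lambda>j. ini (word_tape x j)) j = letter_of (initial M x) j" for j
    using idx[OF good_letter[OF good_initial]] by (simp add: cls_def ini_eq)
  show "length (snd (initial M x)) = ntapes M"
    using good_initial[of x] by (simp add: good_def)
  show "h \<le> N \<and> (\<forall>j>N. c j = Blank)" if "(c, h) \<in> set (snd (initial M x))" for c h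
    using that assms by (auto simp: initial_def word_tape_def)
qed

abbreviation machine_schema :: "nat \<Rightarrow> schema" where
  "machine_schema q \<equiv> tiling.run_schema G P0 P PN ini (targets q)"

lemma machine_schema_sound:
  assumes "q \<in> {accept M, reject M}" "N \<ge> 1" "length x \<le> N" "subinterval_relation sub"
    and "e 0 = 0" "e 5 = N" "e 6 = Suc N" "e 8 = 0" "b < length w"
    and "holds sub (trace_model w) (a, b) (inst x (machine_schema q) e)"
  shows "\<exists>n. fst (run M x n) = q"
proof -
  have "set (targets q) \<subseteq> {..<G}"
    by (auto simp: targets_def)
  then obtain c where c: "\<forall>j\<le>N. c j \<in> set (targets q)" "fate N q (\<lambda>j. ini (word_tape x j)) = fate N q c"
    using tiling_fate.run_schema_sound[OF tiling_fate_machine[OF assms(2,1)] assms(4-10) ini_less]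
    by blast
  have "fst (decode N (cls c)) = q"
    using c(1) by (auto simp: decode_def cls_def targets_def)
  \<comment> \<open>A row of target letters decodes to a configuration already in state
    \<open>q\<close>, so zero steps suffice.\<close>
  then have "fate N q c"
    unfolding fate_def by (intro exI[of _ 0]) simp
  with c(2) show ?thesis
    unfolding fate_def decode_initial[OF assms(3)] run_def by simp
qed

lemma run_mono_halted:
  assumes "fst (run M x n) \<in> {accept M, reject M}" "n \<le> m"
  shows "run M x m = run M x n"
proof -
  have "run M x (n + i) = run M x n" for i
    by (induction i) (use assms(1) in \<open>simp_all add: run_def step_def halted_def\<close>)
  with assms(2) show ?thesis
    by (metis le_add_diff_inverse)
qed

text \<open>The shape of \<open>f\<close> is recorded for model checking: a point is empty or has
  one kind and one letter, as the labels of \<open>trace_kripke\<close> are, and the first point is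
  empty, like the label of the initial world.\<close>

lemma machine_schema_complete:
  assumes "q \<in> {accept M, reject M}" "N \<ge> 1" "subinterval_relation sub"
    and "e 0 = 0" "e 5 = N" "e 6 = Suc N" "e 8 = 0"
    and space: "\<And>n c h. (c, h) \<in> set (snd (run M x n)) \<Longrightarrow> h < N"
    and reach: "fst (run M x n) = q"
  shows "\<exists>l f. l > 0 \<and> f 0 = {} \<and>
    (\<forall>z<l. f z = {} \<or> (\<exists>k<3. \<exists>i<Suc N * G. f z = {k, 2 ^ (i + 2)})) \<and>
    holds sub (trace_model (map f [0..<l])) (0, l - 1) (inst x (machine_schema q) e)"
proof -
  define c where "c t j = idx (letter_of (run M x t) j)" for t j
  have c_less: "c t j < G" for t j
    by (simp add: c_def idx_less)
  have cls: "cls (c t) = letter_of (run M x t)" for t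
    using idx[OF good_letter[OF good_run]] by (auto simp: cls_def c_def)
  have valid: "valid N (cls (c t))" for t
    unfolding cls using valid_letter_of[OF good_run] space by blast
  \<comment> \<open>\<open>3 * n\<close> is a multiple of 3 beyond the halting time
    \<open>n\<close>; the configuration no longer changes, and the last block gets kind 0.\<close>
  interpret rows: tiling_rows G N P0 P PN c "3 * n"
  proof
    show "dk \<le> 1 \<and> g < G"
      if "pat \<in> set P0 \<union> set P \<union> set PN" "(dk, dj, g) \<in> set pat" for pat dk dj g
      using that by (auto simp: P0_def P_def PN_def in_mk)
    show "tiling.allowed N P0 P PN (\<lambda>_. G) (c 0)"
      by (rule allowed_first) (rule c_less, rule valid)
    show "tiling.allowed N P0 P PN (c t) (c (Suc t))" for t
    proof -
      have "linked N (cls (c t)) (cls (c (Suc t)))"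
        using linked_letter_of[OF good_run, of N x t] by (simp add: cls run_def)
      then show ?thesis
        using allowed_iff[of N "c t" "c (Suc t)"] c_less valid by simp
    qed
  qed (use assms(2) c_less in auto)
  have "run M x (3 * n) = run M x n"
    using run_mono_halted[of x n "3 * n"] reach assms(1) by simp
  then have "c (3 * n) j \<in> set (targets q)" for j
    using c_less[of "3 * n" j] cls[of "3 * n"] reach
    by (auto simp: targets_def cls_def fun_eq_iff letter_of_def)
  then have "holds sub (trace_model (map rows.point [0..<rows.size])) (0, rows.size - 1)
      (inst x (machine_schema q) e)"
    using assms(3-7) by (intro rows.run_schema_complete) (auto simp: c_def ini_eq run_def)
  moreover have "rows.size > 0" "rows.point 0 = {}"
    by (simp_all add: rows.size_def rows.point_def)
  moreover have "rows.point z = {} \<or> (\<exists>k<3. \<exists>i<Suc N * G. rows.point z = {k, 2 ^ (i + 2)})" for z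
  proof -
    have "rows.off z * G + c (rows.blk z) (rows.off z) < Suc (rows.off z) * G"
      using c_less by simp
    also have "\<dots> \<le> Suc N * G"
      using rows.off_le by (intro mult_le_mono1) simp
    finally have i: "rows.off z * G + c (rows.blk z) (rows.off z) < Suc N * G" .
    have k: "rows.blk z mod 3 < 3"
      by simp
    show ?thesis
    proof (cases "3 \<le> z \<and> z + 3 < rows.size")
      case True
      then have "rows.point z =
          {rows.blk z mod 3, 2 ^ (rows.off z * G + c (rows.blk z) (rows.off z) + 2)}"
        unfolding rows.point_def by (rule if_P)
      with i k show ?thesis by blast
    next
      case False
      then show ?thesis
        unfolding rows.point_def by (rule disjI1[OF if_not_P])
    qed
  qed
  ultimately show ?thesis
    by (intro exI[of _ rows.size] exI[of _ rows.point] conjI allI impI)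
qed

end


section \<open>Traces, Kripke structures and their codes\<close>

lemma linear_order_enumeration:
  assumes "finite_linear_order S r"
  shows "\<exists>f. bij_betw f {0..<card S} S \<and> (\<forall>i<card S. \<forall>j<card S. (f i, f j) \<in> r \<longleftrightarrow> i < j)"
proof -
  have fin: "finite S" and tr: "trans r" and irr: "irrefl r" and tot: "total_on S r"
    using assms by (auto simp: finite_linear_order_def strict_linear_order_on_def)
  define rank where "rank x = card {y \<in> S. (y, x) \<in> r}" for x
  have mono: "rank x < rank y" if "x \<in> S" "(x, y) \<in> r" for x y
    unfolding rank_def
  proof (rule psubset_card_mono)
    show "{z \<in> S. (z, x) \<in> r} \<subset> {z \<in> S. (z, y) \<in> r}"
      using that tr irr by (auto simp: irrefl_def dest: transD)
  qed (use fin in simp)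
  have iff: "(x, y) \<in> r \<longleftrightarrow> rank x < rank y" if "x \<in> S" "y \<in> S" for x y
    using mono[of x y] mono[of y x] tot that unfolding total_on_def by (metis less_irrefl less_asym)
  have inj: "inj_on rank S"
    using iff tot by (fastforce simp: inj_on_def total_on_def)
  have "rank x < card S" if "x \<in> S" for x
    unfolding rank_def using that irr fin by (intro psubset_card_mono) (auto simp: irrefl_def)
  then have "rank ` S \<subseteq> {0..<card S}"
    by auto
  then have "rank ` S = {0..<card S}"
    using card_image[OF inj] by (intro card_subset_eq) auto
  then have bij: "bij_betw rank S {0..<card S}"
    using inj by (simp add: bij_betw_def)
  let ?f = "inv_into S rank"
  have f: "?f i \<in> S" "rank (?f i) = i" if "i < card S" for i
    using bij that by (auto simp: bij_betw_def inv_into_into f_inv_into_f)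
  have "bij_betw ?f {0..<card S} S"
    using bij by (rule bij_betw_inv_into)
  moreover have "(?f i, ?f j) \<in> r \<longleftrightarrow> i < j" if "i < card S" "j < card S" for i j
    using iff[OF f(1)[OF that(1)] f(1)[OF that(2)]] f(2) that by simp
  ultimately show ?thesis by blast
qed

text \<open>On the atoms of the formula, a homogeneous model is determined by its one-point
  intervals. Enumerating the points in increasing order and collecting their labels gives a word
  whose model is isomorphic.\<close>

lemma satisfiable_trace:
  assumes "satisfiable sub \<phi>" "subinterval_relation sub"
  shows "\<exists>w a b. a \<le> b \<and> b < length w \<and> holds sub (trace_model w) (a, b) \<phi>"
proof -
  obtain M I where M: "interval_model (atoms \<phi>) M" "homogeneous (atoms \<phi>) M"
    "I \<in> intervals (points M) (lt M)" "holds sub M I \<phi>"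
    using assms(1) by (auto simp: satisfiable_def)
  let ?S = "points M" and ?r = "lt M"
  define n where "n = card ?S"
  obtain f where f: "bij_betw f {0..<n} ?S" "\<And>i j. i < n \<Longrightarrow> j < n \<Longrightarrow> (f i, f j) \<in> ?r \<longleftrightarrow> i < j"
    using M(1) linear_order_enumeration unfolding interval_model_def n_def by blast
  have f_eq: "f i = f j \<longleftrightarrow> i = j" if "i < n" "j < n" for i j
    using f(1) that by (auto simp: bij_betw_def inj_on_def)
  have f_le: "(f i, f j) \<in> ?r\<^sup>= \<longleftrightarrow> i \<le> j" if "i < n" "j < n" for i j
    using f(2)[OF that] f_eq[OF that] by auto
  have img: "?S = f ` {0..<n}"
    using f(1) by (simp add: bij_betw_def)
  have ball_S: "(\<forall>z\<in>?S. Q z) \<longleftrightarrow> (\<forall>i<n. Q (f i))" for Q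
    unfolding img by auto
  have intv: "(\<exists>J\<in>intervals ?S ?r. Q J) \<longleftrightarrow> (\<exists>i j. i \<le> j \<and> j < n \<and> Q (f i, f j))" for Q
  proof
    assume "\<exists>J\<in>intervals ?S ?r. Q J"
    then obtain y z where "y \<in> ?S" "z \<in> ?S" "(y, z) \<in> ?r\<^sup>=" "Q (y, z)"
      unfolding intervals_def by blast
    moreover obtain i j where ij: "i < n" "j < n" "y = f i" "z = f j"
      using calculation(1,2) unfolding img by auto
    ultimately have "i \<le> j"
      using f_le[OF ij(1,2)] by blast
    with ij \<open>Q (y, z)\<close> show "\<exists>i j. i \<le> j \<and> j < n \<and> Q (f i, f j)"
      by blast
  next
    assume "\<exists>i j. i \<le> j \<and> j < n \<and> Q (f i, f j)"
    then obtain i j where ij: "i \<le> j" "j < n" "Q (f i, f j)" by blast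
    then have "(f i, f j) \<in> intervals ?S ?r"
      using f(1) f_le[of i j] by (auto simp: intervals_def bij_betw_def)
    with ij(3) show "\<exists>J\<in>intervals ?S ?r. Q J" by blast
  qed
  have sub: "sub ?r (f i', f j') (f i, f j) \<longleftrightarrow> sub less_than (i', j') (i, j)"
    if "i' < n" "j' < n" "i < n" "j < n" for i' j' i j
    using assms(2) f(2) f_le f_eq that
    by (auto simp: subinterval_relation_def proper_sub_def strict_sub_def)
  define w where "w = map (\<lambda>i. {p. (f i, f i) \<in> val M p}) [0..<n]"
  have len: "length w = n"
    by (simp add: w_def)
  have "holds sub M (f i, f j) \<psi> \<longleftrightarrow> holds sub (trace_model w) (i, j) \<psi>"
    if "atoms \<psi> \<subseteq> atoms \<phi>" "i \<le> j" "j < n" for \<psi> i j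
    using that
  proof (induction \<psi> arbitrary: i j)
    case (Atom p)
    have "(f i, f j) \<in> intervals ?S ?r"
      using Atom f(1) f_le[of i j] by (auto simp: intervals_def bij_betw_def)
    then have "(f i, f j) \<in> val M p \<longleftrightarrow>
        (\<forall>z\<in>?S. (f i, z) \<in> ?r\<^sup>= \<and> (z, f j) \<in> ?r\<^sup>= \<longrightarrow> (z, z) \<in> val M p)"
      using M(2) Atom.prems(1) unfolding homogeneous_def by fastforce
    also have "\<dots> \<longleftrightarrow> (\<forall>k<n. i \<le> k \<and> k \<le> j \<longrightarrow> (f k, f k) \<in> val M p)"
    proof -
      have "(f i, f k) \<in> ?r\<^sup>= \<and> (f k, f j) \<in> ?r\<^sup>= \<longleftrightarrow> i \<le> k \<and> k \<le> j" if "k < n" for k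
        using f_le[of i k] f_le[of k j] Atom.prems that by simp
      then show ?thesis
        unfolding ball_S by blast
    qed
    also have "\<dots> \<longleftrightarrow> (\<forall>k\<in>{i..j}. p \<in> w ! k)"
      using Atom.prems by (auto simp: w_def)
    finally show ?case
      using Atom.prems by (simp add: trace_model_simps len)
  next
    case (Dia \<psi>)
    have "holds sub M (f i, f j) (Dia \<psi>) \<longleftrightarrow>
        (\<exists>i' j'. i' \<le> j' \<and> j' < n \<and> sub ?r (f i', f j') (f i, f j) \<and> holds sub M (f i', f j') \<psi>)"
      unfolding holds.simps intv ..
    also have "\<dots> \<longleftrightarrow> (\<exists>i' j'. i' \<le> j' \<and> j' < n \<and> sub less_than (i', j') (i, j) \<and>
        holds sub (trace_model w) (i', j') \<psi>)"
    proof -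
      have "sub ?r (f i', f j') (f i, f j) \<and> holds sub M (f i', f j') \<psi> \<longleftrightarrow>
          sub less_than (i', j') (i, j) \<and> holds sub (trace_model w) (i', j') \<psi>"
        if "i' \<le> j'" "j' < n" for i' j'
        using sub[of i' j' i j] Dia.IH[of i' j'] Dia.prems that by simp
      then show ?thesis by blast
    qed
    finally show ?case
      unfolding holds_Dia_trace len .
  qed auto
  moreover obtain a b where "a \<le> b" "b < n" "holds sub M (f a, f b) \<phi>"
    using M(3,4) intv[of "\<lambda>J. holds sub M J \<phi>"] by blast
  ultimately show ?thesis
    using len by blast
qed

lemma less_than_refl: "(a, b) \<in> less_than\<^sup>= \<longleftrightarrow> a \<le> b"
  by auto

lemma trace_satisfiable:
  assumes "a \<le> b" "b < length w" "holds sub (trace_model w) (a, b) \<phi>"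
  shows "satisfiable sub \<phi>"
proof -
  have "strict_linear_order_on {0..<length w} less_than"
    by (auto simp: strict_linear_order_on_def irrefl_def total_on_def)
  then have "interval_model (atoms \<phi>) (trace_model w)"
    by (auto simp: interval_model_def finite_linear_order_def trace_model_simps intervals_nat
        trace_model_def)
  moreover have "homogeneous (atoms \<phi>) (trace_model w)"
    by (auto simp: homogeneous_def trace_model_simps intervals_nat less_than_refl simp del: Un_iff)
  moreover have "(a, b) \<in> intervals (points (trace_model w)) (lt (trace_model w))"
    using assms by (simp add: trace_model_simps intervals_nat)
  ultimately show ?thesis
    unfolding satisfiable_def using assms(3) by blast
qed

text \<open>The base is at least 2, so a constant \<open>a\<close> is absorbed through
  \<open>a \<le> 2 ^ a\<close>. The condition \<open>d \<ge> 1\<close> later ensures that the input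
  fits into the columns.\<close>

lemma poly_le_power:
  fixes p :: "nat poly"
  shows "\<exists>d\<ge>1. \<forall>n. poly p n \<le> (n + 2) ^ d"
proof (induction p)
  case 0
  then show ?case by auto
next
  case (pCons a p)
  then obtain d where d: "d \<ge> 1" "\<And>n. poly p n \<le> (n + 2) ^ d" by blast
  have "poly (pCons a p) n \<le> (n + 2) ^ (a + d + 2)" for n
  proof -
    have "a \<le> 2 ^ a"
      by (simp add: less_imp_le)
    also have "\<dots> \<le> (n + 2) ^ a"
      by (rule power_mono) simp_all
    also have "\<dots> \<le> (n + 2) ^ (a + d + 1)"
      by (rule power_increasing) simp_all
    finally have "a \<le> (n + 2) ^ (a + d + 1)" .
    moreover have "n * poly p n \<le> (n + 2) * (n + 2) ^ d"
      using d(2) by (intro mult_le_mono) simp_all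
    moreover have "(n + 2) * (n + 2) ^ d \<le> (n + 2) ^ (a + d + 1)"
      using power_increasing[of "d + 1" "a + d + 1" "n + 2"] by simp
    moreover have "2 * (n + 2) ^ (a + d + 1) \<le> (n + 2) ^ (a + d + 2)"
      by simp
    ultimately have "a + n * poly p n \<le> (n + 2) ^ (a + d + 2)"
      by linarith
    then show ?thesis by simp
  qed
  then show ?case
    by (intro exI[of _ "a + d + 2"]) simp
qed


text \<open>World 0 is the empty point and the initial one, since the word of a run begins with
  empty points. World \<open>2 ^ m\<close> stands for the letter code \<open>m div 3\<close> in a
  block of kind \<open>m mod 3\<close>.\<close>

definition trace_kripke :: "nat \<Rightarrow> kripke" where
  "trace_kripke X = \<lparr>props = {..<3} \<union> (\<lambda>i. 2 ^ (i + 2)) ` {..<X},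
     worlds = insert 0 ((\<lambda>m. 2 ^ m) ` {..<3 * X}),
     edges = insert 0 ((\<lambda>m. 2 ^ m) ` {..<3 * X}) \<times> insert 0 ((\<lambda>m. 2 ^ m) ` {..<3 * X}),
     label = (\<lambda>s. {p. \<exists>m<3 * X. s = 2 ^ m \<and> p \<in> {m mod 3, 2 ^ (m div 3 + 2)}}),
     init = 0\<rparr>"

lemma label_power: "m < 3 * X \<Longrightarrow> label (trace_kripke X) (2 ^ m) = {m mod 3, 2 ^ (m div 3 + 2)}"
  by (auto simp: trace_kripke_def)

lemma label_0: "label (trace_kripke X) 0 = {}"
  by (auto simp: trace_kripke_def)

lemma wf_trace_kripke: "wf_kripke (trace_kripke X)"
proof -
  have "label (trace_kripke X) s \<subseteq> props (trace_kripke X)" if "s \<in> worlds (trace_kripke X)" for s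
  proof -
    have "s = 0 \<or> (\<exists>m<3 * X. s = 2 ^ m)"
      using that by (auto simp: trace_kripke_def)
    then show ?thesis
    proof
      assume "\<exists>m<3 * X. s = 2 ^ m"
      then obtain m where m: "m < 3 * X" "s = 2 ^ m" by blast
      then have "m div 3 < X" "m mod 3 < 3"
        by auto
      then have "m mod 3 \<in> props (trace_kripke X)" "2 ^ (m div 3 + 2) \<in> props (trace_kripke X)"
        unfolding trace_kripke_def kripke.simps by blast+
      with m show ?thesis
        using label_power by auto
    qed (simp add: label_0)
  qed
  then show ?thesis
    by (auto simp: wf_kripke_def trace_kripke_def)
qed

text \<open>Stated for every \<open>K\<close> that agrees with \<open>trace_kripke X\<close> as far
  as an encoding determines it: the code of a structure does not fix labels outside its
  worlds.\<close>

lemma initial_trace_map: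
  assumes "l > 0" "f 0 = {}"
    and "\<And>z. z < l \<Longrightarrow> f z = {} \<or> (\<exists>k<3. \<exists>i<X. f z = {k, 2 ^ (i + 2)})"
    and same: "edges K = edges (trace_kripke X)" "init K = init (trace_kripke X)"
      "\<And>s. s \<in> worlds (trace_kripke X) \<Longrightarrow> label K s = label (trace_kripke X) s"
  shows "initial_trace K (map f [0..<l])"
proof -
  have "\<exists>s\<in>worlds (trace_kripke X). label (trace_kripke X) s = f z \<and> (z = 0 \<longrightarrow> s = 0)"
    if z: "z < l" for z
  proof (cases "f z = {}")
    case True
    then show ?thesis
      using label_0 by (intro bexI[of _ 0]) (auto simp: trace_kripke_def)
  next
    case False
    then obtain k i where ki: "k < 3" "i < X" "f z = {k, 2 ^ (i + 2)}"
      using assms(3)[OF z] by blast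
    then have m: "3 * i + k < 3 * X" "(3 * i + k) mod 3 = k" "(3 * i + k) div 3 = i"
      by auto
    then have "label (trace_kripke X) (2 ^ (3 * i + k)) = f z"
      using label_power ki(3) by simp
    moreover have "z \<noteq> 0"
      using False assms(2) by metis
    moreover have "2 ^ (3 * i + k) \<in> worlds (trace_kripke X)"
      using m(1) by (auto simp: trace_kripke_def)
    ultimately show ?thesis by blast
  qed
  then obtain g where g: "\<And>z. z < l \<Longrightarrow> g z \<in> worlds (trace_kripke X) \<and>
      label (trace_kripke X) (g z) = f z \<and> (z = 0 \<longrightarrow> g z = 0)"
    by metis
  have "edges (trace_kripke X) = worlds (trace_kripke X) \<times> worlds (trace_kripke X)"
    by (simp add: trace_kripke_def)
  then have "successively (\<lambda>s s'. (s, s') \<in> edges K) (map g [0..<l])"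
    using g same(1) by (auto simp: successively_conv_nth)
  moreover have "hd (map g [0..<l]) = init K"
    using g[of 0] assms(1) same(2) by (simp add: hd_map trace_kripke_def)
  moreover have "map f [0..<l] = map (label K) (map g [0..<l])"
    using g same(3) by auto
  ultimately show ?thesis
    unfolding initial_trace_def using assms(1) by (intro exI[of _ "map g [0..<l]"]) simp
qed

section \<open>Printing the Kripke structure\<close>

definition cats :: "gen list \<Rightarrow> gen" where
  "cats gs = foldr Cat gs (Lit [])"

lemma emit_cats: "emit x (cats gs) e = concat (map (\<lambda>g. emit x g e) gs)"
  by (induction gs) (simp_all add: cats_def)

lemma scoped_cats: "scoped Z (cats gs) \<longleftrightarrow> (\<forall>g\<in>set gs. scoped Z g)"
  by (induction gs) (simp_all add: cats_def)

text \<open>Sets are encoded in increasing order. Counting the exponents \<open>j * G + g\<close>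
  lexicographically, by a loop over \<open>j\<close> around a fixed list of \<open>g\<close>, meets
  that order without any sorting.\<close>

definition props_code :: "nat \<Rightarrow> gen" where
  "props_code G = cats [Lit (concat (map (\<lambda>p. True # enc_nat p) [0, 1, 2])),
     For 8 6 (cats (map (\<lambda>g. Cat (Lit [True]) (power_code 8 G (g + 2))) [0..<G])), Lit [False]]"

definition worlds_code :: "nat \<Rightarrow> gen" where
  "worlds_code G = cats [Lit (True # enc_nat 0),
     For 9 7 (cats (map (\<lambda>r. Cat (Lit [True]) (power_code 9 (3 * G) r)) [0..<3 * G])), Lit [False]]"

text \<open>The loop treats the worlds with exponent \<open>j * (3 * G) + r\<close>, where
  \<open>j\<close> is register 8. The kind is \<open>r mod 3\<close> and the letter code is
  \<open>j * G + r div 3\<close>, both available without division at run time. Each world prints its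
  successors by \<open>worlds_code\<close>, which uses registers 9 and 7 because 8 and 6 are
  busy.\<close>

definition kripke_code :: "nat \<Rightarrow> gen" where
  "kripke_code G = cats [props_code G,
     Lit (True # enc_nat 0), worlds_code G, Lit [False],
     For 8 6 (cats (map (\<lambda>r. cats [Lit [True], power_code 8 (3 * G) r, worlds_code G,
       Lit (True # enc_nat (r mod 3) @ [True]), power_code 8 G (r div 3 + 2), Lit [False]]) [0..<3 * G])),
     Lit (False # enc_nat 0)]"

lemma concat_concat: "concat (concat xsss) = concat (map concat xsss)"
  by (induction xsss) simp_all

lemma upt_mult: "[0..<n * m] = concat (map (\<lambda>j. map (\<lambda>g. j * m + g) [0..<m]) [0..<n])"
proof (induction n)
  case (Suc n)
  have "[0..<n * m + m] = [0..<n * m] @ [n * m..<n * m + m]"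
    by (rule upt_add_eq_append) simp
  moreover have "map (\<lambda>g. n * m + g) [0..<m] = [n * m..<n * m + m]"
    by (simp add: map_add_upt add.commute)
  moreover have "Suc n * m = n * m + m"
    by simp
  ultimately show ?case
    using Suc by (simp del: mult_Suc)
qed simp

lemma sorted_list_of_set_eqI: "sorted_wrt (<) xs \<Longrightarrow> set xs = A \<Longrightarrow> sorted_list_of_set A = xs"
  for xs :: "nat list"
  by (metis sorted_list_of_set.idem_if_sorted_distinct strict_sorted_iff)

lemma sorted_props:
  "sorted_list_of_set (props (trace_kripke X)) = [0, 1, 2] @ map (\<lambda>i. 2 ^ (i + 2)) [0..<X]"
proof (rule sorted_list_of_set_eqI)
  have "0 < (2 :: nat) ^ i" "Suc 0 < 4 * 2 ^ i" "2 < 4 * (2 :: nat) ^ i" for i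
    using one_le_power[of "2 :: nat" i] by linarith+
  then show "sorted_wrt (<) ([0, 1, 2] @ map (\<lambda>i. 2 ^ (i + 2)) [0..<X] :: nat list)"
    by (auto simp: sorted_wrt_append sorted_wrt_map intro!: sorted_wrt_mono_rel[OF _ sorted_wrt_upt])
  show "set ([0, 1, 2] @ map (\<lambda>i. 2 ^ (i + 2)) [0..<X]) = props (trace_kripke X)"
    by (auto simp: trace_kripke_def)
qed

lemma sorted_worlds:
  "sorted_list_of_set (worlds (trace_kripke X)) = 0 # map (\<lambda>m. 2 ^ m) [0..<3 * X]"
proof (rule sorted_list_of_set_eqI)
  show "sorted_wrt (<) (0 # map (\<lambda>m. 2 ^ m) [0..<3 * X] :: nat list)"
    by (auto simp: sorted_wrt_map intro!: sorted_wrt_mono_rel[OF _ sorted_wrt_upt])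
  show "set (0 # map (\<lambda>m. 2 ^ m) [0..<3 * X]) = worlds (trace_kripke X)"
    by (auto simp: trace_kripke_def)
qed

lemma enc_world_power:
  assumes "m < 3 * X"
  shows "enc_world (trace_kripke X) (2 ^ m) = enc_nat (2 ^ m) @ enc_set (worlds (trace_kripke X)) @
    True # enc_nat (m mod 3) @ True # enc_nat (2 ^ (m div 3 + 2)) @ [False]"
proof -
  have "edges (trace_kripke X) `` {2 ^ m} = worlds (trace_kripke X)"
    using assms by (auto simp: trace_kripke_def)
  moreover have "m mod 3 < 2 ^ (m div 3 + 2)"
  proof -
    have "m mod 3 < 4" by (rule less_trans[of _ 3]) simp_all
    moreover have "(4 :: nat) \<le> 2 ^ (m div 3 + 2)"
      by (simp add: power_add)
    ultimately show ?thesis by linarith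
  qed
  then have "sorted_list_of_set {m mod 3, 2 ^ (m div 3 + 2)} = [m mod 3, 2 ^ (m div 3 + 2)]"
    by (intro sorted_list_of_set_eqI) auto
  ultimately show ?thesis
    using label_power[OF assms] by (simp add: enc_world_def enc_set_def enc_list_def del: power_Suc)
qed

lemma enc_world_0:
  "enc_world (trace_kripke X) 0 = enc_nat 0 @ enc_set (worlds (trace_kripke X)) @ [False]"
proof -
  have "edges (trace_kripke X) `` {0} = worlds (trace_kripke X)"
    by (auto simp: trace_kripke_def)
  then show ?thesis
    by (simp add: enc_world_def label_0 enc_set_def enc_list_def)
qed

lemma emit_props_code:
  assumes "e 6 = n"
  shows "emit x (props_code G) e = enc_set (props (trace_kripke (n * G)))"
  unfolding enc_set_def sorted_props upt_mult[of n G]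
  using assms by (simp add: props_code_def emit_cats emit_power_code enc_list_def map_concat concat_concat o_def)

lemma emit_worlds_code:
  assumes "e 7 = n"
  shows "emit x (worlds_code G) e = enc_set (worlds (trace_kripke (n * G)))"
proof -
  have eq: "3 * (n * G) = n * (3 * G)" by simp
  show ?thesis
    unfolding enc_set_def sorted_worlds eq upt_mult[of n "3 * G"]
    using assms by (simp add: worlds_code_def emit_cats emit_power_code enc_list_def map_concat concat_concat o_def)
qed

lemma emit_kripke_code:
  assumes "e 6 = n" "e 7 = n"
  shows "emit x (kripke_code G) e = enc_kripke (trace_kripke (n * G))"
proof -
  let ?K = "trace_kripke (n * G)"
  have eq: "3 * (n * G) = n * (3 * G)" by simp
  have "map (\<lambda>m. True # enc_world ?K (2 ^ m)) [0..<3 * (n * G)] =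
      map (\<lambda>m. True # enc_nat (2 ^ m) @ enc_set (worlds ?K) @
        True # enc_nat (m mod 3) @ True # enc_nat (2 ^ (m div 3 + 2)) @ [False]) [0..<3 * (n * G)]"
    by (rule map_cong) (auto simp: enc_world_power)
  also have "\<dots> = concat (map (\<lambda>j. map (\<lambda>r. True # enc_nat (2 ^ (j * (3 * G) + r)) @ enc_set (worlds ?K) @
        True # enc_nat (r mod 3) @ True # enc_nat (2 ^ (j * G + (r div 3 + 2))) @ [False]) [0..<3 * G]) [0..<n])"
  proof -
    have "(j * (3 * G) + r) mod 3 = r mod 3" "(j * (3 * G) + r) div 3 = j * G + r div 3" for j r
      using mod_mult_self3[of "j * G" 3 r] div_mult_self3[of 3 "j * G" r] by (simp_all add: ac_simps)
    then show ?thesis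
      unfolding eq upt_mult[of n "3 * G"] by (simp add: map_concat concat_concat o_def add.assoc del: power_Suc)
  qed
  finally show ?thesis
    using assms
    by (simp add: enc_kripke_def kripke_code_def emit_cats emit_props_code emit_worlds_code
        emit_power_code sorted_worlds enc_list_def[of "enc_world ?K"] enc_world_0 o_def
        concat_concat trace_kripke_def[of "n * G", THEN arg_cong[where f = init]])
qed


lemma scoped_power_code: "scoped Z (power_code v G c) \<longleftrightarrow> 10 \<in> Z \<and> v \<noteq> 10"
  by (auto simp: power_code_def)

lemma scoped_kripke_code: "scoped (- {1, 5, 6, 7}) (kripke_code G)"
  by (simp add: kripke_code_def props_code_def worlds_code_def scoped_cats scoped_power_code)

context tiling
begin

lemma scoped_run_schema: "scoped (- {1, 5, 6, 7}) (code (run_schema ini' L))"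
proof -
  have has: "scoped Z (code (has k v c))" if "10 \<in> Z" "v \<noteq> 10" for Z k v c
    using that by (simp add: has_def scoped_power_code)
  have kind: "scoped Z (code (has_kind k))" for Z k
    by (simp add: has_kind_def)
  have viol: "scoped Z (code (viol_schema v Q))" if "10 \<in> Z" "v \<noteq> 10" for Z v Q
    using that by (auto simp: viol_schema_def occurs_schema_def has kind)
  show ?thesis
    by (auto simp: run_schema_def bad_schema_def start_schema_def letter_schema_def full_schema_def
        clash_schema_def viol has kind scoped_power_code)
qed

end


section \<open>The reductions\<close>

lemma atoms_SAny_subset:
  "0 \<in> A \<Longrightarrow> (\<And>s. s \<in> set ss \<Longrightarrow> atoms (inst x s e) \<subseteq> A) \<Longrightarrow> atoms (inst x (SAny ss) e) \<subseteq> A"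
  by auto

lemma atoms_SAll_subset:
  "0 \<in> A \<Longrightarrow> (\<And>s. s \<in> set ss \<Longrightarrow> atoms (inst x s e) \<subseteq> A) \<Longrightarrow> atoms (inst x (SAll ss) e) \<subseteq> A"
  by auto

lemma atoms_SBig_subset:
  "(\<And>i. i < e u \<Longrightarrow> atoms (inst x s (e(v := i, u := e u - Suc i))) \<subseteq> A) \<Longrightarrow>
    atoms (inst x t e) \<subseteq> A \<Longrightarrow> atoms (inst x (SBig v u s t) e) \<subseteq> A"
  by (simp add: atoms_foldr_Or UN_subset_iff del: upt_Suc fun_upd_apply)

text \<open>An instance of model checking must have all atoms of the formula among its propositions.
  No column mentioned exceeds \<open>N\<close>; for column 1 in \<open>clash_schema\<close> this is
  the assumption \<open>N \<ge> 1\<close>.\<close>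

lemma (in tiling) atoms_run_schema:
  assumes "N \<ge> 1" "e 0 = 0" "e 5 = N" "e 6 = Suc N" "e 8 = 0"
    and Q: "\<And>pat dk dj g. pat \<in> set P0 \<union> set PN \<Longrightarrow> (dk, dj, g) \<in> set pat \<Longrightarrow> dj = 0 \<and> g < G"
      "\<And>pat dk dj g. pat \<in> set P \<Longrightarrow> (dk, dj, g) \<in> set pat \<Longrightarrow> dj \<le> 1 \<and> g < G"
    and ini: "\<And>s. ini s < G" and L: "set L \<subseteq> {..<G}"
  shows "atoms (inst x (run_schema ini L) e) \<subseteq> {..<3} \<union> (\<lambda>i. 2 ^ (i + 2)) ` {..<Suc N * G}"
proof -
  define A :: "nat set" where "A = {..<3} \<union> (\<lambda>i. 2 ^ (i + 2)) ` {..<Suc N * G}"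
  have idx: "j * G + g < Suc N * G" if "j \<le> N" "g < G" for j g
  proof -
    have "j * G + g < Suc j * G"
      using that by simp
    also have "\<dots> \<le> Suc N * G"
      using that by (intro mult_le_mono1) simp
    finally show ?thesis .
  qed
  have var: "2 ^ (i + (c + 2)) \<in> A" if "i + c < Suc N * G" for i c
    unfolding A_def using that by (intro UnI2 image_eqI[of _ _ "i + c"]) (simp_all add: add.assoc)
  have less3: "k \<in> A" if "k < 3" for k
    using that by (simp add: A_def)
  have zero: "0 \<in> A"
    by (simp add: less3)
  have has: "atoms (inst x (has k v c) e') \<subseteq> A" if "k < 3" "e' v * G + c < Suc N * G" for k v c e'
    using var[OF that(2)] less3[OF that(1)] unfolding has_def inst.simps atoms.simps atoms_SAnd by simp
  have kind: "atoms (inst x (has_kind k) e') \<subseteq> A" if "k < 3" for k e'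
    using less3[OF that] by (simp add: has_kind_def)
  have bot: "atoms (inst x SBot e') \<subseteq> A" for e'
    using zero by simp
  have viol: "atoms (inst x (viol_schema v Q) e') \<subseteq> A"
    if Q: "\<And>pat dk dj g. pat \<in> set Q \<Longrightarrow> (dk, dj, g) \<in> set pat \<Longrightarrow> e' v + dj \<le> N \<and> g < G" for v Q e'
    unfolding viol_schema_def
  proof (rule atoms_SAny_subset[OF zero])
    fix s assume "s \<in> set (concat (map (\<lambda>k. map (occurs_schema v k) Q) [0..<3]))"
    then obtain k pat where s: "s = occurs_schema v k pat" "pat \<in> set Q"
      by auto
    have "atoms (inst x (has ((k + dk) mod 3) v (dj * G + g)) e') \<subseteq> A"
      if "(dk, dj, g) \<in> set pat" for dk dj g
    proof (rule has)
      show "e' v * G + (dj * G + g) < Suc N * G"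
        using idx[of "e' v + dj" g] Q[OF s(2) that] by (simp add: distrib_right add.assoc)
    qed simp
    then have "atoms (inst x (SAll (map (\<lambda>(dk, dj, g). has ((k + dk) mod 3) v (dj * G + g)) pat)) e') \<subseteq> A"
      by (intro atoms_SAll_subset[OF zero]) auto
    then show "atoms (inst x s e') \<subseteq> A"
      using kind[of "(k + 2) mod 3"] by (simp add: s(1) occurs_schema_def del: atoms_SAll)
  qed
  have full: "atoms (inst x (full_schema L k) e') \<subseteq> A"
    if "set L \<subseteq> {..<G}" "k < 3" "e' 6 = Suc N" for L k e'
  proof -
    have "atoms (inst x (SNeg (SAny (map (has k 8) L))) (e'(8 := i, 6 := e' 6 - Suc i))) \<subseteq> A"
      if "i < e' 6" for i
      unfolding inst.simps atoms.simps
    proof (rule atoms_SAny_subset[OF zero])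
      fix s assume "s \<in> set (map (has k 8) L)"
      then obtain g where "s = has k 8 g" "g < G"
        using \<open>set L \<subseteq> {..<G}\<close> by auto
      moreover from this(2) have "atoms (inst x (has k 8 g) (e'(8 := i, 6 := e' 6 - Suc i))) \<subseteq> A"
        using idx[of i g] that \<open>k < 3\<close> \<open>e' 6 = Suc N\<close> by (intro has) simp_all
      ultimately show "atoms (inst x s (e'(8 := i, 6 := e' 6 - Suc i))) \<subseteq> A"
        by simp
    qed
    then show ?thesis
      unfolding full_schema_def inst.simps(3) atoms.simps(2)
      by (intro atoms_SBig_subset bot) auto
  qed
  have start: "atoms (inst x (start_schema ini) e) \<subseteq> A"
  proof -
    have "atoms (inst x (letter_schema ini) (e(0 := i, 6 := e 6 - Suc i))) \<subseteq> A" if "i < e 6" for i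
    proof -
      have "atoms (inst x (has 0 0 (ini s)) (e(0 := i, 6 := e 6 - Suc i))) \<subseteq> A" for s
        using idx[of i "ini s"] ini that assms(4) by (intro has) auto
      then show ?thesis
        by (simp add: letter_schema_def)
    qed
    then show ?thesis
      unfolding start_schema_def inst.simps(3) atoms.simps(2)
      by (intro atoms_SBig_subset bot) simp
  qed
  have clash: "atoms (inst x clash_schema e) \<subseteq> A"
    unfolding clash_schema_def
  proof (rule atoms_SAny_subset[OF zero])
    fix s
    assume "s \<in> set (concat (map (\<lambda>k. map (\<lambda>k'. SAnd (SAtom k) (SAtom k')) (filter (\<lambda>k'. k \<noteq> k') [0..<3])) [0..<3]) @
      concat (map (\<lambda>g. map (\<lambda>g'. SAnd (SVar 8 G (g + 2)) (SVar 8 G (G + g' + 2))) [0..<G]) [0..<G]))"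
    then consider k k' where "s = SAnd (SAtom k) (SAtom k')" "k < 3" "k' < 3"
      | g g' where "s = SAnd (SVar 8 G (g + 2)) (SVar 8 G (G + g' + 2))" "g < G" "g' < G"
      by auto
    then show "atoms (inst x s e) \<subseteq> A"
    proof cases
      case 1
      then show ?thesis using less3 by simp
    next
      case 2
      have "2 ^ (0 + (g + 2)) \<in> A" "2 ^ (0 + ((G + g') + 2)) \<in> A"
        using idx[of 0 g] idx[of 1 g'] 2 assms(1) by (intro var; simp)+
      then show ?thesis
        unfolding 2(1) atoms_SAnd inst.simps atoms.simps assms(5) by simp
    qed
  qed
  have bad: "atoms (inst x bad_schema e) \<subseteq> A"
    unfolding bad_schema_def
  proof (rule atoms_SAny_subset[OF zero])
    fix s
    assume "s \<in> set [viol_schema 8 P0, SBig 8 5 (viol_schema 8 P) SBot, viol_schema 5 PN,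
      SAll (map has_kind [0..<3] @ map (\<lambda>k. SNeg (full_schema [0..<G] k)) [0..<3]), clash_schema]"
    then consider "s = viol_schema 8 P0" | "s = SBig 8 5 (viol_schema 8 P) SBot" | "s = viol_schema 5 PN"
      | "s = SAll (map has_kind [0..<3] @ map (\<lambda>k. SNeg (full_schema [0..<G] k)) [0..<3])"
      | "s = clash_schema"
      by auto
    then show "atoms (inst x s e) \<subseteq> A"
    proof cases
      case 1
      show ?thesis
        unfolding 1 by (rule viol) (use Q(1) assms(5) in fastforce)
    next
      case 2
      have "atoms (inst x (viol_schema 8 P) (e(8 := i, 5 := e 5 - Suc i))) \<subseteq> A" if "i < e 5" for i
        by (rule viol) (use Q(2) that assms(3) in fastforce)
      then show ?thesis
        unfolding 2 by (intro atoms_SBig_subset bot)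
    next
      case 3
      show ?thesis
        unfolding 3 by (rule viol) (use Q(1) assms(3) in fastforce)
    next
      case 4
      show ?thesis
        unfolding 4
      proof (rule atoms_SAll_subset[OF zero])
        fix s
        assume "s \<in> set (map has_kind [0..<3] @ map (\<lambda>k. SNeg (full_schema [0..<G] k)) [0..<3])"
        then obtain k where "k < 3" "s = has_kind k \<or> s = SNeg (full_schema [0..<G] k)"
          by auto
        moreover have "atoms (inst x (full_schema [0..<G] k) e) \<subseteq> A"
          by (rule full) (use \<open>k < 3\<close> assms(4) in auto)
        ultimately show "atoms (inst x s e) \<subseteq> A"
          using kind by auto
      qed
    qed (simp add: clash)
  qed
  have kinds: "atoms (inst x (has_kind 2) e) \<subseteq> A" "atoms (inst x (has_kind 1) e) \<subseteq> A"
    by (rule kind; simp)+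
  have final: "atoms (inst x (full_schema L 0) e) \<subseteq> A"
    by (rule full[OF L]) (simp_all add: assms(4))
  show ?thesis
    unfolding run_schema_def A_def[symmetric] inst.simps(3,5) atoms_SAnd atoms.simps(2,4)
      Un_subset_iff
    by (intro conjI bad start kinds final)
qed

context tm_tiling
begin

lemma atoms_machine_schema:
  assumes "N \<ge> 1" "e 0 = 0" "e 5 = N" "e 6 = Suc N" "e 8 = 0"
  shows "atoms (inst x (machine_schema q) e) \<subseteq> props (trace_kripke (Suc N * G))"
proof -
  have "atoms (inst x (machine_schema q) e) \<subseteq> {..<3} \<union> (\<lambda>i. 2 ^ (i + 2)) ` {..<Suc N * G}"
  proof (rule tiling.atoms_run_schema[OF assms])
    show "dj = 0 \<and> g < G" if "pat \<in> set P0 \<union> set PN" "(dk, dj, g) \<in> set pat" for pat dk dj g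
      using that by (auto simp: P0_def PN_def in_mk)
    show "dj \<le> 1 \<and> g < G" if "pat \<in> set P" "(dk, dj, g) \<in> set pat" for pat dk dj g
      using that by (auto simp: P_def in_mk)
  qed (auto simp: ini_less targets_def)
  then show ?thesis
    by (simp add: trace_kripke_def)
qed

end

text \<open>Both halting states are characterised, since satisfiability is reduced to reaching
  acceptance and model checking to never reaching rejection. They exclude each other because a
  halted configuration stays fixed.\<close>

lemma PSPACE_decider:
  assumes "A \<in> PSPACE"
  obtains M :: "nat tm" and d where "wf_tm M" "d \<ge> 1"
    "\<And>x. x \<in> A \<longleftrightarrow> (\<exists>n. fst (run M x n) = accept M)"
    "\<And>x. x \<notin> A \<longleftrightarrow> (\<exists>n. fst (run M x n) = reject M)"
    "\<And>x n c h. (c, h) \<in> set (snd (run M x n)) \<Longrightarrow> h < (length x + 2) ^ d"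
proof -
  obtain M :: "nat tm" and p where M: "wf_tm M" "decides M A" "runs_in_space M (poly p)"
    using assms by (auto simp: PSPACE_def)
  interpret tm_tiling M
    using M(1) by unfold_locales
  obtain d where d: "d \<ge> 1" "\<And>n. poly p n \<le> (n + 2) ^ d"
    using poly_le_power by blast
  have ne: "accept M \<noteq> reject M"
    using M(1) by (simp add: wf_tm_def)
  have unique: False if "fst (run M x n) = accept M" "fst (run M x n') = reject M" for x n n'
  proof -
    have "run M x (max n n') = run M x n" "run M x (max n n') = run M x n'"
      using run_mono_halted[of x n "max n n'"] run_mono_halted[of x n' "max n n'"] that by simp_all
    with that ne show False by simp
  qed
  have yes: "\<exists>n. fst (run M x n) = accept M" if "x \<in> A" for x
    using M(2)[unfolded decides_def, rule_format, of x] that by simp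
  have no: "\<exists>n. fst (run M x n) = reject M" if "x \<notin> A" for x
    using M(2)[unfolded decides_def, rule_format, of x] that by simp
  have "x \<in> A \<longleftrightarrow> (\<exists>n. fst (run M x n) = accept M)" "x \<notin> A \<longleftrightarrow> (\<exists>n. fst (run M x n) = reject M)" for x
    using yes[of x] no[of x] unique[of x] by blast+
  moreover have "h < (length x + 2) ^ d" if "(c, h) \<in> set (snd (run M x n))" for x n c h
    using M(3) d(2)[of "length x"] that unfolding runs_in_space_def by fastforce
  ultimately show thesis
    using that M(1) d(1) by blast
qed

lemma env_simps:
  "env d n 0 = 0" "env d n 5 = (n + 2) ^ d" "env d n 6 = Suc ((n + 2) ^ d)"
  "env d n 7 = Suc ((n + 2) ^ d)" "env d n 8 = 0"
  by (simp_all add: env_def)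

lemma PSPACE_hard_SAT:
  assumes sub: "subinterval_relation sub"
  shows "PSPACE_hard (SAT sub)"
  unfolding PSPACE_hard_def
proof
  fix A assume "A \<in> PSPACE"
  then obtain M :: "nat tm" and d where M: "wf_tm M" "d \<ge> 1"
    "\<And>x. x \<in> A \<longleftrightarrow> (\<exists>n. fst (run M x n) = accept M)"
    "\<And>x. x \<notin> A \<longleftrightarrow> (\<exists>n. fst (run M x n) = reject M)"
    "\<And>x n c h. (c, h) \<in> set (snd (run M x n)) \<Longrightarrow> h < (length x + 2) ^ d"
    using PSPACE_decider by metis
  interpret tm_tiling M
    using M(1) by unfold_locales
  let ?N = "\<lambda>x :: bool list. (length x + 2) ^ d"
  let ?\<psi> = "\<lambda>x. inst x (machine_schema (accept M)) (env d (length x))"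
  have N: "1 \<le> ?N x" "length x \<le> ?N x" for x :: "bool list"
    using M(2) self_le_power[of "length x + 2" d] by simp_all
  have "x \<in> A \<longleftrightarrow> satisfiable sub (?\<psi> x)" for x
  proof
    assume "x \<in> A"
    then obtain n where "fst (run M x n) = accept M"
      using M(3) by blast
    then obtain l f where "l > 0" "holds sub (trace_model (map f [0..<l])) (0, l - 1) (?\<psi> x)"
      using machine_schema_complete[where q = "accept M" and N = "?N x" and x = x and n = n,
          OF _ N(1) sub env_simps(1-3,5)] M(5) by blast
    then show "satisfiable sub (?\<psi> x)"
      by (intro trace_satisfiable[of 0 "l - 1" "map f [0..<l]"]) simp_all
  next
    assume "satisfiable sub (?\<psi> x)"
    then obtain w a b where "b < length w" "holds sub (trace_model w) (a, b) (?\<psi> x)"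
      using satisfiable_trace sub by blast
    then show "x \<in> A"
      using machine_schema_sound[where q = "accept M" and N = "?N x" and x = x,
          OF _ N sub env_simps(1-3,5)] M(3) by simp
  qed
  then have "x \<in> A \<longleftrightarrow> emit x (code (machine_schema (accept M))) (env d (length x)) \<in> SAT sub" for x
    by (auto simp: SAT_def emit_code dest: enc_form_inj)
  moreover have "polytime_computable (\<lambda>x. emit x (code (machine_schema (accept M))) (env d (length x)))"
    by (rule polytime_computable_output[OF tiling.scoped_run_schema])
  ultimately show "A \<le>\<^sub>p SAT sub"
    unfolding polytime_reducible_def by blast
qed

lemma PSPACE_hard_MC:
  assumes sub: "subinterval_relation sub"
  shows "PSPACE_hard (MC sub)"
  unfolding PSPACE_hard_def
proof
  fix A assume "A \<in> PSPACE"
  then obtain M :: "nat tm" and d where M: "wf_tm M" "d \<ge> 1"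
    "\<And>x. x \<in> A \<longleftrightarrow> (\<exists>n. fst (run M x n) = accept M)"
    "\<And>x. x \<notin> A \<longleftrightarrow> (\<exists>n. fst (run M x n) = reject M)"
    "\<And>x n c h. (c, h) \<in> set (snd (run M x n)) \<Longrightarrow> h < (length x + 2) ^ d"
    using PSPACE_decider by metis
  interpret tm_tiling M
    using M(1) by unfold_locales
  let ?N = "\<lambda>x :: bool list. (length x + 2) ^ d"
  let ?\<psi> = "\<lambda>x. inst x (machine_schema (reject M)) (env d (length x))"
  let ?K = "\<lambda>x. trace_kripke (Suc (?N x) * G)"
  let ?g = "Cat (kripke_code G) (code (SNeg (machine_schema (reject M))))"
  have N: "1 \<le> ?N x" "length x \<le> ?N x" for x :: "bool list"
    using M(2) self_le_power[of "length x + 2" d] by simp_all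
  have emit: "emit x ?g (env d (length x)) = enc_kripke (?K x) @ enc_form (Neg (?\<psi> x))" for x
    unfolding emit.simps emit_code inst.simps
      emit_kripke_code[where e = "env d (length x)", OF env_simps(3,4)] ..
  have "x \<in> A \<longleftrightarrow> enc_kripke (?K x) @ enc_form (Neg (?\<psi> x)) \<in> MC sub" for x
  proof
    assume "x \<in> A"
    then have no: "\<nexists>n. fst (run M x n) = reject M"
      using M(4) by blast
    have "model_checks sub (?K x) (Neg (?\<psi> x))"
      unfolding model_checks_def
    proof (intro allI impI)
      fix w assume "initial_trace (?K x) w"
      then have "w \<noteq> []"
        by (auto simp: initial_trace_def)
      then have "length w - 1 < length w"
        by simp
      then have "\<not> holds sub (trace_model w) (0, length w - 1) (?\<psi> x)"
        using machine_schema_sound[where q = "reject M" and N = "?N x" and x = x,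
          OF _ N sub env_simps(1-3,5)] no by blast
      then show "holds sub (trace_model w) (0, length w - 1) (Neg (?\<psi> x))"
        by simp
    qed
    moreover have "atoms (Neg (?\<psi> x)) \<subseteq> props (?K x)"
      using atoms_machine_schema[where N = "?N x" and x = x, OF N(1) env_simps(1-3,5)] by simp
    ultimately show "enc_kripke (?K x) @ enc_form (Neg (?\<psi> x)) \<in> MC sub"
      unfolding MC_def using wf_trace_kripke by blast
  next
    assume "enc_kripke (?K x) @ enc_form (Neg (?\<psi> x)) \<in> MC sub"
    then obtain K \<phi> where K: "enc_kripke (?K x) @ enc_form (Neg (?\<psi> x)) = enc_kripke K @ enc_form \<phi>"
      "wf_kripke K" "model_checks sub K \<phi>"
      by (auto simp: MC_def)
    \<comment> \<open>Membership in the language concerns some instance with this code, so its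
      structure and formula are recovered by injectivity, with labels known on the worlds.\<close>
    note eqs = enc_instance_inj[OF K(1) wf_trace_kripke K(2)]
    show "x \<in> A"
    proof (rule ccontr)
      assume "x \<notin> A"
      then obtain n where "fst (run M x n) = reject M"
        using M(4) by blast
      note reach = this
      have "\<exists>l f. l > 0 \<and> f 0 = {} \<and>
          (\<forall>z<l. f z = {} \<or> (\<exists>k<3. \<exists>i<Suc (?N x) * G. f z = {k, 2 ^ (i + 2)})) \<and>
          holds sub (trace_model (map f [0..<l])) (0, l - 1) (?\<psi> x)"
        by (rule machine_schema_complete[where q = "reject M" and x = x and n = n,
              OF _ N(1) sub env_simps(1-3,5) M(5) reach]) simp
      then obtain l f where f: "l > 0" "f 0 = {}"
        "\<forall>z<l. f z = {} \<or> (\<exists>k<3. \<exists>i<Suc (?N x) * G. f z = {k, 2 ^ (i + 2)})"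
        "holds sub (trace_model (map f [0..<l])) (0, l - 1) (?\<psi> x)"
        by (elim exE conjE)
      have "initial_trace K (map f [0..<l])"
      proof (rule initial_trace_map[where f = f, OF f(1,2)])
        show "f z = {} \<or> (\<exists>k<3. \<exists>i<Suc (?N x) * G. f z = {k, 2 ^ (i + 2)})" if "z < l" for z
          using f(3) that by blast
        show "edges K = edges (?K x)" "init K = init (?K x)"
          using eqs by (elim conjE, simp only:)+
        show "label K s = label (?K x) s" if "s \<in> worlds (?K x)" for s
          using eqs that by blast
      qed
      then have "holds sub (trace_model (map f [0..<l])) (0, length (map f [0..<l]) - 1) \<phi>"
        using K(3) unfolding model_checks_def by blast
      moreover have "\<phi> = Neg (?\<psi> x)"
        using eqs by blast
      ultimately show False
        using f(4) by simp
    qed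
  qed
  then have "x \<in> A \<longleftrightarrow> emit x ?g (env d (length x)) \<in> MC sub" for x
    by (simp only: emit)
  moreover have "polytime_computable (\<lambda>x. emit x ?g (env d (length x)))"
    by (rule polytime_computable_output)
      (simp only: scoped.simps code.simps scoped_kripke_code tiling.scoped_run_schema simp_thms)
  ultimately show "A \<le>\<^sub>p MC sub"
    unfolding polytime_reducible_def by blast
qed

theorem theorem5p1:
  "PSPACE_hard (MC proper_sub) \<and> PSPACE_hard (SAT proper_sub) \<and>
   PSPACE_hard (MC strict_sub) \<and> PSPACE_hard (SAT strict_sub)"
  by (simp add: PSPACE_hard_MC PSPACE_hard_SAT subinterval_relation_def)

end
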